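(* Let $p,q\ge2$ be even, with real identity inputs $f_1=\mathrm{id}_{\mathbb S^p}$, $f_2=\mathrm{id}_{\mathbb S^q}$. Fix a positive smooth $P$-periodic $F$ and $\kappa\in\mathbb R$. Set $S_P^1=\mathbb R/P\mathbb Z$, $I_F=\int_0^PF^{-1}\,dt$ and $\tau(t)=\int_{t_0}^tF(\xi)^{-1}\,d\xi$. For every integer $m\ge1$, the single metric $g_{F,\kappa}$ carries a harmonic map $$G_m:S_P^1\times\mathbb S^p\times\mathbb S^q\longrightarrow\mathbb S^{p+q+1},\qquad (t,x,y)\longmapsto\bigl(\cos\Theta_m(\tau(t))\,x,\ \sin\Theta_m(\tau(t))\,y\bigr)$$ of degree $4m$, where $\Theta_m$ is a smooth real function with $\Theta_m(\tau+I_F)=\Theta_m(\tau)+2\pi m$. The target is the smallest real sphere containing the image.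
   Context: $\mathbb S^n$ is the unit round sphere in $\mathbb R^{n+1}$, and $\mathbb S^{p+q+1}\subset\mathbb R^{p+1}\oplus\mathbb R^{q+1}$. The metric is $g_{F,\kappa}=dt^2+\ell_1^2g_{\mathbb S^p}+\ell_2^2g_{\mathbb S^q}$ on $S^1_P\times\mathbb S^p\times\mathbb S^q$, where $(\ell_1,\ell_2)$ is the unique pair of positive ($P$-periodic, smooth) functions with $$\ell_1^{p}\ell_2^{q}=F,\qquad \frac{q}{\ell_2^2}-\frac{p}{\ell_1^2}=\frac{\kappa}{F^2}.$$ A map $f$ into a unit sphere is harmonic iff $\Delta f=-|df|^2f$. Degree is taken with the product orientation given by increasing $t$ and the standard orientations of $\mathbb S^p$, $\mathbb S^q$, and the standard orientation of $\mathbb S^{p+q+1}$ with target coordinates ordered by the $x$-block and then the $y$-block. *)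

theory Defs
  imports "HOL-Analysis.Analysis" "Jordan_Normal_Form.Determinant"
begin

subsection \<open>Smooth maps and charts\<close>

primrec Ck_on :: "nat \<Rightarrow> ('a::real_normed_vector \<Rightarrow> 'b::real_normed_vector) \<Rightarrow> 'a set \<Rightarrow> bool" where
  "Ck_on 0 f U \<longleftrightarrow> continuous_on U f"
| "Ck_on (Suc k) f U \<longleftrightarrow> (\<forall>x\<in>U. f differentiable (at x)) \<and>
     (\<forall>v. Ck_on k (\<lambda>x. frechet_derivative f (at x) v) U)"

text \<open>Meant for open \<open>U\<close> and finite-dimensional domains.\<close>

definition smooth_on :: "'a set \<Rightarrow> ('a::real_normed_vector \<Rightarrow> 'b::real_normed_vector) \<Rightarrow> bool" where
  "smooth_on U f \<longleftrightarrow> (\<forall>k. Ck_on k f U)"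

text \<open>A smooth local parametrization (inverse chart) of an embedded submanifold \<open>M\<close> of
  dimension \<open>CARD('d)\<close> of a Euclidean space.\<close>

definition local_param ::
  "'e::euclidean_space set \<Rightarrow> (real^'d) set \<Rightarrow> (real^'d \<Rightarrow> 'e) \<Rightarrow> bool" where
  "local_param M U \<phi> \<longleftrightarrow>
     open U \<and> smooth_on U \<phi> \<and> (\<forall>u\<in>U. inj (frechet_derivative \<phi> (at u))) \<and>
     (\<exists>\<psi>. homeomorphism U (\<phi> ` U) \<phi> \<psi>) \<and> openin (top_of_set M) (\<phi> ` U)"

subsection \<open>Laplace--Beltrami operator and harmonic maps into spheres\<close>

text \<open>A Riemannian metric on \<open>M\<close> is given as \<open>g z v w\<close> for \<open>z \<in> M\<close> and \<open>v\<close>, \<open>w\<close> in the tangent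
  space of \<open>M\<close> at \<open>z\<close>, regarded as a subspace of the ambient space.\<close>

type_synonym 'e riem_metric = "'e \<Rightarrow> 'e \<Rightarrow> 'e \<Rightarrow> real"

definition pderiv_at :: "'d::finite \<Rightarrow> (real^'d \<Rightarrow> 'b::real_normed_vector) \<Rightarrow> real^'d \<Rightarrow> 'b" where
  "pderiv_at i h u = frechet_derivative h (at u) (axis i 1)"

definition metric_coeffs ::
  "'e::euclidean_space riem_metric \<Rightarrow> (real^'d \<Rightarrow> 'e) \<Rightarrow> real^'d \<Rightarrow> real^'d^'d" where
  "metric_coeffs g \<phi> u = (\<chi> i j. g (\<phi> u) (pderiv_at i \<phi> u) (pderiv_at j \<phi> u))"

definition metric_coeffs_inv ::
  "'e::euclidean_space riem_metric \<Rightarrow> (real^'d \<Rightarrow> 'e) \<Rightarrow> real^'d \<Rightarrow> real^'d^'d" where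
  "metric_coeffs_inv g \<phi> u = matrix_inv (metric_coeffs g \<phi> u)"

definition volume_density ::
  "'e::euclidean_space riem_metric \<Rightarrow> (real^'d \<Rightarrow> 'e) \<Rightarrow> real^'d \<Rightarrow> real" where
  "volume_density g \<phi> u = sqrt (Determinants.det (metric_coeffs g \<phi> u))"

text \<open>The Laplacian (divergence of the gradient, so nonpositive on functions) and the squared norm
  of the differential of \<open>f\<close>, in the coordinates given by \<open>\<phi>\<close>.\<close>

definition laplace_beltrami ::
  "'e::euclidean_space riem_metric \<Rightarrow> (real^'d \<Rightarrow> 'e) \<Rightarrow> ('e \<Rightarrow> 'c::euclidean_space) \<Rightarrow> real^'d \<Rightarrow> 'c"
where
  "laplace_beltrami g \<phi> f u =
     (1 / volume_density g \<phi> u) *\<^sub>R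
     (\<Sum>i\<in>UNIV. pderiv_at i (\<lambda>u'. volume_density g \<phi> u' *\<^sub>R
        (\<Sum>j\<in>UNIV. (metric_coeffs_inv g \<phi> u' $ i $ j) *\<^sub>R pderiv_at j (f \<circ> \<phi>) u')) u)"

definition energy_density ::
  "'e::euclidean_space riem_metric \<Rightarrow> (real^'d \<Rightarrow> 'e) \<Rightarrow> ('e \<Rightarrow> 'c::euclidean_space) \<Rightarrow> real^'d \<Rightarrow> real"
where
  "energy_density g \<phi> f u =
     (\<Sum>i\<in>UNIV. \<Sum>j\<in>UNIV. (metric_coeffs_inv g \<phi> u $ i $ j) *
        inner (pderiv_at i (f \<circ> \<phi>) u) (pderiv_at j (f \<circ> \<phi>) u))"

text \<open>Both quantities above are independent of the coordinates, so it suffices that every point of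
  \<open>M\<close> lies in some chart in which \<open>f\<close> is smooth and the equation holds.  The first argument fixes
  the dimension \<open>CARD('d)\<close> of \<open>M\<close>.\<close>

definition harmonic_into_sphere ::
  "'d::finite itself \<Rightarrow> 'e::euclidean_space set \<Rightarrow> 'e riem_metric \<Rightarrow> ('e \<Rightarrow> 'c::euclidean_space) \<Rightarrow> bool"
where
  "harmonic_into_sphere _ M g f \<longleftrightarrow> f ` M \<subseteq> sphere 0 1 \<and>
     (\<forall>z\<in>M. \<exists>(U::(real^'d) set) \<phi>. local_param M U \<phi> \<and> z \<in> \<phi> ` U \<and> smooth_on U (f \<circ> \<phi>) \<and>
        (\<forall>u\<in>U. laplace_beltrami g \<phi> f u = - (energy_density g \<phi> f u *\<^sub>R f (\<phi> u))))"

subsection \<open>The domain and its metric\<close>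

text \<open>The circle of length \<open>P\<close> is treated through its universal cover: maps on the product of
  \<open>\<real>/P\<int>\<close> with two spheres are maps on the set below that are \<open>P\<close>-periodic in the first variable.\<close>

definition line_spheres :: "(real \<times> 'a::euclidean_space \<times> 'b::euclidean_space) set" where
  "line_spheres = UNIV \<times> sphere 0 1 \<times> sphere 0 1"

definition periodic :: "real \<Rightarrow> (real \<Rightarrow> real) \<Rightarrow> bool" where
  "periodic P h \<longleftrightarrow> (\<forall>t. h (t + P) = h t)"

definition periodic_map ::
  "real \<Rightarrow> (real \<times> 'a::euclidean_space \<times> 'b::euclidean_space \<Rightarrow> 'c) \<Rightarrow> bool" where
  "periodic_map P f \<longleftrightarrow> (\<forall>t. \<forall>x\<in>sphere 0 1. \<forall>y\<in>sphere 0 1. f (t + P, x, y) = f (t, x, y))"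

definition fibre_radii ::
  "nat \<Rightarrow> nat \<Rightarrow> real \<Rightarrow> (real \<Rightarrow> real) \<Rightarrow> real \<Rightarrow> (real \<Rightarrow> real) \<times> (real \<Rightarrow> real)" where
  "fibre_radii p q P F \<kappa> = (THE (l1, l2).
     (\<forall>t. 0 < l1 t) \<and> (\<forall>t. 0 < l2 t) \<and> periodic P l1 \<and> periodic P l2 \<and>
     smooth_on UNIV l1 \<and> smooth_on UNIV l2 \<and>
     (\<forall>t. l1 t ^ p * l2 t ^ q = F t) \<and>
     (\<forall>t. real q / (l2 t)\<^sup>2 - real p / (l1 t)\<^sup>2 = \<kappa> / (F t)\<^sup>2))"

definition metric_F ::
  "nat \<Rightarrow> nat \<Rightarrow> real \<Rightarrow> (real \<Rightarrow> real) \<Rightarrow> real \<Rightarrow>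
   (real \<times> 'a::euclidean_space \<times> 'b::euclidean_space) riem_metric" where
  "metric_F p q P F \<kappa> = (\<lambda>(t, x, y) (s, v, w) (s', v', w').
     s * s' + (fst (fibre_radii p q P F \<kappa>) t)\<^sup>2 * inner v v'
            + (snd (fibre_radii p q P F \<kappa>) t)\<^sup>2 * inner w w')"

text \<open>The interval integral is oriented, so \<open>t < t0\<close> is allowed.\<close>

definition tau :: "(real \<Rightarrow> real) \<Rightarrow> real \<Rightarrow> real \<Rightarrow> real" where
  "tau F t0 t = (LBINT \<xi>=ereal t0..ereal t. 1 / F \<xi>)"

definition I_F :: "(real \<Rightarrow> real) \<Rightarrow> real \<Rightarrow> real" where
  "I_F F P = (LBINT \<xi>=ereal 0..ereal P. 1 / F \<xi>)"

definition G_map ::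
  "(real \<Rightarrow> real) \<Rightarrow> real \<Rightarrow> (real \<Rightarrow> real) \<Rightarrow>
   real \<times> 'a::euclidean_space \<times> 'b::euclidean_space \<Rightarrow> 'a \<times> 'b" where
  "G_map F t0 \<Theta> = (\<lambda>(t, x, y). (cos (\<Theta> (tau F t0 t)) *\<^sub>R x, sin (\<Theta> (tau F t0 t)) *\<^sub>R y))"

subsection \<open>Orientations and degree\<close>

text \<open>The determinant of a list of vectors in the coordinates of an ordered orthonormal basis \<open>B\<close>,
  and the ordered bases that give the standard orientations.\<close>

definition frame_det :: "'e::euclidean_space list \<Rightarrow> 'e list \<Rightarrow> real" where
  "frame_det B vs =
     Determinant.det (Matrix.mat (length vs) (length B) (\<lambda>(i, j). inner (vs ! i) (B ! j)))"

definition std_basis :: "(real^'n::{finite,linorder}) list" where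
  "std_basis = map (\<lambda>i. axis i 1) (sorted_list_of_set UNIV)"

definition std_basis_sum ::
  "((real^'n::{finite,linorder}) \<times> (real^'m::{finite,linorder})) list" where
  "std_basis_sum = map (\<lambda>e. (e, 0)) std_basis @ map (\<lambda>e. (0, e)) std_basis"

text \<open>Spheres are oriented as boundaries of balls (outward normal first).\<close>

definition positive_frame :: "(real^'n::{finite,linorder}) \<Rightarrow> (real^'n::{finite,linorder}) list \<Rightarrow> bool" where
  "positive_frame x vs \<longleftrightarrow> length vs + 1 = CARD('n) \<and> (\<forall>v\<in>set vs. inner x v = 0) \<and>
     0 < frame_det std_basis (x # vs)"

text \<open>A frame at \<open>(t, x, y)\<close> for the product orientation.\<close>

definition product_frame ::
  "real \<times> (real^'a::{finite,linorder}) \<times> (real^'b::{finite,linorder}) \<Rightarrow>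
   (real \<times> (real^'a::{finite,linorder}) \<times> (real^'b::{finite,linorder})) list" where
  "product_frame = (\<lambda>(t, x, y).
     (1, 0, 0) # map (\<lambda>v. (0, v, 0)) (SOME vs. positive_frame x vs)
               @ map (\<lambda>w. (0, 0, w)) (SOME ws. positive_frame y ws))"

text \<open>The derivative of a map defined on \<open>line_spheres\<close>; only its values on tangent vectors, where
  it is uniquely determined, are used.\<close>

definition differential ::
  "(real \<times> 'a::euclidean_space \<times> 'b::euclidean_space \<Rightarrow> 'c::euclidean_space) \<Rightarrow>
   real \<times> 'a \<times> 'b \<Rightarrow> real \<times> 'a \<times> 'b \<Rightarrow> 'c" where
  "differential f z = frechet_derivative f (at z within line_spheres)"

definition local_sign ::
  "(real \<times> (real^'a::{finite,linorder}) \<times> (real^'b::{finite,linorder}) \<Rightarrow> (real^'a::{finite,linorder}) \<times> (real^'b::{finite,linorder})) \<Rightarrow>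
   real \<times> (real^'a::{finite,linorder}) \<times> (real^'b::{finite,linorder}) \<Rightarrow> real" where
  "local_sign f z = sgn (frame_det std_basis_sum (f z # map (differential f z) (product_frame z)))"

definition regular_value ::
  "(real \<times> 'a::euclidean_space \<times> 'b::euclidean_space \<Rightarrow> 'c::euclidean_space) \<Rightarrow> 'c \<Rightarrow> bool" where
  "regular_value f w \<longleftrightarrow> w \<in> sphere 0 1 \<and>
     (\<forall>(t, x, y)\<in>line_spheres. f (t, x, y) = w \<longrightarrow>
        differential f (t, x, y) ` (UNIV \<times> {v. inner x v = 0} \<times> {v. inner y v = 0})
          = {v. inner w v = 0})"

text \<open>Degree of a smooth \<open>P\<close>-periodic map as the signed number of preimages, in one period, of any
  regular value.\<close>

definition has_degree ::
  "real \<Rightarrow> (real \<times> (real^'a::{finite,linorder}) \<times> (real^'b::{finite,linorder}) \<Rightarrow>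
     (real^'a::{finite,linorder}) \<times> (real^'b::{finite,linorder})) \<Rightarrow> int \<Rightarrow> bool" where
  "has_degree P f d \<longleftrightarrow> (\<exists>w. regular_value f w) \<and>
     (\<forall>w. regular_value f w \<longrightarrow>
        (let fib = {z \<in> line_spheres. 0 \<le> fst z \<and> fst z < P \<and> f z = w}
         in finite fib \<and> (\<Sum>z\<in>fib. local_sign f z) = of_int d))"

subsection \<open>Round spheres\<close>

text \<open>Spheres of arbitrary dimension, center and radius; great subspheres of the unit sphere are
  the case of the center \<open>0\<close> and radius \<open>1\<close>.\<close>

definition round_sphere :: "'e::euclidean_space set \<Rightarrow> bool" where
  "round_sphere S \<longleftrightarrow> (\<exists>A c r. affine A \<and> c \<in> A \<and> 0 < r \<and> S = A \<inter> sphere c r)"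

end

(* With \<alpha> = \<Theta> \<circ> \<tau> the harmonic map equation for (cos \<alpha> x, sin \<alpha> y) reduces, thanks to the relation
   between the two radii, to the pendulum equation \<Theta>'' = \<kappa> sin \<Theta> cos \<Theta> in the variable \<tau>, with the
   same \<kappa> for all m.  A rotating pendulum orbit is the inverse of
   \<theta> \<mapsto> \<integral> d\<theta> / sqrt (E + \<kappa> sin^2 \<theta>); the time it needs for m turns runs through all positive numbers
   as the energy E varies, so that I_F can be prescribed.  Since \<alpha> increases, a point both of whose
   blocks are nonzero has exactly 4m preimages in one period; since p and q are even, the factors
   cos^p \<alpha> and sin^q \<alpha> of the Jacobian are positive at each of them. *)

theory Submission
  imports Defs
begin

text \<open>Why one metric serves every m: the condition \<open>l1 ^ p * l2 ^ q = F\<close> makes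
  \<open>F\<close> the t-dependence of the volume density, and the relation of the radii replaces
  q/l2^2 - p/l1^2 by \<kappa>/F^2. The harmonic map equation becomes F (F \<alpha>')' = \<kappa> sin
  \<alpha> cos \<alpha>, which is autonomous because F d/dt = d/d\<tau>; so m enters only through
  the energy of the orbit. The definitions shape the rest. The radii are a definite description, so
  existence, smoothness and uniqueness are all due. Harmonicity is tested in charts: stereographic
  projections from the poles opposite to the given point make the metric diagonal, and the sphere
  coordinates are Laplace eigenfunctions with eigenvalues -p and -q. The degree speaks about every
  regular value, so these have to be determined exactly. The minimality of the target comes from
  surjectivity: the image is the whole unit sphere.\<close>

no_notation scalar_prod (infix "\<bullet>" 70)
no_notation vec_index (infixl "$" 100)

subsection \<open>Calculus of smooth maps\<close>

lemma frechet_derivative_eqI: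
  "(f has_derivative D) (at x) \<Longrightarrow> frechet_derivative f (at x) = D"
  by (rule frechet_derivative_at[symmetric])

text \<open>By uniqueness of derivatives, any explicitly written \<open>D\<close> may stand for
  \<open>frechet_derivative\<close>. With the converse \<open>Ck_on_SucD\<close>, the closure
  properties below become inductions on k that use the usual differentiation rules.\<close>

lemma Ck_on_SucI:
  assumes "\<And>x. (f has_derivative D x) (at x)" and "\<And>v. Ck_on k (\<lambda>x. D x v) UNIV"
  shows "Ck_on (Suc k) f UNIV"
proof -
  have "frechet_derivative f (at x) = D x" for x
    using assms(1) by (rule frechet_derivative_eqI)
  with assms show ?thesis by (auto simp: differentiable_def)
qed

lemma Ck_on_SucD:
  assumes "Ck_on (Suc k) f UNIV"
  obtains D where "\<And>x. (f has_derivative D x) (at x)" and "\<And>v. Ck_on k (\<lambda>x. D x v) UNIV"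
proof
  show "(f has_derivative frechet_derivative f (at x)) (at x)" for x
    using assms by (auto simp: frechet_derivative_works[symmetric])
  show "Ck_on k (\<lambda>x. frechet_derivative f (at x) v) UNIV" for v
    using assms by auto
qed

lemma Ck_on_Suc_real:
  fixes f :: "real \<Rightarrow> real"
  assumes "\<And>x. (f has_real_derivative f' x) (at x)"
  shows "Ck_on (Suc k) f UNIV \<longleftrightarrow> (\<forall>v. Ck_on k (\<lambda>x. f' x * v) UNIV)"
proof -
  have D: "(f has_derivative (*) (f' x)) (at x)" for x
    using assms[of x] by (simp add: has_field_derivative_def)
  then have "frechet_derivative f (at x) = (*) (f' x)" for x by (rule frechet_derivative_eqI)
  with D show ?thesis by (auto simp: differentiable_def)
qed

declare Ck_on.simps(2) [simp del]

lemma Ck_on_Suc_imp: "Ck_on (Suc k) f UNIV \<Longrightarrow> Ck_on k f UNIV"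
proof (induction k arbitrary: f)
  case 0
  then obtain D where "\<And>x. (f has_derivative D x) (at x)" by (rule Ck_on_SucD) blast
  then show ?case
    by (auto intro: continuous_at_imp_continuous_on has_derivative_continuous)
next
  case (Suc k)
  from Suc.prems obtain D where "\<And>x. (f has_derivative D x) (at x)"
    and "\<And>v. Ck_on (Suc k) (\<lambda>x. D x v) UNIV" by (rule Ck_on_SucD) blast
  then show ?case by (intro Ck_on_SucI[of f D] Suc.IH)
qed

lemma Ck_on_const: "Ck_on k (\<lambda>x. c) UNIV"
proof (induction k arbitrary: c)
  case (Suc k)
  show ?case by (rule Ck_on_SucI[where D = "\<lambda>x v. 0"]) (simp_all add: Suc.IH)
qed simp

lemma Ck_on_linear:
  assumes "bounded_linear f" shows "Ck_on k f UNIV"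
proof (cases k)
  case 0
  then show ?thesis using assms by (simp add: linear_continuous_on)
next
  case (Suc j)
  show ?thesis unfolding Suc
    by (rule Ck_on_SucI[where D = "\<lambda>x. f"])
      (rule bounded_linear.has_derivative[OF assms has_derivative_ident] Ck_on_const)+
qed

lemma Ck_on_linear_comp:
  assumes "bounded_linear L" "Ck_on k f UNIV" shows "Ck_on k (\<lambda>x. L (f x)) UNIV"
  using assms(2)
proof (induction k arbitrary: f)
  case 0
  then show ?case
    using continuous_on_compose2[OF linear_continuous_on[OF assms(1)], of UNIV f UNIV] by simp
next
  case (Suc k)
  obtain D where D: "\<And>x. (f has_derivative D x) (at x)"
    "\<And>v. Ck_on k (\<lambda>x. D x v) UNIV" using Suc.prems by (rule Ck_on_SucD) blast
  show ?case
    by (rule Ck_on_SucI[where D = "\<lambda>x v. L (D x v)"])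
      (rule bounded_linear.has_derivative[OF assms(1) D(1)] Suc.IH[OF D(2)])+
qed

lemma Ck_on_add:
  assumes "Ck_on k f UNIV" "Ck_on k g UNIV" shows "Ck_on k (\<lambda>x. f x + g x) UNIV"
  using assms
proof (induction k arbitrary: f g)
  case 0
  then show ?case by (auto intro: continuous_intros)
next
  case (Suc k)
  obtain D where D: "\<And>x. (f has_derivative D x) (at x)"
    "\<And>v. Ck_on k (\<lambda>x. D x v) UNIV" using Suc.prems(1) by (rule Ck_on_SucD) blast
  obtain E where E: "\<And>x. (g has_derivative E x) (at x)"
    "\<And>v. Ck_on k (\<lambda>x. E x v) UNIV" using Suc.prems(2) by (rule Ck_on_SucD) blast
  show ?case
    by (rule Ck_on_SucI[where D = "\<lambda>x v. D x v + E x v"])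
      (rule has_derivative_add[OF D(1) E(1)] Suc.IH[OF D(2) E(2)])+
qed

lemma Ck_on_sum:
  assumes "\<And>i. i \<in> I \<Longrightarrow> Ck_on k (f i) UNIV"
  shows "Ck_on k (\<lambda>x. \<Sum>i\<in>I. f i x) UNIV"
  using assms
  by (induction I rule: infinite_finite_induct) (auto intro: Ck_on_const Ck_on_add)

lemma Ck_on_bilinear:
  assumes "bounded_bilinear B" "Ck_on k f UNIV" "Ck_on k g UNIV"
  shows "Ck_on k (\<lambda>x. B (f x) (g x)) UNIV"
  using assms(2,3)
proof (induction k arbitrary: f g)
  case 0
  then show ?case
    using bounded_bilinear.continuous_on[OF assms(1), of UNIV f g] by simp
next
  case (Suc k)
  note lower = Suc.prems[THEN Ck_on_Suc_imp]
  obtain D where D: "\<And>x. (f has_derivative D x) (at x)"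
    "\<And>v. Ck_on k (\<lambda>x. D x v) UNIV" using Suc.prems(1) by (rule Ck_on_SucD) blast
  obtain E where E: "\<And>x. (g has_derivative E x) (at x)"
    "\<And>v. Ck_on k (\<lambda>x. E x v) UNIV" using Suc.prems(2) by (rule Ck_on_SucD) blast
  show ?case
    by (rule Ck_on_SucI[where D = "\<lambda>x v. B (f x) (E x v) + B (D x v) (g x)"])
      (rule bounded_bilinear.FDERIV[OF assms(1) D(1) E(1)]
        Ck_on_add[OF Suc.IH[OF lower(1) E(2)] Suc.IH[OF D(2) lower(2)]])+
qed

lemmas Ck_on_scaleR = Ck_on_bilinear[OF bounded_bilinear_scaleR]
lemmas Ck_on_mult = Ck_on_bilinear[OF bounded_bilinear_mult]

lemma Ck_on_Pair:
  assumes "Ck_on k f UNIV" "Ck_on k g UNIV" shows "Ck_on k (\<lambda>x. (f x, g x)) UNIV"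
proof -
  have "Ck_on k (\<lambda>x. (f x, 0) + (0, g x)) UNIV"
    by (intro Ck_on_add Ck_on_linear_comp[of "\<lambda>y. (y, 0)"] Ck_on_linear_comp[of "\<lambda>y. (0, y)"]
        assms bounded_linear_Pair bounded_linear_ident bounded_linear_zero)
  then show ?thesis by simp
qed

text \<open>The chain rule gives \<open>E (g x) (D x v)\<close>, where the direction varies with
  \<open>x\<close>, so the induction hypothesis does not apply to it. With a real intermediate
  variable, linearity rewrites it as \<open>D x v * E (g x) 1\<close>, a product of two functions
  that the induction covers.\<close>

lemma Ck_on_compose_real:
  fixes h :: "real \<Rightarrow> real"
  assumes "Ck_on k h UNIV" "Ck_on k g UNIV" shows "Ck_on k (\<lambda>x. h (g x)) UNIV"
  using assms
proof (induction k arbitrary: h g)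
  case 0
  then show ?case using continuous_on_compose2[of UNIV h UNIV g] by simp
next
  case (Suc k)
  obtain D where D: "\<And>x. (g has_derivative D x) (at x)"
    "\<And>v. Ck_on k (\<lambda>x. D x v) UNIV" using Suc.prems(2) by (rule Ck_on_SucD) blast
  obtain E where E: "\<And>x. (h has_derivative E x) (at x)"
    "\<And>v. Ck_on k (\<lambda>x. E x v) UNIV" using Suc.prems(1) by (rule Ck_on_SucD) blast
  have lin: "E x v = v * E x 1" for x v
    using linear_scale[OF bounded_linear.linear[OF has_derivative_bounded_linear[OF E(1)[of x]]], of v 1]
    by simp
  have "((\<lambda>x. h (g x)) has_derivative (\<lambda>v. E (g x) (D x v))) (at x)" for x
    by (rule has_derivative_compose[OF D(1) E(1)])
  then have "((\<lambda>x. h (g x)) has_derivative (\<lambda>v. D x v * E (g x) 1)) (at x)" for x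
    by (subst (asm) lin)
  moreover have "Ck_on k (\<lambda>x. E (g x) 1) UNIV"
    by (rule Suc.IH[OF E(2) Ck_on_Suc_imp[OF Suc.prems(2)]])
  ultimately show ?case
    by (intro Ck_on_SucI[where D = "\<lambda>x v. D x v * E (g x) 1"] Ck_on_mult D(2))
qed

lemma Ck_on_power:
  fixes f :: "'a::real_normed_vector \<Rightarrow> real"
  assumes "Ck_on k f UNIV" shows "Ck_on k (\<lambda>x. f x ^ n) UNIV"
  by (induction n) (auto intro: Ck_on_const Ck_on_mult assms)

text \<open>The derivative is a product of \<open>inverse f\<close> with itself and
  \<open>D\<close>, so the order of \<open>inverse f\<close> grows by one at each step. The square
  root below works in the same way.\<close>

lemma Ck_on_inverse:
  fixes f :: "'a::real_normed_vector \<Rightarrow> real"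
  assumes "Ck_on k f UNIV" "\<And>x. f x \<noteq> 0" shows "Ck_on k (\<lambda>x. inverse (f x)) UNIV"
  using assms(1)
proof (induction k)
  case 0
  then show ?case using assms(2) by (auto intro: continuous_intros)
next
  case (Suc k)
  note lower = Suc.prems[THEN Ck_on_Suc_imp]
  obtain D where D: "\<And>x. (f has_derivative D x) (at x)"
    "\<And>v. Ck_on k (\<lambda>x. D x v) UNIV" using Suc.prems by (rule Ck_on_SucD) blast
  have "((\<lambda>x. inverse (f x)) has_derivative (\<lambda>v. (-1) * (inverse (f x) * D x v * inverse (f x)))) (at x)"
    for x using Deriv.has_derivative_inverse[OF assms(2) D(1)] by simp
  then show ?case
    by (rule Ck_on_SucI) (intro Ck_on_mult Ck_on_const D(2) Suc.IH[OF lower])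
qed

lemma Ck_on_divide:
  fixes f g :: "'a::real_normed_vector \<Rightarrow> real"
  assumes "Ck_on k f UNIV" "Ck_on k g UNIV" "\<And>x. g x \<noteq> 0"
  shows "Ck_on k (\<lambda>x. f x / g x) UNIV"
  unfolding divide_inverse by (intro Ck_on_mult Ck_on_inverse assms)

lemma Ck_on_sqrt:
  fixes f :: "'a::real_normed_vector \<Rightarrow> real"
  assumes "Ck_on k f UNIV" "\<And>x. 0 < f x" shows "Ck_on k (\<lambda>x. sqrt (f x)) UNIV"
  using assms(1)
proof (induction k)
  case 0
  then show ?case by (auto intro: continuous_intros)
next
  case (Suc k)
  note lower = Suc.prems[THEN Ck_on_Suc_imp]
  obtain D where D: "\<And>x. (f has_derivative D x) (at x)"
    "\<And>v. Ck_on k (\<lambda>x. D x v) UNIV" using Suc.prems by (rule Ck_on_SucD) blast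
  have nz: "2 * sqrt (f x) \<noteq> 0" for x using assms(2)[of x] by simp
  have "((\<lambda>x. sqrt (f x)) has_derivative (\<lambda>v. D x v * inverse (2 * sqrt (f x)))) (at x)" for x
    using has_derivative_real_sqrt[OF assms(2) D(1)] by (simp add: field_simps)
  then show ?case
    by (rule Ck_on_SucI) (intro Ck_on_mult Ck_on_inverse Ck_on_const D(2) Suc.IH[OF lower] nz)
qed

lemma Ck_on_sin_cos: "Ck_on k (sin :: real \<Rightarrow> real) UNIV \<and> Ck_on k (cos :: real \<Rightarrow> real) UNIV"
proof (induction k)
  case 0
  then show ?case by (auto intro: continuous_intros)
next
  case (Suc k)
  have "Ck_on (Suc k) (sin :: real \<Rightarrow> real) UNIV"
    by (subst Ck_on_Suc_real[OF DERIV_sin]) (intro allI Ck_on_mult Ck_on_const conjunct2[OF Suc])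
  moreover have "Ck_on k (\<lambda>x::real. sin x * (- 1) * v) UNIV" for v
    by (intro Ck_on_mult Ck_on_const conjunct1[OF Suc])
  then have "Ck_on (Suc k) (cos :: real \<Rightarrow> real) UNIV"
    by (subst Ck_on_Suc_real[OF DERIV_cos]) simp
  ultimately show ?case ..
qed

lemma smooth_on_0: "smooth_on UNIV f \<Longrightarrow> continuous_on UNIV f"
  unfolding smooth_on_def by (metis Ck_on.simps(1))

lemma smooth_on_differentiable: "smooth_on UNIV f \<Longrightarrow> f differentiable (at x)"
  unfolding smooth_on_def using Ck_on.simps(2)[of 0 f UNIV] by blast

text \<open>Regularity gain for functions whose derivative is a smooth expression in the function
  itself and known smooth data: order k for \<open>f\<close> gives order k for \<open>f'\<close>,
  hence order k + 1 for \<open>f\<close>. It serves the inverse functions \<open>\<beta>\<close> and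
  \<open>\<Theta>\<close>, and \<open>tau\<close>.\<close>

lemma smooth_on_bootstrap:
  fixes f :: "real \<Rightarrow> real"
  assumes "\<And>x. (f has_real_derivative f' x) (at x)"
    and "\<And>k. Ck_on k f UNIV \<Longrightarrow> Ck_on k f' UNIV"
  shows "smooth_on UNIV f"
  unfolding smooth_on_def
proof
  fix k show "Ck_on k f UNIV"
  proof (induction k)
    case 0
    show ?case
      using assms(1) DERIV_isCont by (auto simp: continuous_on_eq_continuous_at)
  next
    case (Suc k)
    then show ?case
      by (subst Ck_on_Suc_real[OF assms(1)]) (intro allI Ck_on_mult Ck_on_const assms(2))
  qed
qed

lemma smooth_on_real_derivative:
  fixes f :: "real \<Rightarrow> real"
  assumes "smooth_on UNIV f" "\<And>x. (f has_real_derivative f' x) (at x)"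
  shows "smooth_on UNIV f'"
  unfolding smooth_on_def
proof
  fix k
  have "\<forall>v. Ck_on k (\<lambda>x. f' x * v) UNIV"
    using assms by (metis Ck_on_Suc_real smooth_on_def)
  from this[rule_format, of 1] show "Ck_on k f' UNIV" by simp
qed

lemma smooth_on_DERIV:
  fixes f :: "real \<Rightarrow> real"
  assumes "smooth_on UNIV f"
  shows "(f has_real_derivative deriv f x) (at x)"
  using smooth_on_differentiable[OF assms] 
  by (simp add: DERIV_deriv_iff_real_differentiable)

text \<open>The rule for inverse functions presupposes continuity of \<open>g\<close>, which comes
  from \<open>g\<close> inverting \<open>f\<close> on a closed interval around \<open>g y\<close>.
  The open sets are there because \<open>Q\<close> below is inverted only on a half-line.\<close>

lemma has_real_derivative_inverse_on_open:
  fixes f g :: "real \<Rightarrow> real"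
  assumes "open S" "open T" "y \<in> T" "g y \<in> S"
    and fg: "\<And>y. y \<in> T \<Longrightarrow> f (g y) = y" and gf: "\<And>x. x \<in> S \<Longrightarrow> g (f x) = x"
    and der: "\<And>x. x \<in> S \<Longrightarrow> (f has_real_derivative f' x) (at x)" and nz: "f' (g y) \<noteq> 0"
  shows "(g has_real_derivative inverse (f' (g y))) (at y)"
proof -
  obtain e where "e > 0" and e: "cball (g y) e \<subseteq> S"
    using \<open>open S\<close> \<open>g y \<in> S\<close> open_contains_cball by blast
  have in_S: "z \<in> S" if "\<bar>z - g y\<bar> \<le> e" for z
    using e that by (auto simp: dist_real_def abs_minus_commute)
  have "isCont g (f (g y))"
  proof (rule isCont_inverse_function[where f = f and x = "g y", OF \<open>e > 0\<close>])
    show "g (f z) = z" if "\<bar>z - g y\<bar> \<le> e" for z using gf[OF in_S[OF that]] .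
    show "isCont f z" if "\<bar>z - g y\<bar> \<le> e" for z using der[OF in_S[OF that]] by (rule DERIV_isCont)
  qed
  then have cont: "isCont g y" using fg \<open>y \<in> T\<close> by simp
  obtain d where "d > 0" and d: "ball y d \<subseteq> T"
    using \<open>open T\<close> \<open>y \<in> T\<close> open_contains_ball by blast
  show ?thesis
  proof (rule DERIV_inverse_function[OF der nz _ _ _ cont])
    show "y - d < y" "y < y + d" using \<open>d > 0\<close> by auto
    show "f (g z) = z" if "y - d < z" "z < y + d" for z
      using fg d that by (auto simp: dist_real_def subset_eq)
  qed (use assms in auto)
qed

subsection \<open>The fibre radii\<close>

text \<open>At fixed volume a larger \<open>a\<close> forces a smaller \<open>b\<close>, and both
  changes increase q/b^2 - p/a^2 strictly.\<close>

lemma fibre_radii_unique: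
  fixes a b a' b' :: real
  assumes "0 < p" "0 < q" "0 < a" "0 < b" "0 < a'" "0 < b'"
    and vol: "a ^ p * b ^ q = a' ^ p * b' ^ q"
    and eq: "real q / b\<^sup>2 - real p / a\<^sup>2 = real q / b'\<^sup>2 - real p / a'\<^sup>2"
  shows "a = a' \<and> b = b'"
proof -
  have *: False if "a < a'" and pos: "0 < a" "0 < b" "0 < a'" "0 < b'"
    and vol: "a ^ p * b ^ q = a' ^ p * b' ^ q"
    and eq: "real q / b\<^sup>2 - real p / a\<^sup>2 = real q / b'\<^sup>2 - real p / a'\<^sup>2" for a b a' b' :: real
  proof -
    have "b' < b"
    proof (rule ccontr)
      assume "\<not> b' < b"
      then have "b ^ q \<le> b' ^ q" using pos by (intro power_mono) linarith+
      moreover have "a ^ p < a' ^ p"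
        using pos(1) \<open>0 < p\<close> by (intro power_strict_mono[OF \<open>a < a'\<close>]) linarith+
      ultimately have "a ^ p * b ^ q < a' ^ p * b' ^ q"
        by (intro mult_less_le_imp_less) (simp_all add: pos less_imp_le)
      with vol show False by simp
    qed
    then have "real q / b\<^sup>2 < real q / b'\<^sup>2"
      using pos \<open>0 < q\<close> by (intro divide_strict_left_mono power_strict_mono) auto
    moreover have "real p / a'\<^sup>2 < real p / a\<^sup>2"
      using pos \<open>0 < p\<close> \<open>a < a'\<close> by (intro divide_strict_left_mono power_strict_mono) auto
    ultimately show False using eq by linarith
  qed
  have "\<not> a < a'" "\<not> a' < a"
    using *[OF _ assms(3-6) vol eq] *[OF _ assms(5,6,3,4) vol[symmetric] eq[symmetric]] by blast+
  then have "a = a'" by simp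
  moreover from this vol have "b ^ q = b' ^ q" using \<open>0 < a\<close> by auto
  then have "b = b'" using power_inject_base[of b "q - 1" b'] assms by auto
  ultimately show ?thesis ..
qed

text \<open>Eliminating \<open>l1\<close> from the two equations and putting \<open>\<beta> = (F / l2)\<^sup>2\<close> leaves
  \<open>(q \<beta> - \<kappa>) ^ p * \<beta> ^ q = p ^ p * F ^ (2 * (p + q - 1))\<close>, so that \<open>\<beta>\<close> is an inverse function
  of one variable applied to a power of \<open>F\<close>; no implicit function theorem is needed.\<close>

lemma fibre_radii_exist:
  fixes F :: "real \<Rightarrow> real" and \<kappa> P :: real
  assumes p: "0 < p" and q: "0 < q" and F: "smooth_on UNIV F" "\<And>t. 0 < F t" "periodic P F"
  shows "\<exists>l1 l2. (\<forall>t. 0 < l1 t) \<and> (\<forall>t. 0 < l2 t) \<and> periodic P l1 \<and> periodic P l2 \<and>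
     smooth_on UNIV l1 \<and> smooth_on UNIV l2 \<and>
     (\<forall>t. l1 t ^ p * l2 t ^ q = F t) \<and>
     (\<forall>t. real q / (l2 t)\<^sup>2 - real p / (l1 t)\<^sup>2 = \<kappa> / (F t)\<^sup>2)"
proof -
  \<comment> \<open>Above \<open>b0\<close> both factors of \<open>Q\<close> are positive and
    increasing; at \<open>b0\<close> one of them vanishes, whichever term is the maximum.\<close>
  define b0 where "b0 = max 0 (\<kappa> / q)"
  define Q where "Q = (\<lambda>b::real. (q * b - \<kappa>) ^ p * b ^ q)"
  define Q' where "Q' = (\<lambda>b::real. real p * real q * (q * b - \<kappa>) ^ (p - 1) * b ^ q
    + real q * (q * b - \<kappa>) ^ p * b ^ (q - 1))"
  have pos: "0 < b" "0 < q * b - \<kappa>" if "b0 < b" for b :: real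
    using that q by (auto simp: b0_def field_simps)
  have der: "(Q has_real_derivative Q' b) (at b)" for b
    unfolding Q_def Q'_def by (auto intro!: derivative_eq_intros simp: algebra_simps)
  have Q'_pos: "0 < Q' b" if "b0 < b" for b
    using pos[OF that] p q unfolding Q'_def by (intro add_pos_pos mult_pos_pos zero_less_power) auto
  have Q_mono: "Q b < Q b'" if "b0 < b" "b < b'" for b b'
    using pos[OF that(1)] pos[of b'] that p q unfolding Q_def
    by (intro mult_strict_mono power_strict_mono) (auto intro: less_imp_le)
  have "\<exists>b>b0. Q b = y" if "0 < y" for y
  proof -
    have "Q b0 = 0" using p q by (auto simp: Q_def b0_def max_def)
    \<comment> \<open>Here \<open>b1 ^ q\<close> is at least 1 and \<open>q * b1 - \<kappa>\<close>
      at least \<open>1 + y\<close>, so \<open>Q b1\<close> exceeds \<open>y\<close>.\<close>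
    define b1 where "b1 = b0 + 1 + y"
    have b1: "1 \<le> b1" "1 + y \<le> q * b1 - \<kappa>"
    proof -
      show "1 \<le> b1" using that by (simp add: b1_def b0_def)
      have "\<kappa> \<le> q * b0" using q by (simp add: b0_def max_def field_simps)
      moreover have "1 * (1 + y) \<le> q * (1 + y)" using q that by (intro mult_right_mono) auto
      ultimately show "1 + y \<le> q * b1 - \<kappa>" by (simp add: b1_def algebra_simps)
    qed
    have "1 + y \<le> (1 + y) ^ p" using that p by (intro self_le_power) auto
    also have "\<dots> \<le> (q * b1 - \<kappa>) ^ p" using b1 that by (intro power_mono) auto
    also have "\<dots> \<le> Q b1" unfolding Q_def
      using b1 that mult_left_mono[of 1 "b1 ^ q" "(q * b1 - \<kappa>) ^ p"] by simp
    finally have "y \<le> Q b1" by simp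
    moreover have "continuous_on {b0..b1} Q"
      using der by (blast intro: continuous_at_imp_continuous_on DERIV_isCont)
    ultimately obtain b where "b0 \<le> b" "b \<le> b1" "Q b = y"
      using IVT'[of Q b0 y b1] \<open>0 < y\<close> \<open>Q b0 = 0\<close> by (auto simp: b1_def)
    then show ?thesis using \<open>Q b0 = 0\<close> that by (metis less_irrefl order_le_less)
  qed
  then obtain g where g: "b0 < g y" "Q (g y) = y" if "0 < y" for y by metis
  have gQ: "g (Q b) = b" if "b0 < b" for b
  proof -
    have "0 < Q b" using pos[OF that] by (simp add: Q_def)
    with g[OF this] Q_mono that show ?thesis by (metis linorder_neqE_linordered_idom less_irrefl)
  qed
  \<comment> \<open>The square of the volume condition reads F^(2(p+q)) p^p / Q(\<beta>) = F^2,
    whence this exponent.\<close>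
  define N where "N = 2 * (p + q - 1)"
  define R where "R = (\<lambda>t. real p ^ p * F t ^ N)"
  have R_pos: "0 < R t" for t using F(2) p by (simp add: R_def)
  have smooth_R: "smooth_on UNIV R"
    using F(1) unfolding smooth_on_def R_def by (intro allI Ck_on_mult Ck_on_const Ck_on_power) auto
  define \<beta> where "\<beta> = (\<lambda>t. g (R t))"
  have \<beta>: "b0 < \<beta> t" "Q (\<beta> t) = R t" for t using g[OF R_pos] by (auto simp: \<beta>_def)
  note \<beta>_pos = pos[OF \<beta>(1)]
  have "(\<beta> has_real_derivative inverse (Q' (\<beta> t)) * deriv R t) (at t)" for t
  proof -
    have "(g has_real_derivative inverse (Q' (g (R t)))) (at (R t))"
    proof (rule has_real_derivative_inverse_on_open[where S = "{b0<..}" and T = "{0<..}" and f = Q])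
      show "Q' (g (R t)) \<noteq> 0" using Q'_pos[OF g(1)[OF R_pos[of t]]] by simp
    qed (simp_all add: R_pos g gQ der)
    from DERIV_chain2[OF this smooth_on_DERIV[OF smooth_R]] show ?thesis by (simp add: \<beta>_def)
  qed
  then have smooth_\<beta>: "smooth_on UNIV \<beta>"
  proof (rule smooth_on_bootstrap)
    fix k assume C: "Ck_on k \<beta> UNIV"
    have "smooth_on UNIV (deriv R)"
      by (rule smooth_on_real_derivative[OF smooth_R smooth_on_DERIV[OF smooth_R]])
    moreover have "Q' (\<beta> t) \<noteq> 0" for t using Q'_pos[OF \<beta>(1)[of t]] by simp
    moreover have "Ck_on k (\<lambda>t. Q' (\<beta> t)) UNIV"
    proof -
      have "Ck_on k (\<lambda>t. q * \<beta> t + (- \<kappa>)) UNIV" by (intro Ck_on_add Ck_on_mult Ck_on_const C)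
      then have "Ck_on k (\<lambda>t. q * \<beta> t - \<kappa>) UNIV" by simp
      then show ?thesis unfolding Q'_def
        by (intro Ck_on_add Ck_on_mult Ck_on_const Ck_on_power C)
    qed
    ultimately show "Ck_on k (\<lambda>t. inverse (Q' (\<beta> t)) * deriv R t) UNIV"
      by (intro Ck_on_mult Ck_on_inverse) (auto simp: smooth_on_def)
  qed
  \<comment> \<open>\<open>l2\<close> solves \<beta> = (F/l2)^2; the second equation of the radii
    then forces (F/l1)^2 = (q \<beta> - \<kappa>)/p.\<close>
  define l2 where "l2 = (\<lambda>t. F t / sqrt (\<beta> t))"
  define l1 where "l1 = (\<lambda>t. F t * sqrt (p / (q * \<beta> t - \<kappa>)))"
  have "smooth_on UNIV l2"
    using F(1) smooth_\<beta> unfolding smooth_on_def l2_def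
    by (intro allI Ck_on_divide Ck_on_sqrt \<beta>_pos) (simp_all add: less_imp_neq[OF \<beta>_pos(1), symmetric])
  moreover have "smooth_on UNIV l1"
    unfolding smooth_on_def
  proof
    fix k
    have C: "Ck_on k \<beta> UNIV" using smooth_\<beta> by (simp add: smooth_on_def)
    have "Ck_on k (\<lambda>t. q * \<beta> t + (- \<kappa>)) UNIV" by (intro Ck_on_add Ck_on_mult Ck_on_const C)
    then have *: "Ck_on k (\<lambda>t. q * \<beta> t - \<kappa>) UNIV" by simp
    have nz: "q * \<beta> t - \<kappa> \<noteq> 0" for t using \<beta>_pos(2)[of t] by simp
    have pos': "0 < p / (q * \<beta> t - \<kappa>)" for t using \<beta>_pos(2)[of t] p by simp
    show "Ck_on k l1 UNIV"
      unfolding l1_def using F(1)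
      by (intro Ck_on_mult Ck_on_sqrt Ck_on_divide Ck_on_const * nz pos') (auto simp: smooth_on_def)
  qed
  moreover have l_pos: "0 < l1 t" "0 < l2 t" for t
    using F(2)[of t] \<beta>_pos[of t] p by (auto simp: l1_def l2_def)
  moreover have "periodic P l1" "periodic P l2"
    using F(3) by (auto simp: periodic_def l1_def l2_def \<beta>_def R_def)
  moreover have "l1 t ^ p * l2 t ^ q = F t" for t
  proof -
    have "(l1 t ^ p * l2 t ^ q)\<^sup>2 = ((l1 t)\<^sup>2) ^ p * ((l2 t)\<^sup>2) ^ q"
      by (simp add: power_mult_distrib power_mult[symmetric] mult.commute)
    also have "\<dots> = (F t)\<^sup>2 ^ p * (F t)\<^sup>2 ^ q * (real p ^ p / Q (\<beta> t))"
      using \<beta>_pos[of t] by (simp add: l1_def l2_def power_mult_distrib power_divide Q_def)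
    also have "\<dots> = (F t)\<^sup>2 ^ (p + q) / F t ^ N"
      using p by (simp add: \<beta> R_def power_add)
    also have "\<dots> = (F t)\<^sup>2"
    proof -
      have "2 * (p + q) = N + 2" using p by (simp add: N_def)
      then have "(F t)\<^sup>2 ^ (p + q) = F t ^ (N + 2)" by (simp only: power_mult[symmetric])
      then show ?thesis using F(2)[of t] by (simp add: power_add power2_eq_square)
    qed
    finally show ?thesis
      using F(2)[of t] l_pos[of t] by (simp add: power2_eq_iff_nonneg less_imp_le)
  qed
  moreover have "real q / (l2 t)\<^sup>2 - real p / (l1 t)\<^sup>2 = \<kappa> / (F t)\<^sup>2" for t
  proof -
    have "real q / (l2 t)\<^sup>2 = q * \<beta> t / (F t)\<^sup>2"
      using \<beta>_pos[of t] by (simp add: l2_def power_divide)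
    moreover have "real p / (l1 t)\<^sup>2 = (q * \<beta> t - \<kappa>) / (F t)\<^sup>2"
      using \<beta>_pos[of t] p by (simp add: l1_def power_mult_distrib)
    ultimately show ?thesis by (simp add: diff_divide_distrib)
  qed
  ultimately show ?thesis by (intro exI[of _ l1] exI[of _ l2] conjI) (rule allI | assumption)+
qed

text \<open>Existence together with pointwise uniqueness shows that the definite description in
  \<open>fibre_radii\<close> denotes the pair of radii.\<close>

lemma fibre_radii_props:
  fixes F :: "real \<Rightarrow> real" and \<kappa> P :: real
  assumes "0 < p" "0 < q" "smooth_on UNIV F" "\<And>t. 0 < F t" "periodic P F"
  obtains l1 l2 where "fibre_radii p q P F \<kappa> = (l1, l2)"
    and "\<And>t. 0 < l1 t" and "\<And>t. 0 < l2 t" and "smooth_on UNIV l1" and "smooth_on UNIV l2"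
    and "\<And>t. l1 t ^ p * l2 t ^ q = F t"
    and "\<And>t. real q / (l2 t)\<^sup>2 - real p / (l1 t)\<^sup>2 = \<kappa> / (F t)\<^sup>2"
proof -
  let ?R = "\<lambda>l1 l2. (\<forall>t. 0 < l1 t) \<and> (\<forall>t. 0 < l2 t) \<and> periodic P l1 \<and> periodic P l2 \<and>
     smooth_on UNIV l1 \<and> smooth_on UNIV l2 \<and> (\<forall>t. l1 t ^ p * l2 t ^ q = F t) \<and>
     (\<forall>t. real q / (l2 t)\<^sup>2 - real p / (l1 t)\<^sup>2 = \<kappa> / (F t)\<^sup>2)"
  obtain l1 l2 where l: "?R l1 l2" using fibre_radii_exist[OF assms] by blast
  have "fibre_radii p q P F \<kappa> = (l1, l2)"
    unfolding fibre_radii_def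
  proof (rule the_equality)
    show "case (l1, l2) of (l1, l2) \<Rightarrow> ?R l1 l2" using l by simp
  next
    fix z assume "case z of (l1, l2) \<Rightarrow> ?R l1 l2"
    then obtain m1 m2 where z: "z = (m1, m2)" "?R m1 m2" by (cases z) auto
    have "m1 t = l1 t \<and> m2 t = l2 t" for t
    proof (rule fibre_radii_unique[OF assms(1,2)])
      show "m1 t ^ p * m2 t ^ q = l1 t ^ p * l2 t ^ q" using l z(2) by metis
      show "real q / (m2 t)\<^sup>2 - real p / (m1 t)\<^sup>2 = real q / (l2 t)\<^sup>2 - real p / (l1 t)\<^sup>2"
        using l z(2) by metis
    qed (use l z(2) in blast)+
    then show "z = (l1, l2)" by (simp add: z(1) fun_eq_iff)
  qed
  then show thesis by (rule that) (use l in blast)+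
qed

section \<open>Antiderivatives and quasi-periodic functions\<close>

lemma LBINT_has_real_derivative:
  assumes "continuous_on UNIV f"
  shows "((\<lambda>u. LBINT y=ereal c..ereal u. f y) has_real_derivative f x) (at x)"
proof -
  \<comment> \<open>The margin 1 makes \<open>x\<close> an interior point of an interval containing
    \<open>c\<close>, so that the derivative within the interval is a full derivative.\<close>
  let ?a = "min c x - 1" and ?b = "max c x + 1"
  have "((\<lambda>u. LBINT y=ereal c..ereal u. f y) has_vector_derivative f x) (at x within {?a..?b})"
    by (rule interval_integral_FTC2) (auto intro: continuous_on_subset[OF assms])
  moreover have "at x within {?a..?b} = at x"
    by (rule at_within_interior) auto
  ultimately show ?thesis by (simp add: has_real_derivative_iff_has_vector_derivative)
qed

text \<open>The values at integer multiples of \<open>L\<close> form an arithmetic progression that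
  is unbounded in both directions; the intermediate value theorem fills the gaps.\<close>

lemma quasi_periodic_surj:
  fixes f :: "real \<Rightarrow> real"
  assumes cont: "continuous_on UNIV f" and step: "\<And>x. f (x + L) = f x + I"
    and "0 < L" "0 < I"
  shows "surj f"
proof -
  have up: "f (real n * L) = f 0 + n * I" for n
    by (induction n) (auto simp: step distrib_right add.commute[of L])
  have down: "f (- (real n * L)) = f 0 - n * I" for n
  proof (induction n)
    case (Suc n)
    have "f (- (real (Suc n) * L)) + I = f (- (real (Suc n) * L) + L)" by (simp only: step)
    also have "- (real (Suc n) * L) + L = - (real n * L)" by (simp add: algebra_simps)
    finally have "f (- (real (Suc n) * L)) = f 0 - n * I - I" by (simp only: Suc eq_diff_eq)
    then show ?case by (simp add: algebra_simps)
  qed simp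
  have "\<exists>x. f x = y" for y
  proof -
    obtain n where "\<bar>y - f 0\<bar> < real n * I"
      using reals_Archimedean3[OF \<open>0 < I\<close>] by blast
    then have "f (- (real n * L)) \<le> y" "y \<le> f (real n * L)" by (auto simp: up down)
    moreover have "- (real n * L) \<le> real n * L" using \<open>0 < L\<close> by simp
    ultimately show ?thesis
      using IVT'[of f "- (real n * L)" y "real n * L"] continuous_on_subset[OF cont subset_UNIV]
      by blast
  qed
  then show ?thesis by (metis surjI)
qed

text \<open>The increment over one period has derivative \<open>f' (x + L) - f' x = 0\<close>. So
  its value at a single point gives the quasi-periodicity everywhere.\<close>

lemma DERIV_periodic_increment:
  fixes f :: "real \<Rightarrow> real"
  assumes "\<And>x. (f has_real_derivative f' x) (at x)" and "\<And>x. f' (x + L) = f' x"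
  shows "f (x + L) - f x = f (y + L) - f y"
proof -
  have "((\<lambda>x. f (x + L) - f x) has_real_derivative f' (x + L) - f' x) (at x)" for x
    using DERIV_shift[of f "f' (x + L)" x L] assms(1) by (auto intro: DERIV_diff)
  then have "((\<lambda>x. f (x + L) - f x) has_real_derivative 0) (at x)" for x
    by (simp add: assms(2))
  then show ?thesis by (rule DERIV_isconst_all[rule_format, of "\<lambda>x. f (x + L) - f x"])
qed

subsection \<open>The pendulum equation\<close>

text \<open>The energy level is chosen by the intermediate value theorem: the travel time over \<open>{0..L}\<close>
  tends to \<open>0\<close> for large energies and diverges like a logarithm at the separatrix \<open>e = 0\<close>.
  The shift \<open>c\<close> moves the slowest point of the orbit to a zero of the sine for both signs of \<open>\<kappa>\<close>.\<close>

lemma pendulum_energy_exists: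
  fixes k c L I :: real
  assumes k: "0 \<le> k" and c: "0 \<le> c" "c + 1 \<le> L" and I: "0 < I"
  shows "\<exists>e>0. integral {0..L} (\<lambda>\<theta>. 1 / sqrt (e + k * (sin (\<theta> - c))\<^sup>2)) = I"
proof -
  define h where "h = (\<lambda>e \<theta>. 1 / sqrt (e + k * (sin (\<theta> - c))\<^sup>2))"
  have L: "0 < L" using c by simp
  have pos: "0 < e + k * (sin (\<theta> - c))\<^sup>2" if "0 < e" for e \<theta> :: real
    using that k by (intro add_pos_nonneg) auto
  have cont_h: "continuous_on S (h e)" if "0 < e" for e S
    using pos[OF that] unfolding h_def by (auto intro!: continuous_intros simp: less_imp_neq[symmetric])
  have h_nonneg: "0 \<le> h e \<theta>" if "0 < e" for e \<theta> using pos[OF that] by (simp add: h_def less_imp_le)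
  \<comment> \<open>For x - c at least d, the radicand d^2 + k sin^2(x - c) is at most (1 + k)(x -
    c)^2; so 1/(s (x - c)) is a lower bound of the integrand at energy d^2.\<close>
  define s where "s = sqrt (1 + k)"
  have s: "0 < s" "s\<^sup>2 = 1 + k" using k by (auto simp: s_def)
  \<comment> \<open>Chosen so that this lower bound integrates over [c + d, c + 1] to -ln d / s =
    I.\<close>
  define d where "d = exp (- (s * I))"
  have d: "0 < d" "d < 1" using s I by (auto simp: d_def)
  \<comment> \<open>The first term bounds the integrand by I/L, hence the integral by I; the second
    puts \<open>e1\<close> to the right of d^2 for the intermediate value theorem.\<close>
  define e1 where "e1 = max ((L / I)\<^sup>2) (d\<^sup>2)"
  have "0 < e1" using d by (simp add: e1_def less_max_iff_disj)
  have "integral {0..L} (h e1) \<le> integral {0..L} (\<lambda>_. I / L)"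
  proof (rule integral_le)
    show "h e1 integrable_on {0..L}" using cont_h[OF \<open>0 < e1\<close>] by (rule integrable_continuous_real)
    show "h e1 \<theta> \<le> I / L" for \<theta>
    proof -
      have "(L / I)\<^sup>2 \<le> e1 + k * (sin (\<theta> - c))\<^sup>2"
        using k by (intro order.trans[OF max.cobounded1[of "(L / I)\<^sup>2" "d\<^sup>2"]]) (simp add: e1_def)
      then have "L / I \<le> sqrt (e1 + k * (sin (\<theta> - c))\<^sup>2)" by (rule real_le_rsqrt)
      then have "1 / sqrt (e1 + k * (sin (\<theta> - c))\<^sup>2) \<le> 1 / (L / I)"
        using L I pos[OF \<open>0 < e1\<close>, of \<theta>] by (intro divide_left_mono mult_pos_pos) simp_all
      then show ?thesis by (simp add: h_def)
    qed
  qed auto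
  then have upper: "integral {0..L} (h e1) \<le> I" using L by simp
  have "((\<lambda>x. 1 / (s * (x - c))) has_integral (ln (c + 1 - c) / s - ln (c + d - c) / s)) {c + d..c + 1}"
  proof (rule fundamental_theorem_of_calculus)
    show "((\<lambda>x. ln (x - c) / s) has_vector_derivative 1 / (s * (x - c))) (at x within {c + d..c + 1})"
      if "x \<in> {c + d..c + 1}" for x
      using that d s unfolding has_real_derivative_iff_has_vector_derivative[symmetric]
      by (auto intro!: derivative_eq_intros simp: field_simps)
  qed (use d in simp)
  then have int: "((\<lambda>x. 1 / (s * (x - c))) has_integral I) {c + d..c + 1}"
    using s by (simp add: d_def)
  have d2: "0 < d\<^sup>2" using d by simp
  have "I = integral {c + d..c + 1} (\<lambda>x. 1 / (s * (x - c)))" using int by (simp add: integral_unique)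
  also have "\<dots> \<le> integral {c + d..c + 1} (h (d\<^sup>2))"
  proof (rule integral_le)
    show "(\<lambda>x. 1 / (s * (x - c))) integrable_on {c + d..c + 1}" using int by blast
    show "h (d\<^sup>2) integrable_on {c + d..c + 1}" by (rule integrable_continuous_real[OF cont_h[OF d2]])
    show "1 / (s * (x - c)) \<le> h (d\<^sup>2) x" if x: "x \<in> {c + d..c + 1}" for x
    proof -
      have x': "d \<le> x - c" using x by auto
      have *: "(sin (x - c))\<^sup>2 \<le> (x - c)\<^sup>2"
        using abs_sin_x_le_abs_x[of "x - c"] by (simp add: abs_le_square_iff)
      have "d\<^sup>2 + k * (sin (x - c))\<^sup>2 \<le> (x - c)\<^sup>2 + k * (x - c)\<^sup>2"
        using x' d k by (intro add_mono power_mono mult_left_mono *) auto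
      also have "\<dots> = (s * (x - c))\<^sup>2" unfolding power_mult_distrib s(2) by (simp add: algebra_simps)
      finally have "sqrt (d\<^sup>2 + k * (sin (x - c))\<^sup>2) \<le> s * (x - c)"
        using x' d s by (intro real_le_lsqrt) auto
      then show ?thesis unfolding h_def
        using x' d s pos[OF d2] by (intro divide_left_mono mult_pos_pos) auto
    qed
  qed
  also have "\<dots> \<le> integral {0..L} (h (d\<^sup>2))"
    using c d h_nonneg[OF d2]
    by (intro integral_subset_le integrable_continuous_real cont_h[OF d2]) auto
  finally have lower: "I \<le> integral {0..L} (h (d\<^sup>2))" .
  have "continuous_on ({d\<^sup>2..e1} \<times> cbox 0 L) (\<lambda>(e, \<theta>). h e \<theta>)"
  proof -
    have "fst z + k * (sin (snd z - c))\<^sup>2 \<noteq> 0" if "z \<in> {d\<^sup>2..e1} \<times> cbox 0 L" for z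
    proof -
      have "0 < fst z" using that d2 by (intro less_le_trans[OF d2]) auto
      from pos[OF this, of "snd z"] show ?thesis by simp
    qed
    then show ?thesis unfolding h_def case_prod_beta by (intro continuous_intros) auto
  qed
  then have "continuous_on {d\<^sup>2..e1} (\<lambda>e. integral {0..L} (h e))"
    using integral_continuous_on_param[of "{d\<^sup>2..e1}" 0 L h] by simp
  moreover have "d\<^sup>2 \<le> e1" by (simp add: e1_def)
  ultimately obtain e where "d\<^sup>2 \<le> e" "integral {0..L} (h e) = I"
    using IVT2'[of "\<lambda>e. integral {0..L} (h e)" e1 I "d\<^sup>2"] upper lower by blast
  then have "0 < e \<and> integral {0..L} (h e) = I" using less_le_trans[OF d2] by simp
  then show ?thesis unfolding h_def by blast
qed

text \<open>The inverse of the travel time satisfies the energy equation \<Theta>'^2 = w(\<Theta>);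
  differentiating \<Theta>' = sqrt (w(\<Theta>)) cancels the root and leaves w'(\<Theta>)/2, the
  pendulum force.\<close>

lemma pendulum_solution_exists:
  fixes \<kappa> I :: real and m :: int
  assumes I: "0 < I" and m: "1 \<le> m"
  obtains \<Theta> \<Theta>' :: "real \<Rightarrow> real" where "smooth_on UNIV \<Theta>"
    and "\<And>s. \<Theta> (s + I) = \<Theta> s + 2 * pi * of_int m"
    and "\<And>s. (\<Theta> has_real_derivative \<Theta>' s) (at s)" and "\<And>s. 0 < \<Theta>' s"
    and "\<And>s. (\<Theta>' has_real_derivative \<kappa> * sin (\<Theta> s) * cos (\<Theta> s)) (at s)"
proof -
  define c where "c = (if 0 \<le> \<kappa> then 0 else pi / 2)"
  define L where "L = 2 * pi * of_int m"
  have "1 * (2 * pi) \<le> of_int m * (2 * pi)" using m by (intro mult_right_mono) auto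
  then have L: "2 * pi \<le> L" by (simp add: L_def mult.commute)
  then have "0 < L" using pi_gt_zero by linarith
  have L_per: "sin (\<theta> + L - c) = sin (\<theta> - c)" for \<theta>
  proof -
    have "sin (\<theta> + L - c) = sin ((\<theta> - c) + L)" by (simp add: algebra_simps)
    also have "\<dots> = sin (\<theta> - c)" unfolding sin_add
      using sin_int_2pin[of m] cos_int_2pin[of m] by (simp add: L_def)
    finally show ?thesis .
  qed
  have "0 \<le> c" "c + 1 \<le> L" using L pi_gt3 by (auto simp: c_def)
  then obtain e where e: "0 < e"
    and int: "integral {0..L} (\<lambda>\<theta>. 1 / sqrt (e + \<bar>\<kappa>\<bar> * (sin (\<theta> - c))\<^sup>2)) = I"
    using pendulum_energy_exists[of "\<bar>\<kappa>\<bar>" c L I] I by auto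
  define w where "w = (\<lambda>\<theta>. e + \<bar>\<kappa>\<bar> * (sin (\<theta> - c))\<^sup>2)"
  have w_pos: "0 < w \<theta>" for \<theta> using e by (simp add: w_def add_pos_nonneg)
  define h where "h = (\<lambda>\<theta>. 1 / sqrt (w \<theta>))"
  have h_pos: "0 < h \<theta>" for \<theta> using w_pos by (simp add: h_def)
  have "continuous_on UNIV h"
    using w_pos unfolding h_def w_def by (auto intro!: continuous_intros simp: less_imp_neq[symmetric])
  define T where "T = (\<lambda>\<theta>. LBINT y=ereal 0..ereal \<theta>. h y)"
  have der_T: "(T has_real_derivative h \<theta>) (at \<theta>)" for \<theta>
    unfolding T_def by (rule LBINT_has_real_derivative) fact
  have T_mono: "T x < T y" if "x < y" for x y
    using that by (rule DERIV_pos_imp_increasing) (use der_T h_pos in blast)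
  have "(h has_integral T L - T 0) {0..L}"
    using \<open>0 < L\<close> der_T
    by (intro fundamental_theorem_of_calculus)
      (auto simp: has_real_derivative_iff_has_vector_derivative[symmetric] intro: has_field_derivative_at_within)
  then have "T L - T 0 = I" using int by (simp add: integral_unique h_def w_def)
  moreover have "h (\<theta> + L) = h \<theta>" for \<theta> by (simp add: h_def w_def L_per)
  ultimately have T_step: "T (\<theta> + L) = T \<theta> + I" for \<theta>
    using DERIV_periodic_increment[of T h L \<theta> 0] der_T by simp
  have "surj T"
  proof (rule quasi_periodic_surj[of T L I])
    show "continuous_on UNIV T" using DERIV_isCont[OF der_T] by (blast intro: continuous_at_imp_continuous_on)
  qed (fact T_step \<open>0 < L\<close> I)+
  have "inj T" using T_mono by (intro strict_mono_imp_inj_on strict_monoI)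
  define \<Theta> where "\<Theta> = inv_into UNIV T"
  have T\<Theta>: "T (\<Theta> s) = s" for s using \<open>surj T\<close> by (simp add: \<Theta>_def f_inv_into_f)
  have \<Theta>T: "\<Theta> (T \<theta>) = \<theta>" for \<theta> using \<open>inj T\<close> by (simp add: \<Theta>_def)
  define \<Theta>' where "\<Theta>' = (\<lambda>s. sqrt (w (\<Theta> s)))"
  have der_\<Theta>: "(\<Theta> has_real_derivative \<Theta>' s) (at s)" for s
  proof -
    have "(\<Theta> has_real_derivative inverse (h (\<Theta> s))) (at s)"
      by (rule has_real_derivative_inverse_on_open[where S = UNIV and T = UNIV and f = T])
        (use h_pos[of "\<Theta> s"] in \<open>simp_all add: T\<Theta> \<Theta>T der_T\<close>)
    then show ?thesis by (simp add: h_def \<Theta>'_def)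
  qed
  have "smooth_on UNIV \<Theta>"
  \<comment> \<open>The first-order equation expresses \<open>\<Theta>'\<close> smoothly through
    \<open>\<Theta>\<close>, since \<open>w\<close> is bounded away from zero by
    \<open>e\<close>.\<close>
  proof (rule smooth_on_bootstrap[OF der_\<Theta>])
    fix k assume C: "Ck_on k \<Theta> UNIV"
    then have "Ck_on k (\<lambda>s. \<Theta> s + (- c)) UNIV" by (intro Ck_on_add Ck_on_const)
    then have "Ck_on k (\<lambda>s. sin (\<Theta> s + (- c))) UNIV"
      by (rule Ck_on_compose_real[OF conjunct1[OF Ck_on_sin_cos]])
    then have "Ck_on k (\<lambda>s. w (\<Theta> s)) UNIV" unfolding w_def
      by (intro Ck_on_add Ck_on_mult Ck_on_const Ck_on_power) simp
    then show "Ck_on k \<Theta>' UNIV" unfolding \<Theta>'_def using w_pos by (rule Ck_on_sqrt)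
  qed
  moreover have "\<Theta> (s + I) = \<Theta> s + 2 * pi * of_int m" for s
    using \<Theta>T[of "\<Theta> s + L"] unfolding T_step T\<Theta> by (simp add: L_def)
  moreover have "0 < \<Theta>' s" for s using w_pos by (simp add: \<Theta>'_def)
  moreover have "(\<Theta>' has_real_derivative \<kappa> * sin (\<Theta> s) * cos (\<Theta> s)) (at s)" for s
  proof -
    \<comment> \<open>For negative \<kappa> the shift by pi/2 makes the potential |\<kappa>| cos^2
      \<theta>, which equals \<kappa> sin^2 \<theta> up to a constant; so both signs give the same
      derivative.\<close>
    have "(w has_real_derivative 2 * \<kappa> * sin \<theta> * cos \<theta>) (at \<theta>)" for \<theta>
      unfolding w_def
      by (auto intro!: derivative_eq_intros simp: c_def sin_diff cos_diff)
    from DERIV_chain2[OF this der_\<Theta>]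
    have "((\<lambda>s. w (\<Theta> s)) has_real_derivative 2 * \<kappa> * sin (\<Theta> s) * cos (\<Theta> s) * \<Theta>' s) (at s)" .
    from DERIV_chain2[OF DERIV_real_sqrt[OF w_pos] this]
    show ?thesis using w_pos[of "\<Theta> s"] unfolding \<Theta>'_def by (simp add: field_simps)
  qed
  ultimately show thesis using that der_\<Theta> by blast
qed

subsection \<open>Partial derivatives\<close>

text \<open>Full differentiability is carried along with the value of the partial derivative, so the
  rules compose without side conditions and \<open>pderiv_at\<close> can be read off at the
  end.\<close>

definition has_partial :: "(real^'d \<Rightarrow> 'b::real_normed_vector) \<Rightarrow> 'd::finite \<Rightarrow> 'b \<Rightarrow> real^'d \<Rightarrow> bool" where
  "has_partial h i D u \<longleftrightarrow> (\<exists>h'. (h has_derivative h') (at u) \<and> h' (axis i 1) = D)"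

lemma has_partialI: "(h has_derivative h') (at u) \<Longrightarrow> h' (axis i 1) = D \<Longrightarrow> has_partial h i D u"
  by (auto simp: has_partial_def)

lemma has_partial_pderiv_at: "has_partial h i D u \<Longrightarrow> pderiv_at i h u = D"
  by (auto simp: has_partial_def pderiv_at_def frechet_derivative_eqI)

lemma has_partial_const: "has_partial (\<lambda>u. c) i 0 u"
  by (rule has_partialI[OF has_derivative_const]) simp

lemma has_partial_coord:
  assumes "(f has_real_derivative f') (at (u $ j))"
  shows "has_partial (\<lambda>u. f (u $ j)) i (if i = j then f' else 0) u"
proof (rule has_partialI)
  have "((\<lambda>u. u $ j) has_derivative (\<lambda>v. v $ j)) (at u)"
    by (rule bounded_linear.has_derivative[OF bounded_linear_vec_nth has_derivative_ident])
  from has_derivative_compose[OF this assms[unfolded has_field_derivative_def]]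
  show "((\<lambda>u. f (u $ j)) has_derivative (\<lambda>v. f' * v $ j)) (at u)" .
qed (simp add: axis_def)

lemma has_partial_add:
  "has_partial f i D u \<Longrightarrow> has_partial g i E u \<Longrightarrow> has_partial (\<lambda>u. f u + g u) i (D + E) u"
  unfolding has_partial_def by (elim exE conjE, intro exI conjI, rule has_derivative_add, assumption+) simp

lemma has_partial_diff:
  "has_partial f i D u \<Longrightarrow> has_partial g i E u \<Longrightarrow> has_partial (\<lambda>u. f u - g u) i (D - E) u"
  unfolding has_partial_def by (elim exE conjE, intro exI conjI, rule has_derivative_diff, assumption+) simp

lemma has_partial_scaleR:
  "has_partial f i D u \<Longrightarrow> has_partial g i E u \<Longrightarrow>
    has_partial (\<lambda>u. f u *\<^sub>R g u) i (f u *\<^sub>R E + D *\<^sub>R g u) u"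
  unfolding has_partial_def by (elim exE conjE, intro exI conjI, rule has_derivative_scaleR, assumption+) simp

lemma has_partial_mult:
  fixes f g :: "real^'d \<Rightarrow> real"
  shows "has_partial f i D u \<Longrightarrow> has_partial g i E u \<Longrightarrow>
    has_partial (\<lambda>u. f u * g u) i (f u * E + D * g u) u"
  using has_partial_scaleR[of f i D u g E] by simp

lemma has_partial_Pair:
  "has_partial f i D u \<Longrightarrow> has_partial g i E u \<Longrightarrow> has_partial (\<lambda>u. (f u, g u)) i (D, E) u"
  unfolding has_partial_def by (elim exE conjE, intro exI conjI, rule has_derivative_Pair, assumption+) simp

lemma has_partial_power:
  fixes f :: "real^'d \<Rightarrow> real"
  assumes "has_partial f i D u"
  shows "has_partial (\<lambda>u. f u ^ n) i (real n * f u ^ (n - 1) * D) u"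
proof -
  obtain f' where f': "(f has_derivative f') (at u)" "f' (axis i 1) = D"
    using assms by (auto simp: has_partial_def)
  show ?thesis
    by (rule has_partialI[OF has_derivative_power[OF f'(1)]]) (simp add: f'(2))
qed

lemma has_partial_sum:
  assumes "\<And>j. j \<in> J \<Longrightarrow> has_partial (f j) i (D j) u"
  shows "has_partial (\<lambda>u. \<Sum>j\<in>J. f j u) i (\<Sum>j\<in>J. D j) u"
  using assms by (induction J rule: infinite_finite_induct) (auto intro: has_partial_const has_partial_add)

subsection \<open>Stereographic charts\<close>

text \<open>The conformal factor of the stereographic chart: the round metric is its square times
  the Euclidean one. The coordinates come from a subset \<open>I\<close> of the index type, so that
  two spheres and the line can share one vector \<open>u\<close>.\<close>

definition conf :: "'d set \<Rightarrow> real^'d::finite \<Rightarrow> real" where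
  "conf I u = 2 / (1 + (\<Sum>i\<in>I. (u $ i)\<^sup>2))"

definition lincomb :: "'d set \<Rightarrow> ('d \<Rightarrow> 'a) \<Rightarrow> real^'d::finite \<Rightarrow> 'a::real_vector" where
  "lincomb I e u = (\<Sum>i\<in>I. u $ i *\<^sub>R e i)"

text \<open>Inverse of the stereographic projection from the pole \<open>N\<close>.\<close>

definition stereo :: "'d set \<Rightarrow> ('d \<Rightarrow> 'a) \<Rightarrow> 'a \<Rightarrow> real^'d::finite \<Rightarrow> 'a::real_vector" where
  "stereo I e N u = conf I u *\<^sub>R lincomb I e u + (1 - conf I u) *\<^sub>R N"

definition stereo_partial :: "'d set \<Rightarrow> ('d \<Rightarrow> 'a) \<Rightarrow> 'a \<Rightarrow> 'd \<Rightarrow> real^'d::finite \<Rightarrow> 'a::real_vector" where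
  "stereo_partial I e N i u = (if i \<in> I
     then conf I u *\<^sub>R e i - ((conf I u)\<^sup>2 * u $ i) *\<^sub>R (lincomb I e u - N) else 0)"

lemma conf_denom_pos: fixes u :: "real^'d::finite" shows "0 < 1 + (\<Sum>i\<in>I. (u $ i)\<^sup>2)"
  by (intro add_pos_nonneg sum_nonneg) auto

lemma conf_pos: "0 < conf I u"
  by (simp add: conf_def conf_denom_pos)

text \<open>The definition of \<open>conf\<close> in the form that eliminates |u|^2 from later
  computations.\<close>

lemma conf_times_sum: "conf I u * (\<Sum>i\<in>I. (u $ i)\<^sup>2) = 2 - conf I u"
  using conf_denom_pos[of u I] by (simp add: conf_def field_simps)

lemma Ck_on_coord: "Ck_on k (\<lambda>u. u $ i) UNIV"
  by (rule Ck_on_linear) (rule bounded_linear_vec_nth)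

lemma Ck_on_conf: "Ck_on k (conf I) UNIV"
  unfolding conf_def[abs_def]
  by (intro Ck_on_divide Ck_on_const Ck_on_add Ck_on_sum Ck_on_power Ck_on_coord)
    (metis conf_denom_pos less_irrefl)

lemma Ck_on_lincomb: "Ck_on k (lincomb I e :: real^'d::finite \<Rightarrow> 'a::real_normed_vector) UNIV"
  unfolding lincomb_def[abs_def] by (intro Ck_on_sum Ck_on_scaleR Ck_on_coord Ck_on_const)

lemma Ck_on_stereo: "Ck_on k (stereo I e N :: real^'d::finite \<Rightarrow> 'a::real_normed_vector) UNIV"
proof -
  have "Ck_on k (\<lambda>u. 1 + (- 1) * conf I u) UNIV"
    by (intro Ck_on_add Ck_on_mult Ck_on_const Ck_on_conf)
  then show ?thesis unfolding stereo_def[abs_def]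
    by (intro Ck_on_add Ck_on_scaleR Ck_on_conf Ck_on_lincomb Ck_on_const) simp
qed

lemma has_partial_conf:
  "has_partial (conf I) i (if i \<in> I then - ((conf I u)\<^sup>2 * u $ i) else 0) u"
proof (rule has_partialI)
  let ?d = "1 + (\<Sum>i\<in>I. (u $ i)\<^sup>2)"
  have nz: "?d \<noteq> 0" using conf_denom_pos[of u I] by simp
  have "((\<lambda>u. (u $ i)\<^sup>2) has_derivative (\<lambda>v. 2 * u $ i * v $ i)) (at u)" for i
    by (auto intro!: derivative_eq_intros bounded_linear.has_derivative[OF bounded_linear_vec_nth])
  then have "((\<lambda>u. 1 + (\<Sum>i\<in>I. (u $ i)\<^sup>2)) has_derivative
      (\<lambda>v. 0 + (\<Sum>i\<in>I. 2 * u $ i * v $ i))) (at u)"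
    by (intro has_derivative_add has_derivative_const has_derivative_sum)
  then show "(conf I has_derivative (\<lambda>v. 2 * - (inverse ?d * (0 + (\<Sum>i\<in>I. 2 * u $ i * v $ i)) * inverse ?d))) (at u)"
    unfolding conf_def[abs_def] divide_inverse
    by (intro has_derivative_mult_right Deriv.has_derivative_inverse nz)
  have "(\<Sum>j\<in>I. 2 * u $ j * (axis i 1) $ j) = (if i \<in> I then 2 * u $ i else 0)"
    by (simp add: axis_def if_distrib[of "\<lambda>x. _ * x"] cong: if_cong)
  then show "2 * - (inverse ?d * (0 + (\<Sum>j\<in>I. 2 * u $ j * (axis i 1) $ j)) * inverse ?d)
    = (if i \<in> I then - ((conf I u)\<^sup>2 * u $ i) else 0)"
    by (simp add: conf_def power2_eq_square divide_inverse)
qed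

lemma has_partial_lincomb:
  fixes e :: "'d::finite \<Rightarrow> 'a::real_normed_vector"
  shows "has_partial (lincomb I e) i (if i \<in> I then e i else 0) u"
proof -
  have "has_partial (lincomb I e) i (\<Sum>j\<in>I. (u $ j) *\<^sub>R 0 + (if i = j then 1 else 0) *\<^sub>R e j) u"
    unfolding lincomb_def[abs_def]
    by (intro has_partial_sum has_partial_scaleR has_partial_const has_partial_coord[where f = "\<lambda>x. x"]) simp
  then show ?thesis by (simp add: if_distrib[of "\<lambda>x. x *\<^sub>R _"] cong: if_cong)
qed

lemma has_partial_stereo:
  fixes e :: "'d::finite \<Rightarrow> 'a::real_normed_vector"
  shows "has_partial (stereo I e N) i (stereo_partial I e N i u) u"
proof -
  let ?c = "if i \<in> I then - ((conf I u)\<^sup>2 * u $ i) else 0"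
  have "has_partial (stereo I e N) i ((conf I u *\<^sub>R (if i \<in> I then e i else 0) + ?c *\<^sub>R lincomb I e u)
      + ((1 - conf I u) *\<^sub>R 0 + (0 - ?c) *\<^sub>R N)) u"
    unfolding stereo_def[abs_def]
    by (intro has_partial_add has_partial_scaleR has_partial_diff has_partial_conf has_partial_lincomb
        has_partial_const)
  then show ?thesis by (simp add: stereo_partial_def algebra_simps split: if_splits)
qed

text \<open>An orthonormal basis adapted to the pole. Completeness is stated as an expansion
  formula, which is what inverting the projection uses in place of a dimension count.\<close>

locale sphere_frame =
  fixes I :: "'d::finite set" and e :: "'d \<Rightarrow> 'a::euclidean_space" and N :: 'a
  assumes orthonormal: "i \<in> I \<Longrightarrow> j \<in> I \<Longrightarrow> e i \<bullet> e j = (if i = j then 1 else 0)"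
    and pole: "N \<bullet> N = 1" and tangent: "i \<in> I \<Longrightarrow> e i \<bullet> N = 0"
    and complete: "(\<Sum>i\<in>I. (X \<bullet> e i) *\<^sub>R e i) + (X \<bullet> N) *\<^sub>R N = X"
begin

abbreviation "X \<equiv> stereo I e N"

lemma lincomb_inner_basis: "i \<in> I \<Longrightarrow> lincomb I e u \<bullet> e i = u $ i"
  by (simp add: lincomb_def inner_sum_left orthonormal if_distrib[of "\<lambda>x. _ * x"] cong: if_cong)

lemma lincomb_inner_pole: "lincomb I e u \<bullet> N = 0"
  by (simp add: lincomb_def inner_sum_left tangent)

lemma lincomb_inner_self: "lincomb I e u \<bullet> lincomb I e u = (\<Sum>i\<in>I. (u $ i)\<^sup>2)"
proof -
  have "lincomb I e u \<bullet> lincomb I e u = (\<Sum>i\<in>I. u $ i * (lincomb I e u \<bullet> e i))"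
    by (subst (2) lincomb_def) (simp add: inner_sum_right)
  also have "\<dots> = (\<Sum>i\<in>I. (u $ i)\<^sup>2)"
    by (rule sum.cong) (simp_all add: lincomb_inner_basis power2_eq_square)
  finally show ?thesis .
qed

lemma stereo_inner_pole: "X u \<bullet> N = 1 - conf I u"
  by (simp add: stereo_def inner_add_left lincomb_inner_pole pole)

lemma stereo_inner_basis: "i \<in> I \<Longrightarrow> X u \<bullet> e i = conf I u * u $ i"
  by (simp add: stereo_def inner_add_left lincomb_inner_basis tangent inner_commute[of N "e _"])

lemma norm_stereo: "norm (X u) = 1"
proof -
  have "X u \<bullet> X u = conf I u * (conf I u * (\<Sum>i\<in>I. (u $ i)\<^sup>2)) + (1 - conf I u)\<^sup>2"
    by (simp add: stereo_def inner_add_left inner_add_right lincomb_inner_pole lincomb_inner_self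
        pole inner_commute[of N "lincomb I e u"] power2_eq_square)
  also have "\<dots> = 1" unfolding conf_times_sum by (simp add: power2_eq_square algebra_simps)
  finally show ?thesis by (simp add: norm_eq_1)
qed

text \<open>Conformality. With w = lincomb - N one has c |w|^2 = 2 for the factor c =
  \<open>conf I u\<close>, and then the terms -2 c^3 u_i u_j and c^4 u_i u_j |w|^2 cancel.\<close>

lemma stereo_partial_inner:
  assumes "i \<in> I" "j \<in> I"
  shows "stereo_partial I e N i u \<bullet> stereo_partial I e N j u = (if i = j then (conf I u)\<^sup>2 else 0)"
proof -
  define w where "w = lincomb I e u - N"
  let ?c = "conf I u"
  have w: "w \<bullet> w = (\<Sum>i\<in>I. (u $ i)\<^sup>2) + 1"
    by (simp add: w_def inner_diff_left inner_diff_right lincomb_inner_self lincomb_inner_pole pole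
        inner_commute[of N "lincomb I e u"])
  have cw: "?c * (w \<bullet> w) = 2" unfolding w using conf_times_sum[of I u] by (simp add: distrib_left)
  have we: "w \<bullet> e i = u $ i" "w \<bullet> e j = u $ j"
    using assms by (simp_all add: w_def inner_diff_left lincomb_inner_basis tangent inner_commute[of N "e _"])
  have expand: "(c *\<^sub>R v - (c\<^sup>2 * a) *\<^sub>R w) \<bullet> (c *\<^sub>R v' - (c\<^sup>2 * b) *\<^sub>R w) =
      c\<^sup>2 * (v \<bullet> v') - c ^ 3 * (a * (w \<bullet> v') + b * (w \<bullet> v)) + c ^ 3 * a * b * (c * (w \<bullet> w))"
    for v v' :: 'a and a b c :: real
    by (simp add: inner_diff_left inner_diff_right inner_commute[of v w] power2_eq_square
        power3_eq_cube algebra_simps)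
  have "stereo_partial I e N i u \<bullet> stereo_partial I e N j u = ?c\<^sup>2 * (e i \<bullet> e j)"
    using assms unfolding stereo_partial_def w_def[symmetric] by (simp add: expand cw we)
  then show ?thesis using assms by (simp add: orthonormal)
qed

text \<open>The coordinates of a sphere are eigenfunctions of its Laplacian; in the conformal metric
  \<open>c\<^sup>2 \<delta>\<close> on an \<open>n\<close>-dimensional chart this Laplacian is
  \<open>c ^ (- n) * (\<Sum>i. \<partial>\<^sub>i (c ^ (n - 2) * \<partial>\<^sub>i))\<close>, where \<open>c = conf I\<close>.\<close>

lemma stereo_eigenfunction:
  assumes "card I = k + 2"
  obtains L where "\<And>i. i \<in> I \<Longrightarrow>
      has_partial (\<lambda>u. conf I u ^ k *\<^sub>R stereo_partial I e N i u) i (L i) u"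
    and "(\<Sum>i\<in>I. L i) = - ((real (card I) * conf I u ^ card I) *\<^sub>R X u)"
proof -
  let ?c = "conf I u" and ?w = "lincomb I e u - N"
  \<comment> \<open>The product rule for c^(k+1) e_i - c^(k+2) u_i w, with partial derivatives -c^2
    u_i of c and e_i of w; the coefficients k + 1 and 1 of e_i add up to k + 2.\<close>
  define L where "L = (\<lambda>i. - ((real k + 2) * ?c ^ (k + 2) * u $ i) *\<^sub>R e i
    + ((real k + 2) * ?c ^ (k + 2) * (?c * (u $ i)\<^sup>2)) *\<^sub>R ?w - ?c ^ (k + 2) *\<^sub>R ?w)"
  show thesis
  proof
    fix i assume i: "i \<in> I"
    have eq: "(\<lambda>u. conf I u ^ k *\<^sub>R stereo_partial I e N i u) =
       (\<lambda>u. conf I u ^ (k + 1) *\<^sub>R e i - (conf I u ^ (k + 2) * u $ i) *\<^sub>R (lincomb I e u - N))"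
      using i by (simp add: stereo_partial_def scaleR_diff_right power2_eq_square ac_simps)
    have c: "has_partial (conf I) i (- (?c\<^sup>2 * u $ i)) u"
      using has_partial_conf[of I i u] i by simp
    have l: "has_partial (lincomb I e) i (e i) u"
      using has_partial_lincomb[of I e i u] i by simp
    have x: "has_partial (\<lambda>u. u $ i) i 1 u"
      using has_partial_coord[of "\<lambda>x. x" 1 u i i] by simp
    show "has_partial (\<lambda>u. conf I u ^ k *\<^sub>R stereo_partial I e N i u) i (L i) u"
      unfolding eq
    proof -
      have "has_partial (\<lambda>u. conf I u ^ (k + 1) *\<^sub>R e i - (conf I u ^ (k + 2) * u $ i) *\<^sub>R (lincomb I e u - N)) i
        ((?c ^ (k + 1) *\<^sub>R 0 + (real (k + 1) * ?c ^ (k + 1 - 1) * - (?c\<^sup>2 * u $ i)) *\<^sub>R e i)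
        - ((?c ^ (k + 2) * u $ i) *\<^sub>R (e i - 0) +
           (?c ^ (k + 2) * 1 + (real (k + 2) * ?c ^ (k + 2 - 1) * - (?c\<^sup>2 * u $ i)) * u $ i) *\<^sub>R ?w)) u"
        by (intro has_partial_diff has_partial_scaleR has_partial_mult has_partial_power
            has_partial_const c l x)
      also have "(?c ^ (k + 1) *\<^sub>R 0 + (real (k + 1) * ?c ^ (k + 1 - 1) * - (?c\<^sup>2 * u $ i)) *\<^sub>R e i)
        - ((?c ^ (k + 2) * u $ i) *\<^sub>R (e i - 0) +
           (?c ^ (k + 2) * 1 + (real (k + 2) * ?c ^ (k + 2 - 1) * - (?c\<^sup>2 * u $ i)) * u $ i) *\<^sub>R ?w)
        = L i"
      proof -
        have a: "real (k + 1) * ?c ^ (k + 1 - 1) * - (?c\<^sup>2 * u $ i) - ?c ^ (k + 2) * u $ i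
          = - ((real k + 2) * ?c ^ (k + 2) * u $ i)"
          by (simp add: power_add algebra_simps power2_eq_square)
        have b: "?c ^ (k + 2) * 1 + (real (k + 2) * ?c ^ (k + 2 - 1) * - (?c\<^sup>2 * u $ i)) * u $ i
          = ?c ^ (k + 2) - (real k + 2) * ?c ^ (k + 2) * (?c * (u $ i)\<^sup>2)"
          by (simp add: power_add algebra_simps power2_eq_square)
        have "(c *\<^sub>R 0 + a *\<^sub>R v) - (x *\<^sub>R (v - 0) + y *\<^sub>R w) = (a - x) *\<^sub>R v - y *\<^sub>R w"
          for a c x y and v w :: 'a by (simp add: scaleR_left_diff_distrib)
        note this[of "?c ^ (k + 1)" "real (k + 1) * ?c ^ (k + 1 - 1) * - (?c\<^sup>2 * u $ i)" "e i"
            "?c ^ (k + 2) * u $ i"]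
        then show ?thesis unfolding L_def
          by (rule trans) (simp only: a b scaleR_left_diff_distrib[of "?c ^ (k + 2)"] diff_diff_eq2)
      qed
      finally show "has_partial (\<lambda>u. conf I u ^ (k + 1) *\<^sub>R e i
          - (conf I u ^ (k + 2) * u $ i) *\<^sub>R (lincomb I e u - N)) i (L i) u" .
    qed
  next
    \<comment> \<open>As \<open>card I = k + 2\<close>, the last terms of the \<open>L i\<close> add
      up to M w. Replacing c |u|^2 by 2 - c leaves -M lincomb + M (1 - c) w, and this is -M X
      because w = lincomb - N.\<close>
    define M where "M = (real k + 2) * ?c ^ (k + 2)"
    define w where "w = ?w"
    have "L i = - (M *\<^sub>R (u $ i *\<^sub>R e i)) + (M * ?c * (u $ i)\<^sup>2) *\<^sub>R w - ?c ^ (k + 2) *\<^sub>R w" for i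
      by (simp add: L_def M_def w_def mult.assoc)
    moreover have "(\<Sum>i\<in>I. M *\<^sub>R (u $ i *\<^sub>R e i)) = M *\<^sub>R lincomb I e u"
      by (simp only: scaleR_sum_right lincomb_def)
    moreover have "(\<Sum>i\<in>I. (M * ?c * (u $ i)\<^sup>2) *\<^sub>R w) = (M * (?c * (\<Sum>i\<in>I. (u $ i)\<^sup>2))) *\<^sub>R w"
      by (simp only: scaleR_sum_left[symmetric] sum_distrib_left mult.assoc)
    moreover have "(\<Sum>i\<in>I. ?c ^ (k + 2) *\<^sub>R w) = M *\<^sub>R w"
      by (simp add: sum_constant_scaleR assms M_def add.commute)
    ultimately have "(\<Sum>i\<in>I. L i) = - (M *\<^sub>R lincomb I e u)
      + (M * (?c * (\<Sum>i\<in>I. (u $ i)\<^sup>2))) *\<^sub>R w - M *\<^sub>R w"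
      by (simp only: sum.distrib sum_subtractf sum_negf)
    also have "\<dots> = - (M *\<^sub>R lincomb I e u) + (M * (1 - ?c)) *\<^sub>R w"
      unfolding conf_times_sum
      by (simp add: add_diff_eq[symmetric] scaleR_left_diff_distrib[symmetric] right_diff_distrib)
    also have "\<dots> = - (M *\<^sub>R X u)"
      unfolding stereo_def w_def by (simp add: algebra_simps)
    finally show "(\<Sum>i\<in>I. L i) = - ((real (card I) * conf I u ^ card I) *\<^sub>R X u)"
      by (simp add: assms add.commute M_def)
  qed
qed

end

lemma sphere_frame_exists:
  fixes N :: "'a::euclidean_space" and I :: "'d::finite set"
  assumes "norm N = 1" "card I + 1 = DIM('a)"
  shows "\<exists>e. sphere_frame I e N"
proof -
  obtain S where S: "N \<in> S" "pairwise real_inner_class.orthogonal S" "\<And>x. x \<in> S \<Longrightarrow> norm x = 1"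
    "card S = DIM('a)" "span S = UNIV"
    using vector_in_orthonormal_basis[OF assms(1)] by metis
  have "finite S" using S(4) by (metis card.infinite DIM_positive less_irrefl)
  then have "card (S - {N}) = card I" using S assms(2) by simp
  then obtain e where e: "bij_betw e I (S - {N})"
    using finite_same_card_bij[of I "S - {N}"] \<open>finite S\<close> by auto
  have inj: "inj_on e I" and img: "e ` I = S - {N}" using e by (auto simp: bij_betw_def)
  have "sphere_frame I e N"
  proof
    fix i j assume ij: "i \<in> I" "j \<in> I"
    then have "e i \<in> S" "e j \<in> S" using img by auto
    then show "e i \<bullet> e j = (if i = j then 1 else 0)"
      using S(2) S(3)[of "e i"] inj_onD[OF inj, of i j] ij
      by (auto simp: pairwise_def real_inner_class.orthogonal_def norm_eq_1)
  next
    show "N \<bullet> N = 1" using assms(1) by (simp add: norm_eq_1)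
  next
    fix i assume "i \<in> I"
    then have "e i \<in> S - {N}" using img by auto
    then show "e i \<bullet> N = 0" using S(1,2) by (auto simp: pairwise_def real_inner_class.orthogonal_def)
  next
    fix X
    have "(\<Sum>i\<in>I. (X \<bullet> e i) *\<^sub>R e i) = (\<Sum>b\<in>S - {N}. (X \<bullet> b) *\<^sub>R b)"
      using sum.reindex[OF inj, of "\<lambda>b. (X \<bullet> b) *\<^sub>R b"] by (simp add: img)
    then have "(\<Sum>i\<in>I. (X \<bullet> e i) *\<^sub>R e i) + (X \<bullet> N) *\<^sub>R N = (\<Sum>b\<in>S. (X \<bullet> b) *\<^sub>R b)"
      using sum.remove[OF \<open>finite S\<close> S(1), of "\<lambda>b. (X \<bullet> b) *\<^sub>R b"] by (simp add: add.commute)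
    also have "\<dots> = X"
      using orthonormal_basis_expand[OF S(2,3) _ \<open>finite S\<close>] S(5) by auto
    finally show "(\<Sum>i\<in>I. (X \<bullet> e i) *\<^sub>R e i) + (X \<bullet> N) *\<^sub>R N = X" .
  qed
  then show ?thesis by blast
qed

context sphere_frame begin

text \<open>With n the inner product of x and N, the unit norm gives |u|^2 = (1 + n)/(1 - n), hence
  conf = 1 - n; the expansion of x in the frame does the rest.\<close>

lemma stereo_coords:
  assumes "norm x = 1" "x \<bullet> N \<noteq> 1" and u: "\<And>i. i \<in> I \<Longrightarrow> u $ i = (x \<bullet> e i) / (1 - x \<bullet> N)"
  shows "X u = x"
proof -
  define n where "n = x \<bullet> N"
  have n: "1 - n \<noteq> 0" using assms(2) by (simp add: n_def)
  have "1 = x \<bullet> ((\<Sum>i\<in>I. (x \<bullet> e i) *\<^sub>R e i) + n *\<^sub>R N)"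
    using assms(1) by (simp add: complete n_def norm_eq_1)
  then have sum: "(\<Sum>i\<in>I. (x \<bullet> e i)\<^sup>2) = 1 - n\<^sup>2"
    by (simp add: inner_add_right inner_sum_right power2_eq_square n_def)
  have "(\<Sum>i\<in>I. (u $ i)\<^sup>2) = (1 - n\<^sup>2) / (1 - n)\<^sup>2"
    unfolding sum[symmetric] sum_divide_distrib by (rule sum.cong) (simp_all add: u n_def power_divide)
  also have "1 - n\<^sup>2 = (1 + n) * (1 - n)" by (simp add: power2_eq_square algebra_simps)
  also have "\<dots> / (1 - n)\<^sup>2 = (1 + n) / (1 - n)" using n by (simp add: power2_eq_square)
  finally have "1 + (\<Sum>i\<in>I. (u $ i)\<^sup>2) = 2 / (1 - n)" using n by (simp add: field_simps)
  then have c: "conf I u = 1 - n" by (simp add: conf_def)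
  have "(1 - n) *\<^sub>R lincomb I e u = (\<Sum>i\<in>I. (x \<bullet> e i) *\<^sub>R e i)"
    unfolding lincomb_def scaleR_sum_right
    by (rule sum.cong) (use n in \<open>simp_all add: u n_def\<close>)
  then show ?thesis using complete[of x] by (simp add: stereo_def c n_def)
qed

end

text \<open>The index type of the chart is split into \<open>i0\<close> for the line and disjoint
  sets \<open>I\<close>, \<open>J\<close> for the two spheres.\<close>

locale product_chart = A: sphere_frame I e N + B: sphere_frame J f M
  for I :: "'d::finite set" and e :: "'d \<Rightarrow> 'a::euclidean_space" and N
    and J :: "'d set" and f :: "'d \<Rightarrow> 'b::euclidean_space" and M +
  fixes i0 :: 'd
  assumes UNIV_eq: "UNIV = insert i0 (I \<union> J)" and disj: "i0 \<notin> I" "i0 \<notin> J" "I \<inter> J = {}"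
begin

definition \<phi> :: "real^'d \<Rightarrow> real \<times> 'a \<times> 'b" where
  "\<phi> u = (u $ i0, A.X u, B.X u)"

definition \<phi>_partial :: "'d \<Rightarrow> real^'d \<Rightarrow> real \<times> 'a \<times> 'b" where
  "\<phi>_partial i u = (if i = i0 then 1 else 0, stereo_partial I e N i u, stereo_partial J f M i u)"

lemma index_cases:
  obtains "i = i0" "i \<notin> I" "i \<notin> J" | "i \<noteq> i0" "i \<in> I" "i \<notin> J" | "i \<noteq> i0" "i \<notin> I" "i \<in> J"
  using UNIV_eq disj by blast

lemma smooth_\<phi>: "smooth_on UNIV \<phi>"
  unfolding smooth_on_def \<phi>_def[abs_def]
  by (intro allI Ck_on_Pair Ck_on_coord Ck_on_stereo)

lemma has_partial_\<phi>: "has_partial \<phi> i (\<phi>_partial i u) u"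
  unfolding \<phi>_def[abs_def] \<phi>_partial_def
  by (intro has_partial_Pair has_partial_stereo has_partial_coord[where f = "\<lambda>x. x"] DERIV_ident)

lemma \<phi>_in: "\<phi> u \<in> line_spheres"
  by (simp add: \<phi>_def line_spheres_def A.norm_stereo B.norm_stereo)

text \<open>The weights are free because two choices occur: \<open>a = b = 1\<close> for the
  injectivity of the derivative, and the squared radii for the metric.\<close>

lemma \<phi>_partial_inner:
  fixes a b :: real
  defines "g \<equiv> \<lambda>(s, v, w) (s', v', w'). s * s' + a * (v \<bullet> v') + b * (w \<bullet> w')"
  shows "g (\<phi>_partial i u) (\<phi>_partial j u) =
    (if i = j then (if i = i0 then 1 else if i \<in> I then a * (conf I u)\<^sup>2 else b * (conf J u)\<^sup>2) else 0)"
proof -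
  have *: "stereo_partial I e N k u = 0" if "k \<notin> I" for k using that by (simp add: stereo_partial_def)
  have **: "stereo_partial J f M k u = 0" if "k \<notin> J" for k using that by (simp add: stereo_partial_def)
  show ?thesis
    by (cases rule: index_cases[of i]; cases rule: index_cases[of j])
      (auto simp: g_def \<phi>_partial_def * ** A.stereo_partial_inner B.stereo_partial_inner)
qed

text \<open>The images of the axes are orthogonal and nonzero, hence linearly independent.\<close>

lemma inj_derivative_\<phi>: "inj (frechet_derivative \<phi> (at u))"
proof -
  let ?D = "frechet_derivative \<phi> (at u)"
  have der: "(\<phi> has_derivative ?D) (at u)"
    using smooth_on_differentiable[OF smooth_\<phi>] by (simp add: frechet_derivative_works)
  then have lin: "linear ?D" by (simp add: has_derivative_bounded_linear bounded_linear.linear)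
  have D_axis: "?D (axis i 1) = \<phi>_partial i u" for i
    using has_partial_pderiv_at[OF has_partial_\<phi>] by (simp add: pderiv_at_def)
  have inner: "\<phi>_partial i u \<bullet> \<phi>_partial j u =
      (if i = j then (if i = i0 then 1 else if i \<in> I then (conf I u)\<^sup>2 else (conf J u)\<^sup>2) else 0)" for i j
    using \<phi>_partial_inner[of 1 1 i u j] by (simp add: case_prod_beta inner_prod_def cong: if_cong)
  have "v = 0" if "?D v = 0" for v
  proof -
    have "v = (\<Sum>i\<in>UNIV. v $ i *\<^sub>R axis i 1)"
      using basis_expansion[of v] by (simp add: scalar_mult_eq_scaleR)
    then have "?D v = ?D (\<Sum>i\<in>UNIV. v $ i *\<^sub>R axis i 1)" by simp
    also have "\<dots> = (\<Sum>i\<in>UNIV. v $ i *\<^sub>R \<phi>_partial i u)"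
      by (simp add: linear_sum[OF lin] linear_scale[OF lin] D_axis)
    finally have "(\<Sum>i\<in>UNIV. v $ i *\<^sub>R \<phi>_partial i u) = 0" using that by simp
    then have "0 = (\<Sum>i\<in>UNIV. v $ i *\<^sub>R \<phi>_partial i u) \<bullet> \<phi>_partial j u" for j by simp
    then have "0 = v $ j * (\<phi>_partial j u \<bullet> \<phi>_partial j u)" for j
      by (simp add: inner_sum_left inner if_distrib[of "\<lambda>x. _ * x"] cong: if_cong)
    then have "v $ j = 0" for j
      using less_imp_neq[OF conf_pos[of I u]] less_imp_neq[OF conf_pos[of J u]]
      by (fastforce simp: inner split: if_splits)
    then show ?thesis by (simp add: Finite_Cartesian_Product.vec_eq_iff)
  qed
  then show ?thesis using linear_injective_0[OF lin] by blast
qed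

definition \<psi> :: "real \<times> 'a \<times> 'b \<Rightarrow> real^'d" where
  "\<psi> = (\<lambda>(t, x, y). \<chi> i. if i = i0 then t
     else if i \<in> I then (x \<bullet> e i) / (1 - x \<bullet> N) else (y \<bullet> f i) / (1 - y \<bullet> M))"

lemma \<psi>_\<phi>: "\<psi> (\<phi> u) = u"
proof -
  have "\<psi> (\<phi> u) $ i = u $ i" for i
    using conf_pos[of I u] conf_pos[of J u]
    by (cases rule: index_cases[of i])
      (auto simp: \<psi>_def \<phi>_def A.stereo_inner_pole A.stereo_inner_basis
        B.stereo_inner_pole B.stereo_inner_basis)
  then show ?thesis by (simp add: Finite_Cartesian_Product.vec_eq_iff)
qed

lemma \<phi>_\<psi>:
  assumes "(t, x, y) \<in> line_spheres" "x \<bullet> N \<noteq> 1" "y \<bullet> M \<noteq> 1"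
  shows "\<phi> (\<psi> (t, x, y)) = (t, x, y)"
proof -
  have "A.X (\<psi> (t, x, y)) = x" "B.X (\<psi> (t, x, y)) = y"
    using assms disj by (auto intro!: A.stereo_coords B.stereo_coords simp: \<psi>_def line_spheres_def)
  then show ?thesis by (simp add: \<phi>_def) (simp add: \<psi>_def)
qed

lemma image_\<phi>: "\<phi> ` UNIV = line_spheres \<inter> {z. fst (snd z) \<bullet> N \<noteq> 1 \<and> snd (snd z) \<bullet> M \<noteq> 1}"
proof (intro equalityI subsetI)
  fix z assume "z \<in> \<phi> ` UNIV"
  then obtain u where "z = \<phi> u" by blast
  then show "z \<in> line_spheres \<inter> {z. fst (snd z) \<bullet> N \<noteq> 1 \<and> snd (snd z) \<bullet> M \<noteq> 1}"
    using \<phi>_in[of u] conf_pos[of I u] conf_pos[of J u]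
    by (simp add: \<phi>_def A.stereo_inner_pole B.stereo_inner_pole)
next
  fix z assume "z \<in> line_spheres \<inter> {z. fst (snd z) \<bullet> N \<noteq> 1 \<and> snd (snd z) \<bullet> M \<noteq> 1}"
  then have "\<phi> (\<psi> z) = z" by (cases z) (auto intro: \<phi>_\<psi>)
  then show "z \<in> \<phi> ` UNIV" by (metis rangeI)
qed

lemma local_param_\<phi>: "local_param line_spheres UNIV \<phi>"
  unfolding local_param_def
proof (intro conjI ballI)
  show "smooth_on UNIV \<phi>" by (rule smooth_\<phi>)
  show "inj (frechet_derivative \<phi> (at u))" for u by (rule inj_derivative_\<phi>)
  have "continuous_on (\<phi> ` UNIV) \<psi>"
  proof (subst continuous_on_componentwise, intro ballI)
    fix b :: "real^'d" assume "b \<in> Basis"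
    then obtain i where b: "b = axis i 1" by (auto simp: Basis_vec_def)
    have "continuous_on (\<phi> ` UNIV) (\<lambda>z. if i = i0 then fst z
     else if i \<in> I then (fst (snd z) \<bullet> e i) / (1 - fst (snd z) \<bullet> N)
     else (snd (snd z) \<bullet> f i) / (1 - snd (snd z) \<bullet> M))"
      unfolding image_\<phi> by (cases "i = i0"; cases "i \<in> I") (auto intro!: continuous_intros)
    then show "continuous_on (\<phi> ` UNIV) (\<lambda>z. \<psi> z \<bullet> b)"
      by (simp add: b inner_axis \<psi>_def case_prod_beta)
  qed
  then have "homeomorphism UNIV (\<phi> ` UNIV) \<phi> \<psi>"
    using smooth_on_0[OF smooth_\<phi>] by (intro homeomorphismI) (auto simp: \<psi>_\<phi>)
  then show "\<exists>\<psi>. homeomorphism UNIV (\<phi> ` UNIV) \<phi> \<psi>" by blast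
  have "open {z :: real \<times> 'a \<times> 'b. fst (snd z) \<bullet> N \<noteq> 1 \<and> snd (snd z) \<bullet> M \<noteq> 1}"
    by (intro open_Collect_conj open_Collect_neq continuous_intros)
  then show "openin (top_of_set line_spheres) (\<phi> ` UNIV)"
    unfolding image_\<phi> openin_open by blast
qed simp

end

text \<open>\<open>matrix_inv\<close> is a choice; once an explicit inverse is known, the choice is
  a right inverse, and multiplying by the explicit one identifies the two.\<close>

lemma matrix_inv_diagonal:
  fixes d :: "'d::finite \<Rightarrow> real"
  assumes "\<And>i. d i \<noteq> 0"
  shows "matrix_inv (\<chi> i j. if i = j then d i else 0) = (\<chi> i j. if i = j then 1 / d i else 0)"
proof -
  let ?A = "(\<chi> i j. if i = j then d i else 0) :: real^'d^'d"
  let ?B = "(\<chi> i j. if i = j then 1 / d i else 0) :: real^'d^'d"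
  have mult: "(\<chi> i j. if i = j then a i else 0) ** (\<chi> i j. if i = j then b i else 0)
      = (\<chi> i j. if i = j then a i * b i else 0)" for a b :: "'d \<Rightarrow> real"
    by (simp add: matrix_matrix_mult_def Finite_Cartesian_Product.vec_eq_iff if_distrib[of "\<lambda>x. x * _"] if_distrib[of "\<lambda>x. _ * x"]
        cong: if_cong)
  have AB: "?A ** ?B = Finite_Cartesian_Product.mat 1" "?B ** ?A = Finite_Cartesian_Product.mat 1"
    using assms unfolding mult by (simp_all add: Finite_Cartesian_Product.mat_def cong: if_cong)
  then have "?A ** matrix_inv ?A = Finite_Cartesian_Product.mat 1"
    unfolding matrix_inv_def by (rule_tac someI2[of _ ?B]) auto
  then have "?B = ?B ** (?A ** matrix_inv ?A)" by simp
  also have "\<dots> = matrix_inv ?A" by (simp add: matrix_mul_assoc AB)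
  finally show ?thesis ..
qed

subsection \<open>The harmonic map equation\<close>

context product_chart begin

context
  fixes l1 l2 F \<alpha> \<alpha>' :: "real \<Rightarrow> real" and \<kappa> :: real
    and g :: "(real \<times> 'a \<times> 'b) riem_metric" and G :: "real \<times> 'a \<times> 'b \<Rightarrow> 'a \<times> 'b"
  assumes smooth: "smooth_on UNIV l1" "smooth_on UNIV l2" "smooth_on UNIV F" "smooth_on UNIV \<alpha>"
    and pos: "\<And>t. 0 < l1 t" "\<And>t. 0 < l2 t"
    and vol: "\<And>t. l1 t ^ card I * l2 t ^ card J = F t"
    and rel: "\<And>t. real (card J) / (l2 t)\<^sup>2 - real (card I) / (l1 t)\<^sup>2 = \<kappa> / (F t)\<^sup>2"
    and der_\<alpha>: "\<And>t. (\<alpha> has_real_derivative \<alpha>' t) (at t)"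
    and pendulum: "\<And>t. ((\<lambda>t. F t * \<alpha>' t) has_real_derivative \<kappa> * sin (\<alpha> t) * cos (\<alpha> t) / F t) (at t)"
    and card2: "2 \<le> card I" "2 \<le> card J"
  defines "g \<equiv> \<lambda>(t, x, y) (s, v, w) (s', v', w').
      s * s' + (l1 t)\<^sup>2 * inner v v' + (l2 t)\<^sup>2 * inner w w'"
    and "G \<equiv> \<lambda>(t, x, y). (cos (\<alpha> t) *\<^sub>R x, sin (\<alpha> t) *\<^sub>R y)"
begin

lemma F_pos: "0 < F t"
  using vol[of t] pos by (metis mult_pos_pos zero_less_power)

definition diag :: "'d \<Rightarrow> real^'d \<Rightarrow> real" where
  "diag i u = (if i = i0 then 1 else if i \<in> I then (l1 (u $ i0))\<^sup>2 * (conf I u)\<^sup>2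
     else (l2 (u $ i0))\<^sup>2 * (conf J u)\<^sup>2)"

lemma diag_pos: "0 < diag i u"
  unfolding diag_def by (auto intro!: mult_pos_pos zero_less_power pos conf_pos)

lemma metric_coeffs_eq: "metric_coeffs g \<phi> u = (\<chi> i j. if i = j then diag i u else 0)"
proof -
  have "g (\<phi> u) (\<phi>_partial i u) (\<phi>_partial j u) = (if i = j then diag i u else 0)" for i j
    using \<phi>_partial_inner[of "(l1 (u $ i0))\<^sup>2" "(l2 (u $ i0))\<^sup>2" i u j]
    unfolding g_def diag_def by (simp add: \<phi>_def cong: if_cong)
  then show ?thesis
    by (simp add: metric_coeffs_def has_partial_pderiv_at[OF has_partial_\<phi>])
qed

lemma metric_coeffs_inv_eq: "metric_coeffs_inv g \<phi> u = (\<chi> i j. if i = j then 1 / diag i u else 0)"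
  unfolding metric_coeffs_inv_def metric_coeffs_eq
  by (rule matrix_inv_diagonal) (use diag_pos less_imp_neq in \<open>metis\<close>)

text \<open>The determinant is the square of (l1 conf)^p (l2 conf)^q; the volume condition merges
  the radii into \<open>F\<close>.\<close>

lemma volume_density_eq:
  "volume_density g \<phi> u = F (u $ i0) * conf I u ^ card I * conf J u ^ card J"
proof -
  have "Determinants.det (metric_coeffs g \<phi> u) = (\<Prod>i\<in>UNIV. diag i u)"
    unfolding metric_coeffs_eq by (subst Determinants.det_diagonal) simp_all
  also have "\<dots> = (\<Prod>i\<in>I. diag i u) * (\<Prod>i\<in>J. diag i u)"
    using disj unfolding UNIV_eq by (simp add: prod.union_disjoint diag_def)
  also have "(\<Prod>i\<in>I. diag i u) = (\<Prod>i\<in>I. (l1 (u $ i0) * conf I u)\<^sup>2)"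
    by (rule prod.cong) (use disj in \<open>auto simp: diag_def power_mult_distrib\<close>)
  also have "(\<Prod>i\<in>J. diag i u) = (\<Prod>i\<in>J. (l2 (u $ i0) * conf J u)\<^sup>2)"
    by (rule prod.cong) (use disj in \<open>auto simp: diag_def power_mult_distrib\<close>)
  finally have "Determinants.det (metric_coeffs g \<phi> u) =
      ((l1 (u $ i0) * conf I u) ^ card I * (l2 (u $ i0) * conf J u) ^ card J)\<^sup>2"
    by (simp add: power_mult_distrib power_mult[symmetric] mult.commute[of _ 2])
  moreover have "0 \<le> (l1 (u $ i0) * conf I u) ^ card I * (l2 (u $ i0) * conf J u) ^ card J"
    by (intro less_imp_le mult_pos_pos zero_less_power pos conf_pos)
  ultimately have "volume_density g \<phi> u =
      (l1 (u $ i0) * conf I u) ^ card I * (l2 (u $ i0) * conf J u) ^ card J"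
    by (simp add: volume_density_def)
  then show ?thesis by (simp add: power_mult_distrib vol[symmetric])
qed

definition G_partial :: "'d \<Rightarrow> real^'d \<Rightarrow> 'a \<times> 'b" where
  "G_partial i u =
    (if i = i0 then (- (\<alpha>' (u $ i0) * sin (\<alpha> (u $ i0))) *\<^sub>R A.X u, (\<alpha>' (u $ i0) * cos (\<alpha> (u $ i0))) *\<^sub>R B.X u)
     else (cos (\<alpha> (u $ i0)) *\<^sub>R stereo_partial I e N i u, sin (\<alpha> (u $ i0)) *\<^sub>R stereo_partial J f M i u))"

lemma der_cos_\<alpha>: "((\<lambda>t. cos (\<alpha> t)) has_real_derivative - (\<alpha>' t * sin (\<alpha> t))) (at t)"
  using der_\<alpha> by (auto intro!: derivative_eq_intros)

lemma der_sin_\<alpha>: "((\<lambda>t. sin (\<alpha> t)) has_real_derivative \<alpha>' t * cos (\<alpha> t)) (at t)"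
  using der_\<alpha> by (auto intro!: derivative_eq_intros)

lemma G_\<phi>: "(G \<circ> \<phi>) = (\<lambda>u. (cos (\<alpha> (u $ i0)) *\<^sub>R A.X u, sin (\<alpha> (u $ i0)) *\<^sub>R B.X u))"
  by (auto simp: G_def \<phi>_def)

lemma smooth_G_\<phi>: "smooth_on UNIV (G \<circ> \<phi>)"
  unfolding smooth_on_def G_\<phi>
proof
  fix k
  have "Ck_on k (\<lambda>u. \<alpha> (u $ i0)) UNIV"
    using smooth(4) by (intro Ck_on_compose_real[OF _ Ck_on_coord]) (simp add: smooth_on_def)
  then show "Ck_on k (\<lambda>u. (cos (\<alpha> (u $ i0)) *\<^sub>R A.X u, sin (\<alpha> (u $ i0)) *\<^sub>R B.X u)) UNIV"
    by (intro Ck_on_Pair Ck_on_scaleR Ck_on_stereo Ck_on_compose_real[OF conjunct1[OF Ck_on_sin_cos]]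
        Ck_on_compose_real[OF conjunct2[OF Ck_on_sin_cos]])
qed

lemma stereo_partial_0: "stereo_partial I e N i0 u = 0" "stereo_partial J f M i0 u = 0"
  "i \<in> I \<Longrightarrow> stereo_partial J f M i u = 0" "i \<in> J \<Longrightarrow> stereo_partial I e N i u = 0"
  using disj by (auto simp: stereo_partial_def)

lemma has_partial_coord_fun:
  assumes "\<And>t. (h has_real_derivative h' t) (at t)"
  shows "has_partial (\<lambda>u. h (u $ i0)) i (if i = i0 then h' (u $ i0) else 0) u"
  by (rule has_partial_coord[OF assms])

lemma pderiv_at_G: "pderiv_at i (G \<circ> \<phi>) u = G_partial i u"
proof -
  have "has_partial (G \<circ> \<phi>) i
     (cos (\<alpha> (u $ i0)) *\<^sub>R stereo_partial I e N i u
        + (if i = i0 then - (\<alpha>' (u $ i0) * sin (\<alpha> (u $ i0))) else 0) *\<^sub>R A.X u,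
      sin (\<alpha> (u $ i0)) *\<^sub>R stereo_partial J f M i u
        + (if i = i0 then \<alpha>' (u $ i0) * cos (\<alpha> (u $ i0)) else 0) *\<^sub>R B.X u) u"
    unfolding G_\<phi>
    by (intro has_partial_Pair has_partial_scaleR has_partial_stereo
        has_partial_coord[OF der_cos_\<alpha>] has_partial_coord[OF der_sin_\<alpha>])
  from has_partial_pderiv_at[OF this] show ?thesis
    by (simp add: G_partial_def stereo_partial_0)
qed

text \<open>In each sphere direction the conformal factor of the metric cancels the one in the
  squared length of the partial derivative.\<close>

lemma energy_density_eq:
  "energy_density g \<phi> G u = (\<alpha>' (u $ i0))\<^sup>2
     + real (card I) * (cos (\<alpha> (u $ i0)))\<^sup>2 / (l1 (u $ i0))\<^sup>2
     + real (card J) * (sin (\<alpha> (u $ i0)))\<^sup>2 / (l2 (u $ i0))\<^sup>2"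
proof -
  let ?t = "u $ i0"
  let ?E = "\<lambda>i. 1 / diag i u * (G_partial i u \<bullet> G_partial i u)"
  have "energy_density g \<phi> G u = (\<Sum>i\<in>UNIV. ?E i)"
    by (simp add: energy_density_def metric_coeffs_inv_eq pderiv_at_G
        if_distrib[of "\<lambda>x. x * _"] cong: if_cong)
  also have "\<dots> = ?E i0 + (sum ?E I + sum ?E J)"
    using disj unfolding UNIV_eq by (simp add: sum.union_disjoint)
  also have "?E i0 = (\<alpha>' ?t * sin (\<alpha> ?t))\<^sup>2 + (\<alpha>' ?t * cos (\<alpha> ?t))\<^sup>2"
    using A.norm_stereo[of u] B.norm_stereo[of u]
    by (simp add: diag_def G_partial_def inner_prod_def norm_eq_1 power2_eq_square)
  also have "\<dots> = (\<alpha>' ?t)\<^sup>2" by (simp add: power_mult_distrib flip: distrib_left)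
  also have "sum ?E I = (\<Sum>i\<in>I. (cos (\<alpha> ?t))\<^sup>2 / (l1 ?t)\<^sup>2)"
    by (rule sum.cong)
      (use disj conf_pos[of I u] in \<open>auto simp: diag_def G_partial_def inner_prod_def stereo_partial_0
         A.stereo_partial_inner power2_eq_square\<close>)
  also have "sum ?E J = (\<Sum>i\<in>J. (sin (\<alpha> ?t))\<^sup>2 / (l2 ?t)\<^sup>2)"
    by (rule sum.cong)
      (use disj conf_pos[of J u] in \<open>auto simp: diag_def G_partial_def inner_prod_def stereo_partial_0
         B.stereo_partial_inner power2_eq_square\<close>)
  finally show ?thesis by simp
qed

text \<open>The diagonal metric splits the divergence into three blocks. The direction
  \<open>i0\<close> calls on the pendulum equation. In \<open>I\<close> and \<open>J\<close> the
  quotient of volume density and metric coefficient contains \<open>conf\<close> to the power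
  dimension minus 2, exactly the weight of \<open>stereo_eigenfunction\<close>.\<close>

lemma laplace_beltrami_eq:
  "laplace_beltrami g \<phi> G u = - (energy_density g \<phi> G u *\<^sub>R G (\<phi> u))"
proof -
  let ?p = "card I" and ?q = "card J" and ?t = "u $ i0"
  let ?H = "\<lambda>i u. (volume_density g \<phi> u / diag i u) *\<^sub>R G_partial i u"
  let ?V = "conf I u ^ card I * conf J u ^ card J"
  obtain k where k: "?p = k + 2" using card2(1) by (metis le_add_diff_inverse2)
  obtain l where l: "?q = l + 2" using card2(2) by (metis le_add_diff_inverse2)
  have H_i0: "pderiv_at i0 (?H i0) u = ?V *\<^sub>R
    ((- (\<kappa> * sin (\<alpha> ?t) * cos (\<alpha> ?t) / F ?t * sin (\<alpha> ?t) + F ?t * \<alpha>' ?t * (\<alpha>' ?t * cos (\<alpha> ?t)))) *\<^sub>R A.X u,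
     (\<kappa> * sin (\<alpha> ?t) * cos (\<alpha> ?t) / F ?t * cos (\<alpha> ?t) - F ?t * \<alpha>' ?t * (\<alpha>' ?t * sin (\<alpha> ?t))) *\<^sub>R B.X u)"
  proof (rule has_partial_pderiv_at)
    have eq: "?H i0 = (\<lambda>u. (conf I u ^ ?p * conf J u ^ ?q) *\<^sub>R
       ((- (F (u $ i0) * \<alpha>' (u $ i0) * sin (\<alpha> (u $ i0)))) *\<^sub>R A.X u,
        (F (u $ i0) * \<alpha>' (u $ i0) * cos (\<alpha> (u $ i0))) *\<^sub>R B.X u))"
      by (simp add: volume_density_eq diag_def G_partial_def ac_simps)
    \<comment> \<open>The product F \<alpha>' is differentiated as a single factor by the pendulum
      equation, so that no second derivative of \<alpha> appears.\<close>
    have d1: "((\<lambda>t. - (F t * \<alpha>' t * sin (\<alpha> t))) has_real_derivative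
       - (\<kappa> * sin (\<alpha> t) * cos (\<alpha> t) / F t * sin (\<alpha> t) + F t * \<alpha>' t * (\<alpha>' t * cos (\<alpha> t)))) (at t)" for t
      by (rule DERIV_cong[OF DERIV_minus[OF DERIV_mult[OF pendulum der_sin_\<alpha>]]]) (simp add: ac_simps)
    have d2: "((\<lambda>t. F t * \<alpha>' t * cos (\<alpha> t)) has_real_derivative
       \<kappa> * sin (\<alpha> t) * cos (\<alpha> t) / F t * cos (\<alpha> t) - F t * \<alpha>' t * (\<alpha>' t * sin (\<alpha> t))) (at t)" for t
      by (rule DERIV_cong[OF DERIV_mult[OF pendulum der_cos_\<alpha>]]) (simp add: ac_simps)
    have c: "has_partial (conf I) i0 0 u" "has_partial (conf J) i0 0 u"
      using has_partial_conf[of I i0 u] has_partial_conf[of J i0 u] disj by auto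
    have s: "has_partial (stereo I e N) i0 0 u" "has_partial (stereo J f M) i0 0 u"
      using has_partial_stereo[of I e N i0 u] has_partial_stereo[of J f M i0 u]
      by (simp_all add: stereo_partial_0)
    show "has_partial (?H i0) i0 (?V *\<^sub>R
    ((- (\<kappa> * sin (\<alpha> ?t) * cos (\<alpha> ?t) / F ?t * sin (\<alpha> ?t) + F ?t * \<alpha>' ?t * (\<alpha>' ?t * cos (\<alpha> ?t)))) *\<^sub>R A.X u,
     (\<kappa> * sin (\<alpha> ?t) * cos (\<alpha> ?t) / F ?t * cos (\<alpha> ?t) - F ?t * \<alpha>' ?t * (\<alpha>' ?t * sin (\<alpha> ?t))) *\<^sub>R B.X u)) u"
      unfolding eq
      using has_partial_scaleR[OF has_partial_mult[OF has_partial_power[OF c(1), of ?p] has_partial_power[OF c(2), of ?q]]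
          has_partial_Pair[OF has_partial_scaleR[OF has_partial_coord_fun[OF d1, where i = i0] s(1)]
            has_partial_scaleR[OF has_partial_coord_fun[OF d2, where i = i0] s(2)]]]
      by simp
  qed
  define a where "a = (\<lambda>t. F t * cos (\<alpha> t) / (l1 t)\<^sup>2)"
  define b where "b = (\<lambda>t. F t * sin (\<alpha> t) / (l2 t)\<^sup>2)"
  have der_F: "(F has_real_derivative deriv F t) (at t)"
    and der_l1: "(l1 has_real_derivative deriv l1 t) (at t)"
    and der_l2: "(l2 has_real_derivative deriv l2 t) (at t)" for t
    using smooth by (auto intro: smooth_on_DERIV)
  have nz: "l1 t \<noteq> 0" "l2 t \<noteq> 0" "F t \<noteq> 0" for t
    using pos F_pos by (metis less_irrefl)+
  \<comment> \<open>Differentiability is enough: in the directions of \<open>I\<close> and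
    \<open>J\<close> a function of t alone has partial derivative 0.\<close>
  have "\<exists>D. \<forall>t. (a has_real_derivative D t) (at t)"
    unfolding a_def
    by (intro exI allI, rule DERIV_divide[OF DERIV_mult[OF der_F der_cos_\<alpha>] DERIV_power[OF der_l1]])
      (simp add: nz)
  then obtain a' where a': "\<And>t. (a has_real_derivative a' t) (at t)" by blast
  have "\<exists>D. \<forall>t. (b has_real_derivative D t) (at t)"
    unfolding b_def
    by (intro exI allI, rule DERIV_divide[OF DERIV_mult[OF der_F der_sin_\<alpha>] DERIV_power[OF der_l2]])
      (simp add: nz)
  then obtain b' where b': "\<And>t. (b has_real_derivative b' t) (at t)" by blast
  obtain L where L: "\<And>i. i \<in> I \<Longrightarrow> has_partial (\<lambda>u. conf I u ^ k *\<^sub>R stereo_partial I e N i u) i (L i) u"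
    "(\<Sum>i\<in>I. L i) = - ((real ?p * conf I u ^ ?p) *\<^sub>R A.X u)"
    using A.stereo_eigenfunction[OF k, of u] by blast
  obtain L' where L': "\<And>i. i \<in> J \<Longrightarrow> has_partial (\<lambda>u. conf J u ^ l *\<^sub>R stereo_partial J f M i u) i (L' i) u"
    "(\<Sum>i\<in>J. L' i) = - ((real ?q * conf J u ^ ?q) *\<^sub>R B.X u)"
    using B.stereo_eigenfunction[OF l, of u] by blast
  have H_I: "pderiv_at i (?H i) u = (a ?t * conf J u ^ ?q) *\<^sub>R (L i, 0)" if i: "i \<in> I" for i
  proof (rule has_partial_pderiv_at)
    have ne: "i \<noteq> i0" "i \<notin> J" using i disj by auto
    have "?H i u = (a (u $ i0) * conf J u ^ ?q) *\<^sub>R (conf I u ^ k *\<^sub>R stereo_partial I e N i u, 0)" for u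
    proof -
      have "volume_density g \<phi> u / diag i u * cos (\<alpha> (u $ i0)) = a (u $ i0) * conf J u ^ ?q * conf I u ^ k"
        using i ne nz conf_pos[of I u]
        by (simp add: volume_density_eq diag_def a_def k power_add power2_eq_square)
      then show ?thesis using i ne by (simp add: G_partial_def stereo_partial_0)
    qed
    then have eq: "?H i = (\<lambda>u. (a (u $ i0) * conf J u ^ ?q) *\<^sub>R (conf I u ^ k *\<^sub>R stereo_partial I e N i u, 0))"
      by blast
    have c: "has_partial (conf J) i 0 u" using has_partial_conf[of J i u] ne by simp
    show "has_partial (?H i) i ((a ?t * conf J u ^ ?q) *\<^sub>R (L i, 0)) u"
      unfolding eq
      using has_partial_scaleR[OF has_partial_mult[OF has_partial_coord_fun[OF a', where i = i] has_partial_power[OF c, of ?q]]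
          has_partial_Pair[OF L(1)[OF i] has_partial_const[where c = 0]]] ne
      by simp
  qed
  have H_J: "pderiv_at i (?H i) u = (b ?t * conf I u ^ ?p) *\<^sub>R (0, L' i)" if i: "i \<in> J" for i
  proof (rule has_partial_pderiv_at)
    have ne: "i \<noteq> i0" "i \<notin> I" using i disj by auto
    have "?H i u = (b (u $ i0) * conf I u ^ ?p) *\<^sub>R (0, conf J u ^ l *\<^sub>R stereo_partial J f M i u)" for u
    proof -
      have "volume_density g \<phi> u / diag i u * sin (\<alpha> (u $ i0)) = b (u $ i0) * conf I u ^ ?p * conf J u ^ l"
        using i ne nz conf_pos[of J u]
        by (simp add: volume_density_eq diag_def b_def l power_add power2_eq_square)
      then show ?thesis using i ne by (simp add: G_partial_def stereo_partial_0)
    qed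
    then have eq: "?H i = (\<lambda>u. (b (u $ i0) * conf I u ^ ?p) *\<^sub>R (0, conf J u ^ l *\<^sub>R stereo_partial J f M i u))"
      by blast
    have c: "has_partial (conf I) i 0 u" using has_partial_conf[of I i u] ne by simp
    show "has_partial (?H i) i ((b ?t * conf I u ^ ?p) *\<^sub>R (0, L' i)) u"
      unfolding eq
      using has_partial_scaleR[OF has_partial_mult[OF has_partial_coord_fun[OF b', where i = i] has_partial_power[OF c, of ?p]]
          has_partial_Pair[OF has_partial_const[where c = 0] L'(1)[OF i]]] ne
      by simp
  qed
  have cancel: "(1 / (d * V)) *\<^sub>R (V *\<^sub>R (x *\<^sub>R X, y *\<^sub>R Y) + (V *\<^sub>R (- m *\<^sub>R X, 0) + V *\<^sub>R (0, - n *\<^sub>R Y)))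
      = ((1 / d * (x - m)) *\<^sub>R X, (1 / d * (y - n)) *\<^sub>R Y)"
    if "V \<noteq> 0" for d V x y m n :: real and X :: 'a and Y :: 'b
  proof -
    have "V *\<^sub>R (x *\<^sub>R X, y *\<^sub>R Y) + (V *\<^sub>R (- m *\<^sub>R X, 0) + V *\<^sub>R (0, - n *\<^sub>R Y))
      = V *\<^sub>R ((x - m) *\<^sub>R X, (y - n) *\<^sub>R Y)" by (simp add: algebra_simps)
    then show ?thesis using that by simp
  qed
  have "laplace_beltrami g \<phi> G u = (1 / (F ?t * ?V)) *\<^sub>R (\<Sum>i\<in>UNIV. pderiv_at i (?H i) u)"
    by (simp add: laplace_beltrami_def metric_coeffs_inv_eq pderiv_at_G volume_density_eq mult.assoc
        if_distrib[of "\<lambda>x. x *\<^sub>R _"] cong: if_cong)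
  also have "(\<Sum>i\<in>UNIV. pderiv_at i (?H i) u) = pderiv_at i0 (?H i0) u
      + ((\<Sum>i\<in>I. pderiv_at i (?H i) u) + (\<Sum>i\<in>J. pderiv_at i (?H i) u))"
    using disj unfolding UNIV_eq by (simp add: sum.union_disjoint)
  also have "(\<Sum>i\<in>I. pderiv_at i (?H i) u) = ?V *\<^sub>R (- (a ?t * real ?p) *\<^sub>R A.X u, 0)"
  proof -
    have "(\<Sum>i\<in>I. pderiv_at i (?H i) u) = (a ?t * conf J u ^ ?q) *\<^sub>R (\<Sum>i\<in>I. (L i, 0))"
      by (simp add: H_I scaleR_sum_right)
    also have "(\<Sum>i\<in>I. (L i, 0::'b)) = (\<Sum>i\<in>I. L i, 0)"
      by (simp add: prod_eq_iff fst_sum snd_sum)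
    finally show ?thesis by (simp add: L(2) ac_simps)
  qed
  also have "(\<Sum>i\<in>J. pderiv_at i (?H i) u) = ?V *\<^sub>R (0, - (b ?t * real ?q) *\<^sub>R B.X u)"
  proof -
    have "(\<Sum>i\<in>J. pderiv_at i (?H i) u) = (b ?t * conf I u ^ ?p) *\<^sub>R (\<Sum>i\<in>J. (0, L' i))"
      by (simp add: H_J scaleR_sum_right)
    also have "(\<Sum>i\<in>J. (0::'a, L' i)) = (0, \<Sum>i\<in>J. L' i)"
      by (simp add: prod_eq_iff fst_sum snd_sum)
    finally show ?thesis by (simp add: L'(2) ac_simps)
  qed
  finally have lap: "laplace_beltrami g \<phi> G u =
     ((1 / F ?t * (- (\<kappa> * sin (\<alpha> ?t) * cos (\<alpha> ?t) / F ?t * sin (\<alpha> ?t) + F ?t * \<alpha>' ?t * (\<alpha>' ?t * cos (\<alpha> ?t)))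
         - a ?t * real ?p)) *\<^sub>R A.X u,
      (1 / F ?t * (\<kappa> * sin (\<alpha> ?t) * cos (\<alpha> ?t) / F ?t * cos (\<alpha> ?t) - F ?t * \<alpha>' ?t * (\<alpha>' ?t * sin (\<alpha> ?t))
         - b ?t * real ?q)) *\<^sub>R B.X u)"
    unfolding H_i0 by (rule trans[OF _ cancel]) (use conf_pos[of I u] conf_pos[of J u] in simp_all)
  let ?s = "sin (\<alpha> ?t)" and ?c = "cos (\<alpha> ?t)" and ?E = "energy_density g \<phi> G u"
  \<comment> \<open>The relation of the radii enters here as m2 - m1 = K. The identities to check
    are K s^2 + m1 = m1 c^2 + m2 s^2 for the x-block and m2 - K c^2 = m1 c^2 + m2 s^2 for the
    y-block, where s^2 + c^2 = 1.\<close>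
  define K where "K = \<kappa> / (F ?t)\<^sup>2"
  define m1 m2 where "m1 = real ?p / (l1 ?t)\<^sup>2" and "m2 = real ?q / (l2 ?t)\<^sup>2"
  have K: "m2 - m1 = K" using rel[of ?t] by (simp add: m1_def m2_def K_def)
  have E: "?E = (\<alpha>' ?t)\<^sup>2 + m1 * ?c\<^sup>2 + m2 * ?s\<^sup>2"
    unfolding energy_density_eq m1_def m2_def by simp
  have sc: "?s\<^sup>2 = 1 - ?c\<^sup>2" by (rule sin_squared_eq)
  have ab: "a ?t * real ?p = F ?t * (m1 * ?c)" "b ?t * real ?q = F ?t * (m2 * ?s)"
    by (simp_all add: a_def b_def m1_def m2_def)
  have "1 / d * (- (\<kappa> * s * c / d * s + d * r * (r * c)) - d * (m * c))
      = - (\<kappa> / d\<^sup>2 * s\<^sup>2 * c) - r\<^sup>2 * c - m * c" if "d \<noteq> 0" for d r s c m :: real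
    using that by (simp add: power2_eq_square field_simps)
  from this[OF nz(3)[of ?t]]
  have "1 / F ?t * (- (\<kappa> * ?s * ?c / F ?t * ?s + F ?t * \<alpha>' ?t * (\<alpha>' ?t * ?c)) - a ?t * real ?p)
    = - (K * ?s\<^sup>2 * ?c) - (\<alpha>' ?t)\<^sup>2 * ?c - m1 * ?c"
    unfolding ab K_def .
  also have "\<dots> = - (?E * ?c)" unfolding E K[symmetric] sc by (simp add: algebra_simps)
  finally have x: "1 / F ?t * (- (\<kappa> * ?s * ?c / F ?t * ?s + F ?t * \<alpha>' ?t * (\<alpha>' ?t * ?c)) - a ?t * real ?p)
    = - (?E * ?c)" .
  have "1 / d * (\<kappa> * s * c / d * c - d * r * (r * s) - d * (m * s))
      = \<kappa> / d\<^sup>2 * c\<^sup>2 * s - r\<^sup>2 * s - m * s" if "d \<noteq> 0" for d r s c m :: real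
    using that by (simp add: power2_eq_square field_simps)
  from this[OF nz(3)[of ?t]]
  have "1 / F ?t * (\<kappa> * ?s * ?c / F ?t * ?c - F ?t * \<alpha>' ?t * (\<alpha>' ?t * ?s) - b ?t * real ?q)
    = K * ?c\<^sup>2 * ?s - (\<alpha>' ?t)\<^sup>2 * ?s - m2 * ?s"
    unfolding ab K_def .
  also have "\<dots> = - (?E * ?s)" unfolding E K[symmetric] sc by (simp add: algebra_simps)
  finally have y: "1 / F ?t * (\<kappa> * ?s * ?c / F ?t * ?c - F ?t * \<alpha>' ?t * (\<alpha>' ?t * ?s) - b ?t * real ?q)
    = - (?E * ?s)" .
  show ?thesis unfolding lap x y by (simp add: G_def \<phi>_def)
qed

end

end

subsection \<open>Determinants of frames\<close>

lemma frame_det_swap: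
  assumes "length us + length vs + 2 = length B"
  shows "frame_det B (us @ a # b # vs) = - frame_det B (us @ b # a # vs)"
proof -
  let ?n = "length B" and ?k = "length us"
  let ?A = "\<lambda>vs. Matrix.mat (length vs) ?n (\<lambda>(i, j). inner (vs ! i) (B ! j)) :: real Matrix.mat"
  have "?A (us @ a # b # vs) = swaprows ?k (Suc ?k) (?A (us @ b # a # vs))"
    by (rule eq_matI) (use assms in \<open>auto simp: nth_append nth_Cons' not_less\<close>)
  moreover have "Determinant.det (swaprows ?k (Suc ?k) (?A (us @ b # a # vs))) = - Determinant.det (?A (us @ b # a # vs))"
    by (rule det_swaprows[of _ ?n]) (use assms in auto)
  ultimately show ?thesis by (simp add: frame_det_def)
qed

lemma frame_det_move:
  assumes "length us + length xs + length vs + 1 = length B"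
  shows "frame_det B (us @ a # xs @ vs) = (- 1) ^ length xs * frame_det B (us @ xs @ a # vs)"
  using assms
proof (induction xs arbitrary: us)
  case (Cons x xs)
  have "frame_det B (us @ a # (x # xs) @ vs) = - frame_det B ((us @ [x]) @ a # xs @ vs)"
    using frame_det_swap[of us "xs @ vs" B a x] Cons.prems by simp
  also have "frame_det B ((us @ [x]) @ a # xs @ vs) = (- 1) ^ length xs * frame_det B ((us @ [x]) @ xs @ a # vs)"
    by (rule Cons.IH) (use Cons.prems in simp)
  finally show ?case by simp
qed simp

lemma frame_det_scaleR:
  assumes "length us + length vs + 1 = length B"
  shows "frame_det B (us @ (c *\<^sub>R a) # vs) = c * frame_det B (us @ a # vs)"
proof -
  let ?n = "length B" and ?k = "length us"
  let ?A = "\<lambda>vs. Matrix.mat (length vs) ?n (\<lambda>(i, j). inner (vs ! i) (B ! j)) :: real Matrix.mat"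
  have "?A (us @ (c *\<^sub>R a) # vs) = multrow ?k c (?A (us @ a # vs))"
    by (rule eq_matI) (use assms in \<open>auto simp: nth_append nth_Cons'\<close>)
  moreover have "Determinant.det (multrow ?k c (?A (us @ a # vs))) = c * Determinant.det (?A (us @ a # vs))"
    by (rule det_multrow[of _ ?n]) (use assms in auto)
  ultimately show ?thesis by (simp add: frame_det_def)
qed

lemma frame_det_map_scaleR:
  assumes "length us + length xs + length vs = length B"
  shows "frame_det B (us @ map (\<lambda>x. c *\<^sub>R x) xs @ vs) = c ^ length xs * frame_det B (us @ xs @ vs)"
  using assms
proof (induction xs arbitrary: us)
  case (Cons x xs)
  have "frame_det B (us @ map (\<lambda>x. c *\<^sub>R x) (x # xs) @ vs)
      = c * frame_det B ((us @ [x]) @ map (\<lambda>x. c *\<^sub>R x) xs @ vs)"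
    using frame_det_scaleR[of us "map (\<lambda>x. c *\<^sub>R x) xs @ vs" B c x] Cons.prems by simp
  also have "frame_det B ((us @ [x]) @ map (\<lambda>x. c *\<^sub>R x) xs @ vs)
      = c ^ length xs * frame_det B ((us @ [x]) @ xs @ vs)"
    by (rule Cons.IH) (use Cons.prems in simp)
  finally show ?case by simp
qed simp

lemma frame_det_add:
  assumes "length us + length xs + length vs + 2 = length B"
  shows "frame_det B (us @ (a + c *\<^sub>R b) # xs @ b # vs) = frame_det B (us @ a # xs @ b # vs)"
proof -
  let ?n = "length B" and ?k = "length us" and ?l = "length us + length xs + 1"
  let ?A = "\<lambda>vs. Matrix.mat (length vs) ?n (\<lambda>(i, j). inner (vs ! i) (B ! j)) :: real Matrix.mat"
  have "?A (us @ (a + c *\<^sub>R b) # xs @ b # vs) = addrow c ?k ?l (?A (us @ a # xs @ b # vs))"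
    by (rule eq_matI) (use assms in \<open>auto simp: nth_append nth_Cons' inner_add_left\<close>)
  moreover have "Determinant.det (addrow c ?k ?l (?A (us @ a # xs @ b # vs)))
      = Determinant.det (?A (us @ a # xs @ b # vs))"
    by (rule det_addrow[of _ ?n]) (use assms in auto)
  ultimately show ?thesis by (simp add: frame_det_def)
qed

text \<open>The leading vectors have no second component, so the matrix is block lower triangular
  and the first components of \<open>ws\<close> drop out.\<close>

lemma frame_det_block:
  assumes "length vs = length B" "length ws = length C"
  shows "frame_det (map (\<lambda>e. (e, 0)) B @ map (\<lambda>e. (0, e)) C) (map (\<lambda>v. (v, 0)) vs @ ws)
    = frame_det B vs * frame_det C (map snd ws)"
proof -
  let ?n = "length B" and ?m = "length C"
  let ?A = "\<lambda>B vs. Matrix.mat (length vs) (length B) (\<lambda>(i, j). inner (vs ! i) (B ! j)) :: real Matrix.mat"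
  let ?L = "Matrix.mat ?m ?n (\<lambda>(i, j). inner (fst (ws ! i)) (B ! j)) :: real Matrix.mat"
  have "?A (map (\<lambda>e. (e, 0)) B @ map (\<lambda>e. (0, e)) C) (map (\<lambda>v. (v, 0)) vs @ ws)
      = four_block_mat (?A B vs) (0\<^sub>m ?n ?m) ?L (?A C (map snd ws))"
    by (rule eq_matI) (use assms in \<open>auto simp: nth_append inner_prod_def\<close>)
  also have "Determinant.det \<dots> = Determinant.det (?A B vs) * Determinant.det (?A C (map snd ws))"
    by (rule det_four_block_mat_upper_right_zero[of _ ?n _ ?m]) (use assms in auto)
  finally show ?thesis by (simp add: frame_det_def)
qed

lemma length_std_basis: "length (std_basis :: (real^'n::{finite,linorder}) list) = CARD('n)"
  by (simp add: std_basis_def)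

lemma length_std_basis_sum:
  "length (std_basis_sum :: ((real^'n::{finite,linorder}) \<times> (real^'m::{finite,linorder})) list) = CARD('n) + CARD('m)"
  by (simp add: std_basis_sum_def length_std_basis)

lemma inner_std_basis:
  fixes u v :: "real^'n::{finite,linorder}"
  shows "(\<Sum>j<CARD('n). inner u (std_basis ! j) * inner v (std_basis ! j)) = inner u v"
proof -
  have "(\<Sum>j<CARD('n). inner u (std_basis ! j) * inner v (std_basis ! j))
    = sum_list (map (\<lambda>b. inner u b * inner v b) std_basis)"
    by (simp add: sum_list_sum_nth length_std_basis atLeast0LessThan)
  also have "\<dots> = sum_list (map (\<lambda>i. u $ i * v $ i) (sorted_list_of_set UNIV))"
    by (simp add: std_basis_def comp_def inner_axis)
  also have "\<dots> = (\<Sum>i\<in>UNIV. u $ i * v $ i)"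
    by (subst sum_list_distinct_conv_sum_set) simp_all
  finally show ?thesis by (simp add: inner_vec_def)
qed

text \<open>The matrix times its transpose is the identity, so the determinant squares to 1.\<close>

lemma frame_det_orthonormal_nonzero:
  fixes us :: "(real^'n::{finite,linorder}) list"
  assumes len: "length us = CARD('n)"
    and on: "\<And>i j. i < length us \<Longrightarrow> j < length us \<Longrightarrow> inner (us ! i) (us ! j) = (if i = j then 1 else 0)"
  shows "frame_det std_basis us \<noteq> 0"
proof -
  let ?n = "CARD('n)"
  define A where "A = (Matrix.mat ?n ?n (\<lambda>(i, j). inner (us ! i) (std_basis ! j)) :: real Matrix.mat)"
  have A: "A \<in> carrier_mat ?n ?n" by (simp add: A_def)
  have "A * transpose_mat A = 1\<^sub>m ?n"
    by (rule eq_matI) (auto simp: A_def scalar_prod_def inner_std_basis atLeast0LessThan on len)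
  then have "Determinant.det A * Determinant.det A = 1"
    using det_mult[OF A, of "transpose_mat A"] det_transpose[OF A] A by simp
  then show ?thesis by (auto simp: frame_det_def length_std_basis len A_def)
qed

text \<open>Justifies the choice in \<open>product_frame\<close>. An orthonormal basis through x has
  the right sign after negating one tangent vector if necessary; dimension at least 2 supplies such
  a vector.\<close>

lemma positive_frame_exists:
  fixes x :: "real^'n::{finite,linorder}"
  assumes "norm x = 1" "2 \<le> CARD('n)"
  shows "\<exists>vs. positive_frame x vs"
proof -
  obtain S where S: "x \<in> S" "pairwise real_inner_class.orthogonal S" "\<And>x. x \<in> S \<Longrightarrow> norm x = 1"
    "card S = DIM(real^'n::{finite,linorder})"
    using vector_in_orthonormal_basis[OF assms(1)] by metis
  have "finite S" using S(4) by (metis card.infinite DIM_positive less_irrefl)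
  then obtain vs where vs: "set vs = S - {x}" "distinct vs"
    using finite_distinct_list[of "S - {x}"] by auto
  have len: "length (x # vs) = CARD('n)"
    using distinct_card[OF vs(2)] S(1,4) \<open>finite S\<close> vs(1) assms(2) by simp
  have dist: "distinct (x # vs)" and set: "set (x # vs) = S" using vs S(1) by auto
  have nz: "frame_det std_basis (x # vs) \<noteq> 0"
  proof (rule frame_det_orthonormal_nonzero[OF len])
    fix i j assume ij: "i < length (x # vs)" "j < length (x # vs)"
    then have "(x # vs) ! i \<in> S" "(x # vs) ! j \<in> S" using set by (metis nth_mem)+
    moreover have "(x # vs) ! i = (x # vs) ! j \<longleftrightarrow> i = j" using nth_eq_iff_index_eq[OF dist ij] .
    ultimately show "inner ((x # vs) ! i) ((x # vs) ! j) = (if i = j then 1 else 0)"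
      using S(2) S(3)[of "(x # vs) ! i"]
      by (auto simp: pairwise_def real_inner_class.orthogonal_def norm_eq_1)
  qed
  have orth: "inner x v = 0" if "v \<in> set vs" for v
    using that vs(1) S(1,2) by (auto simp: pairwise_def real_inner_class.orthogonal_def)
  obtain v vs' where v: "vs = v # vs'" using len assms(2) by (cases vs) auto
  show ?thesis
  proof (cases "0 < frame_det std_basis (x # vs)")
    case True
    then have "positive_frame x vs" using len orth by (simp add: positive_frame_def)
    then show ?thesis by blast
  next
    case False
    have "frame_det std_basis (x # (- v) # vs') = - frame_det std_basis (x # vs)"
      using frame_det_scaleR[of "[x]" vs' std_basis "- 1" v] len by (simp add: v length_std_basis)
    then have "positive_frame x ((- v) # vs')"
      using False nz len orth by (auto simp: positive_frame_def v)
    then show ?thesis by blast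
  qed
qed

text \<open>The frame below is the image of a product frame under the differential of the join
  \<open>(t, x, y) \<mapsto> (c x, s y)\<close>, where \<open>c = cos \<theta>\<close>, \<open>s = sin \<theta>\<close> and \<open>r = \<theta>'\<close>.\<close>

lemma frame_det_join:
  fixes x :: "real^'n::{finite,linorder}" and y :: "real^'m::{finite,linorder}" and c s r :: real
  assumes x: "positive_frame x vs" and y: "positive_frame y ws"
    and even: "even (length vs)" "even (length ws)"
    and cs: "c \<noteq> 0" "s \<noteq> 0" "c\<^sup>2 + s\<^sup>2 = 1" and "0 < r"
  shows "0 < frame_det std_basis_sum
    ((c *\<^sub>R x, s *\<^sub>R y) # (- (r * s) *\<^sub>R x, (r * c) *\<^sub>R y) #
      map (\<lambda>v. (c *\<^sub>R v, 0)) vs @ map (\<lambda>w. (0, s *\<^sub>R w)) ws)"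
proof -
  let ?B = "std_basis_sum :: ((real^'n::{finite,linorder}) \<times> (real^'m::{finite,linorder})) list"
  let ?V = "map (\<lambda>v. (v, 0)) vs :: ((real^'n::{finite,linorder}) \<times> (real^'m::{finite,linorder})) list"
  let ?W = "map (\<lambda>w. (0, w)) ws :: ((real^'n::{finite,linorder}) \<times> (real^'m::{finite,linorder})) list"
  let ?a = "(c *\<^sub>R x, s *\<^sub>R y)" and ?b = "(- (r * s) *\<^sub>R x, (r * c) *\<^sub>R y)"
  have len: "length vs + 1 = CARD('n)" "length ws + 1 = CARD('m)"
    using x y by (simp_all add: positive_frame_def)
  note lens = len(1)[symmetric] len(2)[symmetric] length_std_basis_sum length_std_basis
  have "frame_det ?B (?a # ?b # map (\<lambda>v. (c *\<^sub>R v, 0)) vs @ map (\<lambda>w. (0, s *\<^sub>R w)) ws)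
      = frame_det ?B ([?a, ?b] @ map (\<lambda>v. c *\<^sub>R v) ?V @ map (\<lambda>w. s *\<^sub>R w) ?W)"
    by (simp add: comp_def)
  also have "\<dots> = c ^ length vs * frame_det ?B (([?a, ?b] @ ?V) @ map (\<lambda>w. s *\<^sub>R w) ?W @ [])"
    by (subst frame_det_map_scaleR) (simp_all add: lens)
  also have "\<dots> = c ^ length vs * (s ^ length ws * frame_det ?B ([?a] @ ?b # ?V @ ?W))"
    by (subst frame_det_map_scaleR) (simp_all add: lens)
  \<comment> \<open>Moving \<open>?b\<close> past \<open>?V\<close> costs the sign (-1)^p = 1 and
    prepares the block form.\<close>
  also have "frame_det ?B ([?a] @ ?b # ?V @ ?W) = frame_det ?B ([] @ ?a # ?V @ ?b # ?W)"
    by (subst frame_det_move) (simp_all add: lens even)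
  \<comment> \<open>The multiple of \<open>?b\<close> removes the y-part of \<open>?a\<close>; the
    x-part becomes c + s^2/c = 1/c.\<close>
  also have "\<dots> = frame_det ?B ([] @ (?a + (- (s / (r * c))) *\<^sub>R ?b) # ?V @ ?b # ?W)"
    by (rule frame_det_add[symmetric]) (simp add: lens)
  also have "?a + (- (s / (r * c))) *\<^sub>R ?b = (1 / c) *\<^sub>R (x, 0)"
  proof -
    have "c + s / (r * c) * (r * s) = 1 / c" "s - s / (r * c) * (r * c) = 0"
      using cs \<open>0 < r\<close> by (simp_all add: field_simps power2_eq_square)
    then show ?thesis
      by (simp add: scaleR_left_distrib[symmetric] scaleR_left_diff_distrib[symmetric])
  qed
  also have "frame_det ?B ([] @ (1 / c) *\<^sub>R (x, 0) # ?V @ ?b # ?W)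
      = 1 / c * frame_det ?B ([] @ (x, 0) # ?V @ ?b # ?W)"
    by (rule frame_det_scaleR) (simp add: lens)
  also have "frame_det ?B ([] @ (x, 0) # ?V @ ?b # ?W)
      = frame_det std_basis (x # vs) * frame_det std_basis ((r * c) *\<^sub>R y # ws)"
    using frame_det_block[of "x # vs" std_basis "?b # ?W" std_basis]
    by (simp add: std_basis_sum_def lens comp_def)
  also have "frame_det std_basis ((r * c) *\<^sub>R y # ws) = r * c * frame_det std_basis (y # ws)"
    using frame_det_scaleR[of "[]" ws std_basis "r * c" y] by (simp add: lens)
  also have "c ^ length vs * (s ^ length ws * (1 / c * (frame_det std_basis (x # vs)
      * (r * c * frame_det std_basis (y # ws)))))
      = c ^ length vs * s ^ length ws * r * frame_det std_basis (x # vs) * frame_det std_basis (y # ws)"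
    using cs by simp
  also have "\<dots> > 0"
    using x y even cs \<open>0 < r\<close> by (auto intro!: mult_pos_pos simp: positive_frame_def zero_less_power_eq)
  finally show ?thesis .
qed

subsection \<open>Differentials on the product of the line and two spheres\<close>

text \<open>A curve on the sphere with prescribed velocity, also for v = 0: by orthogonality the
  line x + h v has length sqrt (1 + h^2 |v|^2), and the normalizing factor has derivative 0 at h =
  0.\<close>

lemma normalized_line_derivative:
  fixes x v :: "'a::euclidean_space"
  assumes "norm x = 1" "inner x v = 0"
  shows "((\<lambda>h. (1 / sqrt (1 + h\<^sup>2 * (inner v v))) *\<^sub>R (x + h *\<^sub>R v)) has_vector_derivative v) (at 0)"
    and "norm ((1 / sqrt (1 + h\<^sup>2 * (inner v v))) *\<^sub>R (x + h *\<^sub>R v)) = 1"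
proof -
  have "((\<lambda>h. 1 / sqrt (1 + h\<^sup>2 * (inner v v))) has_real_derivative 0) (at 0)"
    by (auto intro!: derivative_eq_intros)
  moreover have "((\<lambda>h. x + h *\<^sub>R v) has_vector_derivative v) (at 0)"
    by (auto intro!: derivative_eq_intros)
  ultimately show "((\<lambda>h. (1 / sqrt (1 + h\<^sup>2 * (inner v v))) *\<^sub>R (x + h *\<^sub>R v)) has_vector_derivative v) (at 0)"
    using has_vector_derivative_scaleR[of "\<lambda>h. 1 / sqrt (1 + h\<^sup>2 * (inner v v))" 0 0 UNIV "\<lambda>h. x + h *\<^sub>R v" v]
    by simp
  have pos: "0 < 1 + h\<^sup>2 * (inner v v)" by (intro add_pos_nonneg mult_nonneg_nonneg) auto
  have "(norm (x + h *\<^sub>R v))\<^sup>2 = 1 + h\<^sup>2 * (inner v v)"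
    using assms unfolding power2_norm_eq_inner
    by (simp add: inner_add_left inner_add_right inner_commute[of v x] norm_eq_1 power2_eq_square)
  then have "norm (x + h *\<^sub>R v) = sqrt (1 + h\<^sup>2 * (inner v v))" by (metis norm_ge_zero real_sqrt_unique)
  then show "norm ((1 / sqrt (1 + h\<^sup>2 * (inner v v))) *\<^sub>R (x + h *\<^sub>R v)) = 1"
    using pos by simp
qed

text \<open>\<open>differential\<close> is only some derivative within the set. Composed with a
  curve that stays in the set, it and \<open>D\<close> both give the derivative of f along the
  curve, so they agree on its velocity.\<close>

lemma differential_eq:
  assumes f: "(f has_derivative D) (at (t, x, y))"
    and x: "norm x = 1" "inner x v = 0" and y: "norm y = 1" "inner y w = 0"
  shows "differential f (t, x, y) (s, v, w) = D (s, v, w)"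
proof -
  define \<gamma> where "\<gamma> = (\<lambda>h. (t + h * s, (1 / sqrt (1 + h\<^sup>2 * (inner v v))) *\<^sub>R (x + h *\<^sub>R v),
    (1 / sqrt (1 + h\<^sup>2 * (inner w w))) *\<^sub>R (y + h *\<^sub>R w)))"
  have \<gamma>0: "\<gamma> 0 = (t, x, y)" by (simp add: \<gamma>_def)
  have "((\<lambda>h. t + h * s) has_vector_derivative s) (at 0)"
    by (auto intro!: derivative_eq_intros)
  then have "(\<gamma> has_vector_derivative (s, v, w)) (at 0)"
    unfolding \<gamma>_def
    by (intro has_vector_derivative_Pair normalized_line_derivative(1) x y)
  then have \<gamma>: "(\<gamma> has_derivative (\<lambda>h. h *\<^sub>R (s, v, w))) (at 0)"
    by (simp add: has_vector_derivative_def)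
  have "\<gamma> h \<in> line_spheres" for h
    unfolding \<gamma>_def line_spheres_def
    by (intro SigmaI UNIV_I)
      (simp_all only: mem_sphere_0 normalized_line_derivative(2)[OF x] normalized_line_derivative(2)[OF y])
  then have range: "range \<gamma> \<subseteq> line_spheres" by blast
  have chain: "((\<lambda>h. f (\<gamma> h)) has_derivative (\<lambda>h. E (h *\<^sub>R (s, v, w)))) (at 0)"
    if "(f has_derivative E) (at (t, x, y) within line_spheres)" for E
    using has_derivative_in_compose[OF \<gamma>, of f E] has_derivative_subset[OF that range] by (simp add: \<gamma>0)
  have within: "(f has_derivative D) (at (t, x, y) within line_spheres)"
    using f by (rule has_derivative_at_withinI)
  then have "(f has_derivative differential f (t, x, y)) (at (t, x, y) within line_spheres)"
    unfolding differential_def by (metis differentiableI frechet_derivative_works)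
  from has_derivative_unique[OF chain[OF this] chain[OF within]]
  have "differential f (t, x, y) (1 *\<^sub>R (s, v, w)) = D (1 *\<^sub>R (s, v, w))" by metis
  then show ?thesis by simp
qed

subsection \<open>Counting preimages\<close>

lemma card_arith_progression:
  fixes a b :: real and n :: nat
  shows "finite {\<theta>. a \<le> \<theta> \<and> \<theta> < a + real n * pi \<and> (\<exists>i::int. \<theta> = b + of_int i * pi)}"
    and "card {\<theta>. a \<le> \<theta> \<and> \<theta> < a + real n * pi \<and> (\<exists>i::int. \<theta> = b + of_int i * pi)} = n"
proof -
  let ?S = "{\<theta>. a \<le> \<theta> \<and> \<theta> < a + real n * pi \<and> (\<exists>i::int. \<theta> = b + of_int i * pi)}"
  \<comment> \<open>The least admissible integer; the half-open interval admits exactly n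
    consecutive ones.\<close>
  define c where "c = \<lceil>(a - b) / pi\<rceil>"
  have iff: "a \<le> b + of_int i * pi \<and> b + of_int i * pi < a + real n * pi \<longleftrightarrow> i \<in> {c..<c + int n}" for i :: int
  proof -
    have "a \<le> b + of_int i * pi \<longleftrightarrow> (a - b) / pi \<le> of_int i" by (simp add: field_simps)
    also have "\<dots> \<longleftrightarrow> c \<le> i" by (simp add: c_def ceiling_le_iff)
    finally have 1: "a \<le> b + of_int i * pi \<longleftrightarrow> c \<le> i" .
    have "b + of_int i * pi < a + real n * pi \<longleftrightarrow> of_int (i - int n) < (a - b) / pi"
      by (simp add: field_simps)
    also have "\<dots> \<longleftrightarrow> i - int n < c" by (simp add: c_def less_ceiling_iff del: of_int_diff)
    finally show ?thesis using 1 by auto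
  qed
  have S: "?S = (\<lambda>i. b + of_int i * pi) ` {c..<c + int n}"
    using iff by blast
  have "inj_on (\<lambda>i::int. b + of_int i * pi) {c..<c + int n}" by (auto simp: inj_on_def)
  then show "finite ?S" "card ?S = n" unfolding S by (simp_all add: card_image)
qed

text \<open>The solutions form the two progressions b + i pi and -b + i pi, disjoint because 0 < 2 b
  < pi; each meets the interval n times.\<close>

lemma card_cos_squared_eq:
  fixes a r :: real and n :: nat
  assumes r: "0 < r" "r < 1"
  shows "finite {\<theta>. a \<le> \<theta> \<and> \<theta> < a + real n * pi \<and> (cos \<theta>)\<^sup>2 = r}"
    and "card {\<theta>. a \<le> \<theta> \<and> \<theta> < a + real n * pi \<and> (cos \<theta>)\<^sup>2 = r} = 2 * n"
proof -
  define b where "b = arccos (sqrt r)"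
  let ?A = "\<lambda>b. {\<theta>. a \<le> \<theta> \<and> \<theta> < a + real n * pi \<and> (\<exists>i::int. \<theta> = b + of_int i * pi)}"
  have sq: "0 < sqrt r" "sqrt r < 1" using r by auto
  have cos_b: "cos b = sqrt r" unfolding b_def using sq by (intro cos_arccos) linarith+
  have b: "0 < b" "b < pi / 2"
    using arccos_less_arccos[of "sqrt r" 1] arccos_less_arccos[of 0 "sqrt r"] sq by (auto simp: b_def)
  have "(cos \<theta>)\<^sup>2 = r \<longleftrightarrow> (\<exists>i::int. \<theta> = b + of_int i * pi) \<or> (\<exists>i::int. \<theta> = - b + of_int i * pi)" for \<theta>
  proof -
    have "sin (\<theta> - b) * sin (\<theta> + b) = (sin \<theta>)\<^sup>2 * (cos b)\<^sup>2 - (cos \<theta>)\<^sup>2 * (sin b)\<^sup>2"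
      by (simp add: sin_add sin_diff power2_eq_square algebra_simps)
    also have "\<dots> = (cos b)\<^sup>2 - (cos \<theta>)\<^sup>2" by (simp add: sin_squared_eq algebra_simps)
    also have "(cos b)\<^sup>2 = r" using r by (simp add: cos_b)
    finally have "(cos \<theta>)\<^sup>2 = r \<longleftrightarrow> sin (\<theta> - b) = 0 \<or> sin (\<theta> + b) = 0" by auto
    then show ?thesis by (simp add: sin_zero_iff_int2 algebra_simps eq_diff_eq)
  qed
  then have eq: "{\<theta>. a \<le> \<theta> \<and> \<theta> < a + real n * pi \<and> (cos \<theta>)\<^sup>2 = r} = ?A b \<union> ?A (- b)" by blast
  have "?A b \<inter> ?A (- b) = {}"
  proof -
    have False if "b + of_int i * pi = - b + of_int j * pi" for i j :: int
    proof -
      have "of_int (j - i) * pi = 2 * b" using that by (simp add: algebra_simps)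
      then have "0 < of_int (j - i) * pi" "of_int (j - i) * pi < 1 * pi" using b by auto
      then have "0 < j - i" "j - i < 1" by (auto simp: zero_less_mult_iff)
      then show False by simp
    qed
    then show ?thesis by fast
  qed
  from card_Un_disjoint[OF card_arith_progression(1) card_arith_progression(1) this]
  show "card {\<theta>. a \<le> \<theta> \<and> \<theta> < a + real n * pi \<and> (cos \<theta>)\<^sup>2 = r} = 2 * n"
    unfolding eq card_arith_progression(2) by simp
  show "finite {\<theta>. a \<le> \<theta> \<and> \<theta> < a + real n * pi \<and> (cos \<theta>)\<^sup>2 = r}"
    unfolding eq by (intro finite_UnI card_arith_progression(1))
qed

lemma orthogonal_pair_exists:
  assumes "2 \<le> DIM('a::euclidean_space)"
  shows "\<exists>x z :: 'a. norm x = 1 \<and> inner x z = 0 \<and> z \<noteq> 0"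
proof -
  obtain x :: 'a where x: "x \<in> Basis" using nonempty_Basis by blast
  have "card (Basis - {x}) \<noteq> 0" using assms x by simp
  then obtain z where "z \<in> Basis" "z \<noteq> x" by (metis Diff_iff all_not_in_conv card.empty singletonI)
  then show ?thesis using x by (metis inner_not_same_Basis nonzero_Basis norm_Basis)
qed

subsection \<open>The degree of a join with increasing angle\<close>

context
  fixes \<alpha> \<alpha>' :: "real \<Rightarrow> real" and P :: real and m :: nat
    and G :: "real \<times> (real^'a::{finite,linorder}) \<times> (real^'b::{finite,linorder}) \<Rightarrow> (real^'a::{finite,linorder}) \<times> (real^'b::{finite,linorder})"
  assumes der: "\<And>t. (\<alpha> has_real_derivative \<alpha>' t) (at t)" and \<alpha>'_pos: "\<And>t. 0 < \<alpha>' t"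
    and step: "\<And>t. \<alpha> (t + P) = \<alpha> t + 2 * pi * real m" and P: "0 < P" and m: "0 < m"
  assumes G_eq: "\<And>t x y. G (t, x, y) = (cos (\<alpha> t) *\<^sub>R x, sin (\<alpha> t) *\<^sub>R y)"
begin

lemma \<alpha>_mono: "t < t' \<Longrightarrow> \<alpha> t < \<alpha> t'"
  by (rule DERIV_pos_imp_increasing[where f = \<alpha>]) (auto intro: der \<alpha>'_pos)

lemma \<alpha>_less_iff: "\<alpha> t < \<alpha> t' \<longleftrightarrow> t < t'"
  using \<alpha>_mono by (metis linorder_neqE_linordered_idom less_asym less_irrefl)

lemma \<alpha>_surj: "surj \<alpha>"
  by (rule quasi_periodic_surj[of \<alpha>, OF _ step])
    (use DERIV_isCont[OF der] P m in \<open>auto intro: continuous_at_imp_continuous_on\<close>)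

lemma differential_G:
  assumes "norm x = 1" "inner x v = 0" "norm y = 1" "inner y w = 0"
  shows "differential G (t, x, y) (s, v, w) =
    (- (\<alpha>' t * s * sin (\<alpha> t)) *\<^sub>R x + cos (\<alpha> t) *\<^sub>R v, (\<alpha>' t * s * cos (\<alpha> t)) *\<^sub>R y + sin (\<alpha> t) *\<^sub>R w)"
proof -
  have d\<alpha>: "((\<lambda>z. \<alpha> (fst z)) has_derivative (\<lambda>h. \<alpha>' t * fst h)) (at (t, x, y))"
    using has_derivative_compose[OF has_derivative_fst[OF has_derivative_ident] der[of "fst (t, x, y)", unfolded has_field_derivative_def]]
    by simp
  have "((\<lambda>z. (cos (\<alpha> (fst z)) *\<^sub>R fst (snd z), sin (\<alpha> (fst z)) *\<^sub>R snd (snd z))) has_derivative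
     (\<lambda>h. (cos (\<alpha> t) *\<^sub>R fst (snd h) + (- (sin (\<alpha> t)) * (\<alpha>' t * fst h)) *\<^sub>R x,
           sin (\<alpha> t) *\<^sub>R snd (snd h) + (cos (\<alpha> t) * (\<alpha>' t * fst h)) *\<^sub>R y))) (at (t, x, y))"
    by (auto intro!: derivative_eq_intros d\<alpha> simp: mult.commute)
  moreover have "G = (\<lambda>z. (cos (\<alpha> (fst z)) *\<^sub>R fst (snd z), sin (\<alpha> (fst z)) *\<^sub>R snd (snd z)))"
    by (auto simp: G_eq)
  ultimately have "(G has_derivative
     (\<lambda>h. (cos (\<alpha> t) *\<^sub>R fst (snd h) + (- (sin (\<alpha> t)) * (\<alpha>' t * fst h)) *\<^sub>R x,
           sin (\<alpha> t) *\<^sub>R snd (snd h) + (cos (\<alpha> t) * (\<alpha>' t * fst h)) *\<^sub>R y))) (at (t, x, y))"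
    by simp
  from differential_eq[OF this assms] show ?thesis by (simp add: ac_simps)
qed

text \<open>At a preimage of \<open>(a, 0)\<close> or \<open>(0, b)\<close> one of the spheres collapses to a point, so that the
  differential is not surjective.\<close>

lemma regular_value_iff:
  assumes "2 \<le> CARD('a)" "2 \<le> CARD('b)"
  shows "regular_value G (a, b) \<longleftrightarrow> norm (a, b) = 1 \<and> a \<noteq> 0 \<and> b \<noteq> 0"
proof
  assume reg: "regular_value G (a, b)"
  then have ab: "norm (a, b) = 1" by (simp add: regular_value_def)
  have surj: "{v. inner (a, b) v = 0} = differential G (t, x, y) ` (UNIV \<times> {v. inner x v = 0} \<times> {v. inner y v = 0})"
    \<comment> \<open>Surjectivity holds at every preimage, so the collapsed sphere coordinate can
      be chosen freely below, with a tangent direction z that is missed.\<close>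
    if "norm x = 1" "norm y = 1" "G (t, x, y) = (a, b)" for t x y
    using reg that by (auto simp: regular_value_def line_spheres_def)
  have "a \<noteq> 0"
  proof
    assume [simp]: "a = 0"
    obtain t where t: "\<alpha> t = pi / 2" using \<alpha>_surj by (metis surjD)
    obtain x z :: "real^'a::{finite,linorder}" where x: "norm x = 1" and z: "inner x z = 0" "z \<noteq> 0"
      using orthogonal_pair_exists[where 'a = "real^'a::{finite,linorder}"] assms by auto
    have b: "norm b = 1" using ab by (simp add: norm_Pair)
    have "G (t, x, b) = (a, b)" by (simp add: G_eq t)
    from surj[OF x b this] have "(z, 0) \<in> differential G (t, x, b) ` (UNIV \<times> {v. inner x v = 0} \<times> {v. inner b v = 0})"
      by (auto simp: inner_prod_def)
    then obtain s v w where "(z, 0) = differential G (t, x, b) (s, v, w)" "inner x v = 0" "inner b w = 0"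
      by auto
    then have "z = - (\<alpha>' t * s) *\<^sub>R x" using x b by (simp add: differential_G t)
    then have "inner z z = - (\<alpha>' t * s) * inner x z" by (metis inner_scaleR_left)
    then show False using z by simp
  qed
  moreover have "b \<noteq> 0"
  proof
    assume [simp]: "b = 0"
    obtain t where t: "\<alpha> t = 0" using \<alpha>_surj by (metis surjD)
    obtain y z :: "real^'b::{finite,linorder}" where y: "norm y = 1" and z: "inner y z = 0" "z \<noteq> 0"
      using orthogonal_pair_exists[where 'a = "real^'b::{finite,linorder}"] assms by auto
    have a: "norm a = 1" using ab by (simp add: norm_Pair)
    have "G (t, a, y) = (a, b)" by (simp add: G_eq t)
    from surj[OF a y this] have "(0, z) \<in> differential G (t, a, y) ` (UNIV \<times> {v. inner a v = 0} \<times> {v. inner y v = 0})"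
      by (auto simp: inner_prod_def)
    then obtain s v w where "(0, z) = differential G (t, a, y) (s, v, w)" "inner a v = 0" "inner y w = 0"
      by auto
    then have "z = (\<alpha>' t * s) *\<^sub>R y" using a y by (simp add: differential_G t)
    then have "inner z z = (\<alpha>' t * s) * inner y z" by (metis inner_scaleR_left)
    then show False using z by simp
  qed
  ultimately show "norm (a, b) = 1 \<and> a \<noteq> 0 \<and> b \<noteq> 0" using ab by simp
next
  assume ab: "norm (a, b) = 1 \<and> a \<noteq> 0 \<and> b \<noteq> 0"
  have "differential G (t, x, y) ` (UNIV \<times> {v. inner x v = 0} \<times> {v. inner y v = 0}) = {v. inner (a, b) v = 0}"
    if x: "norm x = 1" and y: "norm y = 1" and G: "G (t, x, y) = (a, b)" for t x y
  proof (intro equalityI subsetI)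
    have a: "a = cos (\<alpha> t) *\<^sub>R x" and b: "b = sin (\<alpha> t) *\<^sub>R y" using G by (simp_all add: G_eq)
    have xx: "inner x x = 1" "inner y y = 1" using x y by (simp_all add: norm_eq_1)
    {
      fix u assume "u \<in> differential G (t, x, y) ` (UNIV \<times> {v. inner x v = 0} \<times> {v. inner y v = 0})"
      then obtain s v w where "u = differential G (t, x, y) (s, v, w)" "inner x v = 0" "inner y w = 0" by auto
      then show "u \<in> {v. inner (a, b) v = 0}"
        using x y xx by (simp add: differential_G a b inner_add_right inner_diff_right)
    next
      fix u assume "u \<in> {v. inner (a, b) v = 0}"
      then obtain p q where u: "u = (p, q)" and orth: "inner a p + inner b q = 0" by (cases u) auto
      have nz: "cos (\<alpha> t) \<noteq> 0" "sin (\<alpha> t) \<noteq> 0" "\<alpha>' t \<noteq> 0"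
        using ab a b \<alpha>'_pos[of t] by auto
      \<comment> \<open>Tangency at (a, b) ties the components of u along x and y to one number l,
        the angular speed that the line direction has to produce.\<close>
      define l where "l = inner y q / cos (\<alpha> t)"
      have l: "inner y q = l * cos (\<alpha> t)" "inner x p = - (l * sin (\<alpha> t))"
        using orth nz by (simp_all add: l_def a b field_simps)
      let ?v = "(1 / cos (\<alpha> t)) *\<^sub>R (p - inner x p *\<^sub>R x)" and ?w = "(1 / sin (\<alpha> t)) *\<^sub>R (q - inner y q *\<^sub>R y)"
      have tang: "inner x ?v = 0" "inner y ?w = 0" by (simp_all add: inner_diff_right xx)
      have "differential G (t, x, y) (l / \<alpha>' t, ?v, ?w) = u"
        using differential_G[OF x tang(1) y tang(2), of t "l / \<alpha>' t"] nz by (simp add: u l)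
      then show "u \<in> differential G (t, x, y) ` (UNIV \<times> {v. inner x v = 0} \<times> {v. inner y v = 0})"
        using tang by (auto intro!: image_eqI[of u _ "(l / \<alpha>' t, ?v, ?w)"])
    }
  qed
  then show "regular_value G (a, b)" using ab by (auto simp: regular_value_def line_spheres_def)
qed

text \<open>The time determines the preimage through x = a / cos \<alpha> and y = b / sin \<alpha>;
  the unit norms of x and y amount to the single condition on the cosine.\<close>

lemma fibre_eq:
  assumes ab: "norm (a, b) = 1" "a \<noteq> 0" "b \<noteq> 0"
  shows "{z \<in> line_spheres. 0 \<le> fst z \<and> fst z < P \<and> G z = (a, b)} =
    (\<lambda>t. (t, (1 / cos (\<alpha> t)) *\<^sub>R a, (1 / sin (\<alpha> t)) *\<^sub>R b)) ` {t. 0 \<le> t \<and> t < P \<and> (cos (\<alpha> t))\<^sup>2 = (norm a)\<^sup>2}"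
    (is "?L = ?f ` ?R")
proof (intro equalityI subsetI)
  fix z assume "z \<in> ?L"
  then obtain t x y where z: "z = (t, x, y)" "norm x = 1" "norm y = 1" "0 \<le> t" "t < P"
    "a = cos (\<alpha> t) *\<^sub>R x" "b = sin (\<alpha> t) *\<^sub>R y"
    by (cases z) (auto simp: line_spheres_def G_eq)
  then show "z \<in> ?f ` ?R" using ab by (intro image_eqI[of z _ t]) auto
next
  fix z assume "z \<in> ?f ` ?R"
  then obtain t where t: "0 \<le> t" "t < P" "(cos (\<alpha> t))\<^sup>2 = (norm a)\<^sup>2" and z: "z = ?f t" by blast
  have "(norm a)\<^sup>2 + (norm b)\<^sup>2 = 1" using ab(1) by (simp add: norm_Pair)
  then have s: "(sin (\<alpha> t))\<^sup>2 = (norm b)\<^sup>2" using t(3) by (simp add: sin_squared_eq)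
  have abs: "\<bar>cos (\<alpha> t)\<bar> = norm a" "\<bar>sin (\<alpha> t)\<bar> = norm b"
    using t(3) s power2_eq_iff_nonneg[of "\<bar>cos (\<alpha> t)\<bar>" "norm a"] power2_eq_iff_nonneg[of "\<bar>sin (\<alpha> t)\<bar>" "norm b"]
    by simp_all
  then have "cos (\<alpha> t) \<noteq> 0" "sin (\<alpha> t) \<noteq> 0" using ab(2,3) by auto
  then show "z \<in> ?L" using t ab abs by (simp add: z line_spheres_def G_eq)
qed

text \<open>The increasing \<alpha> maps one period bijectively onto an interval of 2 m half-turns,
  each of which contributes two solutions.\<close>

lemma card_times:
  assumes ab: "norm (a, b) = 1" "a \<noteq> 0" "b \<noteq> 0"
  shows "finite {t. 0 \<le> t \<and> t < P \<and> (cos (\<alpha> t))\<^sup>2 = (norm a)\<^sup>2}"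
    and "card {t. 0 \<le> t \<and> t < P \<and> (cos (\<alpha> t))\<^sup>2 = (norm a)\<^sup>2} = 4 * m"
proof -
  let ?R = "{t. 0 \<le> t \<and> t < P \<and> (cos (\<alpha> t))\<^sup>2 = (norm a)\<^sup>2}"
  let ?S = "{\<theta>. \<alpha> 0 \<le> \<theta> \<and> \<theta> < \<alpha> 0 + real (2 * m) * pi \<and> (cos \<theta>)\<^sup>2 = (norm a)\<^sup>2}"
  have "(norm a)\<^sup>2 + (norm b)\<^sup>2 = 1" using ab(1) by (simp add: norm_Pair)
  moreover have "0 < (norm a)\<^sup>2" "0 < (norm b)\<^sup>2" using ab by simp_all
  ultimately have r: "0 < (norm a)\<^sup>2" "(norm a)\<^sup>2 < 1" by linarith+
  have "\<alpha> P = \<alpha> 0 + real (2 * m) * pi" using step[of 0] by simp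
  then have iff: "t \<in> ?R \<longleftrightarrow> \<alpha> t \<in> ?S" for t
    using \<alpha>_less_iff[of t 0] \<alpha>_less_iff[of t P] by (auto simp: not_less[symmetric])
  have inj: "inj \<alpha>" using \<alpha>_mono by (intro strict_mono_imp_inj_on strict_monoI)
  have "\<alpha> ` ?R = ?S"
  proof (intro equalityI subsetI)
    fix \<theta> assume \<theta>: "\<theta> \<in> ?S"
    obtain t where "\<theta> = \<alpha> t" using \<alpha>_surj by (metis surjD)
    with iff \<theta> show "\<theta> \<in> \<alpha> ` ?R" by blast
  qed (use iff in blast)
  then have bij: "bij_betw \<alpha> ?R ?S" using inj by (auto simp: bij_betw_def intro: inj_on_subset)
  show "finite ?R" using bij_betw_finite[OF bij] card_cos_squared_eq(1)[OF r] by blast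
  show "card ?R = 4 * m" using bij_betw_same_card[OF bij] card_cos_squared_eq(2)[OF r, of "\<alpha> 0" "2 * m"] by simp
qed

lemma local_sign_G:
  assumes "norm x = 1" "norm y = 1" "cos (\<alpha> t) \<noteq> 0" "sin (\<alpha> t) \<noteq> 0"
    and card: "2 \<le> CARD('a)" "2 \<le> CARD('b)" "odd CARD('a)" "odd CARD('b)"
  shows "local_sign G (t, x, y) = 1"
proof -
  define vs where "vs = (SOME vs. positive_frame x vs)"
  define ws where "ws = (SOME ws. positive_frame y ws)"
  have vs: "positive_frame x vs" unfolding vs_def by (rule someI_ex[OF positive_frame_exists[OF assms(1) card(1)]])
  have ws: "positive_frame y ws" unfolding ws_def by (rule someI_ex[OF positive_frame_exists[OF assms(2) card(2)]])
  \<comment> \<open>A tangent frame has one vector fewer than the ambient dimension, which turns odd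
    cardinalities into even lengths.\<close>
  have even: "even (length vs)" "even (length ws)"
    using vs ws card(3,4) by (metis positive_frame_def even_plus_one_iff)+
  have "map (differential G (t, x, y)) (product_frame (t, x, y)) =
    (- (\<alpha>' t * sin (\<alpha> t)) *\<^sub>R x, (\<alpha>' t * cos (\<alpha> t)) *\<^sub>R y) #
    map (\<lambda>v. (cos (\<alpha> t) *\<^sub>R v, 0)) vs @ map (\<lambda>w. (0, sin (\<alpha> t) *\<^sub>R w)) ws"
    using assms(1,2) vs[unfolded positive_frame_def] ws[unfolded positive_frame_def]
    by (simp add: product_frame_def vs_def[symmetric] ws_def[symmetric] differential_G)
  moreover have "0 < frame_det std_basis_sum
    ((cos (\<alpha> t) *\<^sub>R x, sin (\<alpha> t) *\<^sub>R y) # (- (\<alpha>' t * sin (\<alpha> t)) *\<^sub>R x, (\<alpha>' t * cos (\<alpha> t)) *\<^sub>R y) #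
      map (\<lambda>v. (cos (\<alpha> t) *\<^sub>R v, 0)) vs @ map (\<lambda>w. (0, sin (\<alpha> t) *\<^sub>R w)) ws)"
    by (rule frame_det_join[OF vs ws even assms(3,4) _ \<alpha>'_pos]) simp
  ultimately show ?thesis by (simp add: local_sign_def G_eq)
qed

lemma has_degree_G:
  assumes card: "2 \<le> CARD('a)" "2 \<le> CARD('b)" "odd CARD('a)" "odd CARD('b)"
  shows "has_degree P G (4 * int m)"
  unfolding has_degree_def
proof (intro conjI allI impI)
  \<comment> \<open>A Pythagorean triple supplies a unit vector with both blocks nonzero.\<close>
  obtain a :: "real^'a::{finite,linorder}" where a: "norm a = 3 / 5" using vector_choose_size[of "3 / 5"] by auto
  obtain b :: "real^'b::{finite,linorder}" where b: "norm b = 4 / 5" using vector_choose_size[of "4 / 5"] by auto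
  have "norm (a, b) = 1" unfolding norm_Pair a b by (simp add: power_divide)
  moreover have "a \<noteq> 0" "b \<noteq> 0" using a b by auto
  ultimately show "\<exists>w. regular_value G w" using regular_value_iff[OF card(1,2)] by blast
next
  fix w assume reg: "regular_value G w"
  obtain a b where w: "w = (a, b)" by (cases w)
  have ab: "norm (a, b) = 1" "a \<noteq> 0" "b \<noteq> 0"
    using reg regular_value_iff[OF card(1,2)] by (auto simp: w)
  let ?L = "{z \<in> line_spheres. 0 \<le> fst z \<and> fst z < P \<and> G z = w}"
  let ?R = "{t. 0 \<le> t \<and> t < P \<and> (cos (\<alpha> t))\<^sup>2 = (norm a)\<^sup>2}"
  let ?f = "\<lambda>t. (t, (1 / cos (\<alpha> t)) *\<^sub>R a, (1 / sin (\<alpha> t)) *\<^sub>R b)"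
  have L: "?L = ?f ` ?R" unfolding w by (rule fibre_eq[OF ab])
  have inj: "inj_on ?f ?R" by (auto simp: inj_on_def)
  have "local_sign G z = 1" if "z \<in> ?L" for z
  proof -
    obtain t x y where z: "z = (t, x, y)" by (cases z)
    have "norm x = 1" "norm y = 1" "cos (\<alpha> t) *\<^sub>R x = a" "sin (\<alpha> t) *\<^sub>R y = b"
      using that by (auto simp: z w line_spheres_def G_eq)
    then show ?thesis unfolding z using ab by (intro local_sign_G card) auto
  qed
  then have "(\<Sum>z\<in>?L. local_sign G z) = real (card ?L)" by simp
  also have "card ?L = 4 * m" unfolding L card_image[OF inj] by (rule card_times(2)[OF ab])
  finally show "let fib = ?L in finite fib \<and> (\<Sum>z\<in>fib. local_sign G z) = of_int (4 * int m)"
    using card_times(1)[OF ab] L by simp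
qed

end

subsection \<open>Harmonic maps of degree \<open>4m\<close>\<close>

lemma tau_properties:
  assumes F: "smooth_on UNIV F" "\<And>t. 0 < F t" "periodic P F" and "0 < P"
  shows "(tau F t0 has_real_derivative 1 / F t) (at t)"
    and "smooth_on UNIV (tau F t0)"
    and "tau F t0 (t + P) = tau F t0 t + I_F F P"
    and "0 < I_F F P"
proof -
  have C: "Ck_on k (\<lambda>t. 1 / F t) UNIV" for k
    using F(1) less_imp_neq[OF F(2)]
    by (intro Ck_on_divide Ck_on_const) (auto simp: smooth_on_def)
  then have cont: "continuous_on UNIV (\<lambda>t. 1 / F t)" by (metis Ck_on.simps(1))
  have der: "(tau F c has_real_derivative 1 / F t) (at t)" for c t
    unfolding tau_def[abs_def] by (rule LBINT_has_real_derivative[OF cont])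
  show "(tau F t0 has_real_derivative 1 / F t) (at t)" by (rule der)
  show "smooth_on UNIV (tau F t0)" by (rule smooth_on_bootstrap[OF der C])
  have I: "I_F F P = tau F 0 P - tau F 0 0" by (simp add: I_F_def tau_def)
  \<comment> \<open>\<open>I_F\<close> starts at 0 and \<open>tau\<close> at \<open>t0\<close>; the
    two antiderivatives differ by a constant.\<close>
  have "((\<lambda>s. tau F t0 s - tau F 0 s) has_real_derivative 1 / F s - 1 / F s) (at s)" for s
    by (rule DERIV_diff[OF der der])
  then have "tau F t0 P - tau F 0 P = tau F t0 0 - tau F 0 0"
    by (intro DERIV_isconst_all[rule_format, of "\<lambda>s. tau F t0 s - tau F 0 s"]) simp
  moreover have "tau F t0 (t + P) - tau F t0 t = tau F t0 (0 + P) - tau F t0 0"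
    by (rule DERIV_periodic_increment[OF der]) (use F(3) in \<open>simp add: periodic_def\<close>)
  ultimately show "tau F t0 (t + P) = tau F t0 t + I_F F P" by (simp add: I)
  have "tau F 0 0 < tau F 0 P"
    using \<open>0 < P\<close> by (rule DERIV_pos_imp_increasing) (metis der F(2) zero_less_divide_1_iff)
  then show "0 < I_F F P" by (simp add: I)
qed

text \<open>Projecting from the antipodes -x and -y keeps (x, y) away from the poles, at the centre
  of the chart.\<close>

lemma product_chart_at:
  fixes x :: "'a::euclidean_space" and y :: "'b::euclidean_space"
  assumes "norm x = 1" "norm y = 1" "card (I :: 'd::finite set) + 1 = DIM('a)" "card J + 1 = DIM('b)"
    and "UNIV = insert i0 (I \<union> J)" "i0 \<notin> I" "i0 \<notin> J" "I \<inter> J = {}"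
  obtains e f where "product_chart I e (- x) J f (- y) i0"
    and "(t, x, y) \<in> range (product_chart.\<phi> I e (- x) J f (- y) i0)"
proof -
  obtain e where e: "sphere_frame I e (- x)" using sphere_frame_exists[of "- x" I] assms by auto
  obtain f where f: "sphere_frame J f (- y)" using sphere_frame_exists[of "- y" J] assms by auto
  interpret product_chart I e "- x" J f "- y" i0
    using e f assms by (intro product_chart.intro product_chart_axioms.intro)
  have "(t, x, y) \<in> range \<phi>"
    unfolding image_\<phi> using assms(1,2) by (simp add: line_spheres_def norm_eq_1)
  then show thesis using that product_chart_axioms by blast
qed

lemma harmonic_into_sphere_join:
  fixes l1 l2 F \<alpha> \<alpha>' :: "real \<Rightarrow> real" and \<kappa> :: real
  assumes smooth: "smooth_on UNIV l1" "smooth_on UNIV l2" "smooth_on UNIV F" "smooth_on UNIV \<alpha>"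
    and pos: "\<And>t. 0 < l1 t" "\<And>t. 0 < l2 t"
    and vol: "\<And>t. l1 t ^ p * l2 t ^ q = F t"
    and rel: "\<And>t. real q / (l2 t)\<^sup>2 - real p / (l1 t)\<^sup>2 = \<kappa> / (F t)\<^sup>2"
    and der_\<alpha>: "\<And>t. (\<alpha> has_real_derivative \<alpha>' t) (at t)"
    and pendulum: "\<And>t. ((\<lambda>t. F t * \<alpha>' t) has_real_derivative \<kappa> * sin (\<alpha> t) * cos (\<alpha> t) / F t) (at t)"
    and dims: "2 \<le> p" "2 \<le> q" "DIM('a::euclidean_space) = p + 1" "DIM('b::euclidean_space) = q + 1"
      "CARD('d::finite) = p + q + 1"
  shows "harmonic_into_sphere TYPE('d) line_spheres
    (\<lambda>(t, x::'a, y::'b) (s, v, w) (s', v', w').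
      s * s' + (l1 t)\<^sup>2 * inner v v' + (l2 t)\<^sup>2 * inner w w')
    (\<lambda>(t, x, y). (cos (\<alpha> t) *\<^sub>R x, sin (\<alpha> t) *\<^sub>R y))"
    (is "harmonic_into_sphere _ _ ?g ?G")
  unfolding harmonic_into_sphere_def
proof (intro conjI ballI)
  show "?G ` line_spheres \<subseteq> sphere 0 1"
    by (auto simp: line_spheres_def norm_Pair power_mult_distrib)
next
  fix z :: "real \<times> 'a \<times> 'b" assume "z \<in> line_spheres"
  then obtain t x y where z: "z = (t, x, y)" "norm x = 1" "norm y = 1"
    by (cases z) (auto simp: line_spheres_def)
  obtain i0 :: 'd where "i0 \<in> UNIV" by blast
  have "p \<le> card (UNIV - {i0})" using dims(5) by simp
  then obtain I where I: "card I = p" "I \<subseteq> UNIV - {i0}"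
    using obtain_subset_with_card_n by metis
  define J where "J = UNIV - {i0} - I"
  have J: "card J = q" using I dims(5) by (simp add: J_def card_Diff_subset)
  have part: "UNIV = insert i0 (I \<union> J)" "i0 \<notin> I" "i0 \<notin> J" "I \<inter> J = {}"
    using I(2) by (auto simp: J_def)
  obtain e f where chart: "product_chart I e (- x) J f (- y) i0"
    and z_in: "z \<in> range (product_chart.\<phi> I e (- x) J f (- y) i0)"
    unfolding z(1) using product_chart_at[OF z(2,3) _ _ part, of t] dims(3,4) I(1) J by auto
  interpret product_chart I e "- x" J f "- y" i0 by fact
  note hyps = smooth pos vol[folded I(1) J] rel[folded I(1) J] der_\<alpha> pendulum dims(1,2)[folded I(1) J]
  show "\<exists>(U::(real^'d) set) \<phi>. local_param line_spheres U \<phi> \<and> z \<in> \<phi> ` U \<and> smooth_on U (?G \<circ> \<phi>) \<and>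
        (\<forall>u\<in>U. laplace_beltrami ?g \<phi> ?G u = - (energy_density ?g \<phi> ?G u *\<^sub>R ?G (\<phi> u)))"
    by (intro exI[of _ UNIV] exI[of _ \<phi>] conjI ballI local_param_\<phi> z_in
        smooth_G_\<phi>[OF hyps] laplace_beltrami_eq[OF hyps])
qed

lemma unit_multiple_exists:
  fixes a :: "'a::euclidean_space"
  obtains x where "norm x = 1" "a = norm a *\<^sub>R x"
proof (cases "a = 0")
  case True
  obtain x :: 'a where "norm x = 1" using vector_choose_size[of 1] by auto
  with True show thesis using that by simp
next
  case False
  then show thesis using that[of "(1 / norm a) *\<^sub>R a"] by simp
qed

text \<open>The pair (|a|, |b|) lies on the unit circle and so has an angle, which \<alpha> attains;
  x and y carry the directions, arbitrary ones where a block vanishes.\<close>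

lemma join_surj:
  assumes "surj \<alpha>"
  shows "sphere 0 1 \<subseteq> (\<lambda>(t, x, y). (cos (\<alpha> t) *\<^sub>R x, sin (\<alpha> t) *\<^sub>R y)) `
    (line_spheres :: (real \<times> 'a::euclidean_space \<times> 'b::euclidean_space) set)"
proof
  fix z :: "'a \<times> 'b" assume "z \<in> sphere 0 1"
  moreover obtain a b where z: "z = (a, b)" by (cases z)
  ultimately have "(norm a)\<^sup>2 + (norm b)\<^sup>2 = 1" by (simp add: norm_Pair)
  then obtain \<theta> where \<theta>: "norm a = cos \<theta>" "norm b = sin \<theta>" using sincos_total_2pi_le by blast
  obtain t where t: "\<theta> = \<alpha> t" using assms by (metis surjD)
  obtain x where x: "norm x = 1" "a = norm a *\<^sub>R x" by (rule unit_multiple_exists)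
  obtain y where y: "norm y = 1" "b = norm b *\<^sub>R y" by (rule unit_multiple_exists)
  have "z = (cos (\<alpha> t) *\<^sub>R x, sin (\<alpha> t) *\<^sub>R y)" using x(2) y(2) by (simp add: z \<theta> t)
  moreover have "(t, x, y) \<in> line_spheres" using x(1) y(1) by (simp add: line_spheres_def)
  ultimately show "z \<in> (\<lambda>(t, x, y). (cos (\<alpha> t) *\<^sub>R x, sin (\<alpha> t) *\<^sub>R y)) ` line_spheres"
    by (intro image_eqI[of _ _ "(t, x, y)"]) simp_all
qed

theorem theorem6p4:
  fixes p q :: nat and P \<kappa> t0 :: real and F :: "real \<Rightarrow> real"
  assumes "CARD('a::{finite,linorder}) = p + 1" and "CARD('b::{finite,linorder}) = q + 1"
    and "CARD('d::finite) = p + q + 1"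
    and "2 \<le> p" and "2 \<le> q" and "even p" and "even q"
    and "0 < P" and "smooth_on UNIV F" and "\<forall>t. 0 < F t" and "periodic P F"
  shows "\<forall>m::int. 1 \<le> m \<longrightarrow>
    (\<exists>\<Theta>::real \<Rightarrow> real. smooth_on UNIV \<Theta> \<and> (\<forall>s. \<Theta> (s + I_F F P) = \<Theta> s + 2 * pi * of_int m) \<and>
       (let G = (G_map F t0 \<Theta> :: real \<times> (real^'a::{finite,linorder}) \<times> (real^'b::{finite,linorder}) \<Rightarrow> (real^'a::{finite,linorder}) \<times> (real^'b::{finite,linorder})) in
          periodic_map P G \<and>
          harmonic_into_sphere TYPE('d) line_spheres (metric_F p q P F \<kappa>) G \<and>
          has_degree P G (4 * m) \<and>
          (\<forall>S. round_sphere S \<and> G ` line_spheres \<subseteq> S \<longrightarrow> sphere 0 1 \<subseteq> S)))"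
proof (intro allI impI)
  fix m :: int assume m: "1 \<le> m"
  have F: "smooth_on UNIV F" "\<And>t. 0 < F t" "periodic P F" using assms(9-11) by auto
  have pq: "0 < p" "0 < q" using assms(4,5) by auto
  obtain l1 l2 where l: "fibre_radii p q P F \<kappa> = (l1, l2)"
    and l_pos: "\<And>t. 0 < l1 t" "\<And>t. 0 < l2 t" and l_smooth: "smooth_on UNIV l1" "smooth_on UNIV l2"
    and vol: "\<And>t. l1 t ^ p * l2 t ^ q = F t"
    and rel: "\<And>t. real q / (l2 t)\<^sup>2 - real p / (l1 t)\<^sup>2 = \<kappa> / (F t)\<^sup>2"
    using fibre_radii_props[OF pq F] by metis
  note tau = tau_properties(1)[OF F assms(8), where ?t0.0 = t0] tau_properties(2)[OF F assms(8), where ?t0.0 = t0]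
    tau_properties(3)[OF F assms(8), where ?t0.0 = t0] tau_properties(4)[OF F assms(8)]
  obtain \<Theta> \<Theta>' where \<Theta>: "smooth_on UNIV \<Theta>" "\<And>s. \<Theta> (s + I_F F P) = \<Theta> s + 2 * pi * of_int m"
    and der_\<Theta>: "\<And>s. (\<Theta> has_real_derivative \<Theta>' s) (at s)" "\<And>s. 0 < \<Theta>' s"
    and der_\<Theta>': "\<And>s. (\<Theta>' has_real_derivative \<kappa> * sin (\<Theta> s) * cos (\<Theta> s)) (at s)"
    using pendulum_solution_exists[OF tau(4) m] by metis
  define \<alpha> where "\<alpha> = (\<lambda>t. \<Theta> (tau F t0 t))"
  define \<alpha>' where "\<alpha>' = (\<lambda>t. \<Theta>' (tau F t0 t) / F t)"
  have der_\<alpha>: "(\<alpha> has_real_derivative \<alpha>' t) (at t)" for t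
    using DERIV_chain2[OF der_\<Theta>(1) tau(1)] by (simp add: \<alpha>_def \<alpha>'_def)
  have \<alpha>'_pos: "0 < \<alpha>' t" for t using der_\<Theta>(2) F(2) by (simp add: \<alpha>'_def)
  \<comment> \<open>Multiplication by \<open>F\<close> undoes the factor 1/F of the derivative of
    \<open>tau\<close>, so the second t-derivative comes from a single application of the chain
    rule.\<close>
  have "F t * \<alpha>' t = \<Theta>' (tau F t0 t)" for t using F(2)[of t] by (simp add: \<alpha>'_def)
  then have pendulum: "((\<lambda>t. F t * \<alpha>' t) has_real_derivative \<kappa> * sin (\<alpha> t) * cos (\<alpha> t) / F t) (at t)" for t
    using DERIV_chain2[OF der_\<Theta>' tau(1)] by (simp add: \<alpha>_def)
  have \<alpha>_smooth: "smooth_on UNIV \<alpha>"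
    using \<Theta>(1) tau(2) unfolding smooth_on_def \<alpha>_def by (auto intro: Ck_on_compose_real)
  have step: "\<alpha> (t + P) = \<alpha> t + 2 * pi * real (nat m)" for t
    using m by (simp add: \<alpha>_def tau(3) \<Theta>(2))
  define G where "G = (G_map F t0 \<Theta> :: real \<times> (real^'a::{finite,linorder}) \<times> (real^'b::{finite,linorder}) \<Rightarrow> (real^'a::{finite,linorder}) \<times> (real^'b::{finite,linorder}))"
  have G: "G = (\<lambda>(t, x, y). (cos (\<alpha> t) *\<^sub>R x, sin (\<alpha> t) *\<^sub>R y))"
    unfolding G_def G_map_def \<alpha>_def ..
  have "cos (\<alpha> (t + P)) = cos (\<alpha> t)" "sin (\<alpha> (t + P)) = sin (\<alpha> t)" for t
    using sin_int_2pin[of m] cos_int_2pin[of m] m by (simp_all add: step cos_add sin_add)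
  then have "periodic_map P G" by (simp add: periodic_map_def G)
  moreover have "metric_F p q P F \<kappa> = (\<lambda>(t, x::real^'a::{finite,linorder}, y::real^'b::{finite,linorder}) (s, v, w) (s', v', w').
      s * s' + (l1 t)\<^sup>2 * inner v v' + (l2 t)\<^sup>2 * inner w w')"
    by (simp add: metric_F_def l)
  then have "harmonic_into_sphere TYPE('d) line_spheres (metric_F p q P F \<kappa>) G"
    unfolding G using assms(1-5)
    by (simp add: harmonic_into_sphere_join[OF l_smooth F(1) \<alpha>_smooth l_pos vol rel der_\<alpha> pendulum])
  moreover have "has_degree P G (4 * m)"
    using has_degree_G[OF der_\<alpha> \<alpha>'_pos step assms(8), of G] assms(1,2,4-7) m by (simp add: G)
  moreover have "surj \<alpha>"
    using \<alpha>_surj[OF der_\<alpha> \<alpha>'_pos step assms(8), of G] m by (simp add: G)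
  \<comment> \<open>The image contains the entire unit sphere, hence so does every round sphere that
    contains the image.\<close>
  from join_surj[OF this] have "\<forall>S. round_sphere S \<and> G ` line_spheres \<subseteq> S \<longrightarrow> sphere 0 1 \<subseteq> S"
    unfolding G by (blast intro: subset_trans)
  ultimately show "\<exists>\<Theta>. smooth_on UNIV \<Theta> \<and> (\<forall>s. \<Theta> (s + I_F F P) = \<Theta> s + 2 * pi * of_int m) \<and>
       (let G = (G_map F t0 \<Theta> :: real \<times> (real^'a::{finite,linorder}) \<times> (real^'b::{finite,linorder}) \<Rightarrow> (real^'a::{finite,linorder}) \<times> (real^'b::{finite,linorder})) in
          periodic_map P G \<and>
          harmonic_into_sphere TYPE('d) line_spheres (metric_F p q P F \<kappa>) G \<and>
          has_degree P G (4 * m) \<and>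
          (\<forall>S. round_sphere S \<and> G ` line_spheres \<subseteq> S \<longrightarrow> sphere 0 1 \<subseteq> S))"
    using \<Theta> unfolding Let_def G_def[symmetric] by (intro exI[of _ \<Theta>]) (simp add: G_def)
qed

end
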